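(* Let $\alpha\in\Sigma$ (with $\Sigma$ as defined in the context) be fixed. Then the set of $V\in C^\infty(\mathbb{T},\mathbb{R})$ for which the Schrödinger cocycle $(\alpha,A_V)$, where $A_V(\theta)=\begin{pmatrix}V(\theta)&1\\-1&0\end{pmatrix}$, has positive Lyapunov exponent $\lambda(\alpha,A_V)>0$ is $C^\infty$-dense in $C^\infty(\mathbb{T},\mathbb{R})$.
   Context: $\mathbb{T}=\mathbb{R}/\mathbb{Z}$; for $A:\mathbb{T}\to SL(2,\mathbb{R})$, $(\alpha,A)$ is the map $(\theta,y)\mapsto(\theta+\alpha,A(\theta)y)$ of $\mathbb{T}\times SL(2,\mathbb{R})$. With $A_n(\theta)=A(\theta+(n-1)\alpha)\cdots A(\theta)$ for $n\ge1$, the Lyapunov exponent is $\lambda(\alpha,A)=\lim_{n\to\infty}\frac1n\int_{\mathbb{T}}\log\|A_n(\theta)\|\,d\theta$. **The set $\Sigma$.** For $\gamma>0,\sigma>1$ let $CD(\gamma,\sigma)=\{\alpha\in\mathbb{R}/\mathbb{Z}:\ \forall k\in\mathbb{Z}\setminus\{0\},\ \min_{l\in\mathbb{Z}}|k\alpha-l|\ge\gamma^{-1}|k|^{-\sigma}\}$. Let $G(x)=\{1/x\}$ (fractional part) be the Gauss map on $(0,1)$ and $m=\frac{1}{\log2}\frac{dx}{1+x}$ the Gauss measure. Fix $\sigma>1$ and then $\gamma$ large enough that $m(CD(\gamma,\sigma)\cap G^{-1}(CD(\gamma,\sigma)))>1-m((\frac15,\frac14]\cap G^{-1}((\frac15,\frac14]))$.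 Then $\Sigma$ is the set of $\alpha\in(0,1)$ (identified with points of $\mathbb{T}$) such that for every $N\in\mathbb{N}$ there is $k\ge N$ with $G^k(\alpha)$ and $G^{k+1}(\alpha)$ both in $CD(\gamma,\sigma)\cap(\frac15,\frac14]$. *)

theory Defs
  imports "HOL-Analysis.Analysis"
begin

section \<open>Smooth functions on the circle\<close>

text \<open>Functions on \<open>\<real>/\<int>\<close> are represented by 1-periodic functions on the real line.\<close>

definition smooth_circle :: "(real \<Rightarrow> real) set" where
  "smooth_circle =
    {V. (\<forall>x. V (x + 1) = V x) \<and> (\<forall>n. (deriv ^^ n) V differentiable_on UNIV)}"

definition Cr_norm :: "nat \<Rightarrow> (real \<Rightarrow> real) \<Rightarrow> real" where
  "Cr_norm r V = (MAX k\<in>{..r}. SUP x. \<bar>(deriv ^^ k) V x\<bar>)"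

definition Cr_ball :: "nat \<Rightarrow> (real \<Rightarrow> real) \<Rightarrow> real \<Rightarrow> (real \<Rightarrow> real) set" where
  "Cr_ball r V \<epsilon> = {W \<in> smooth_circle. Cr_norm r (\<lambda>x. W x - V x) < \<epsilon>}"

text \<open>The \<open>C\<^sup>\<infinity>\<close> topology, in which the \<open>C\<^sup>r\<close>-balls, for all finite \<open>r\<close>, around a
  function form a neighbourhood basis of that function.\<close>

definition smooth_circle_topology :: "(real \<Rightarrow> real) topology" where
  "smooth_circle_topology =
    topology (\<lambda>U. U \<subseteq> smooth_circle \<and> (\<forall>V\<in>U. \<exists>r. \<exists>\<epsilon>>0. Cr_ball r V \<epsilon> \<subseteq> U))"

lemma Cr_norm_mono: "r \<le> s \<Longrightarrow> Cr_norm r V \<le> Cr_norm s V"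
  unfolding Cr_norm_def by (rule Max_mono) auto

lemma Cr_ball_mono: "r \<le> s \<Longrightarrow> \<epsilon> \<le> \<delta> \<Longrightarrow> Cr_ball s V \<epsilon> \<subseteq> Cr_ball r V \<delta>"
  unfolding Cr_ball_def
proof (intro Collect_mono impI conjI; elim conjE)
  fix W
  assume "r \<le> s" "\<epsilon> \<le> \<delta>" "Cr_norm s (\<lambda>x. W x - V x) < \<epsilon>"
  then show "Cr_norm r (\<lambda>x. W x - V x) < \<delta>"
    using Cr_norm_mono[of r s "\<lambda>x. W x - V x"] by linarith
qed simp

lemma istopology_smooth_circle:
  "istopology (\<lambda>U. U \<subseteq> smooth_circle \<and> (\<forall>V\<in>U. \<exists>r. \<exists>\<epsilon>>0. Cr_ball r V \<epsilon> \<subseteq> U))"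
    (is "istopology ?O")
  unfolding istopology_def
proof (rule conjI; intro allI impI)
  fix S T assume S: "?O S" and T: "?O T"
  show "?O (S \<inter> T)"
  proof (intro conjI ballI)
    show "S \<inter> T \<subseteq> smooth_circle" using S by blast
    fix V assume V: "V \<in> S \<inter> T"
    obtain r \<epsilon> where r: "\<epsilon> > 0" "Cr_ball r V \<epsilon> \<subseteq> S" using S V by blast
    obtain s \<delta> where s: "\<delta> > 0" "Cr_ball s V \<delta> \<subseteq> T" using T V by blast
    have "Cr_ball (max r s) V (min \<epsilon> \<delta>) \<subseteq> Cr_ball r V \<epsilon>"
      "Cr_ball (max r s) V (min \<epsilon> \<delta>) \<subseteq> Cr_ball s V \<delta>"
      by (rule Cr_ball_mono; simp)+
    then have "Cr_ball (max r s) V (min \<epsilon> \<delta>) \<subseteq> S \<inter> T" using r s by blast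
    moreover have "min \<epsilon> \<delta> > 0" using r s by simp
    ultimately show "\<exists>r. \<exists>\<epsilon>>0. Cr_ball r V \<epsilon> \<subseteq> S \<inter> T" by blast
  qed
next
  fix K assume K: "\<forall>U\<in>K. ?O U"
  show "?O (\<Union>K)"
  proof (intro conjI ballI)
    show "\<Union>K \<subseteq> smooth_circle" using K by blast
    fix V assume "V \<in> \<Union>K"
    then obtain U where U: "U \<in> K" "V \<in> U" by blast
    then obtain r \<epsilon> where "\<epsilon> > 0" "Cr_ball r V \<epsilon> \<subseteq> U" using K by blast
    then show "\<exists>r. \<exists>\<epsilon>>0. Cr_ball r V \<epsilon> \<subseteq> \<Union>K" using U by blast
  qed
qed

lemma openin_smooth_circle:
  "openin smooth_circle_topology U \<longleftrightarrow>
    U \<subseteq> smooth_circle \<and> (\<forall>V\<in>U. \<exists>r. \<exists>\<epsilon>>0. Cr_ball r V \<epsilon> \<subseteq> U)"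
  unfolding smooth_circle_topology_def
  by (simp add: topology_inverse'[OF istopology_smooth_circle])

lemma topspace_smooth_circle: "topspace smooth_circle_topology = smooth_circle"
proof
  show "topspace smooth_circle_topology \<subseteq> smooth_circle"
    using openin_smooth_circle openin_topspace by blast
  have "openin smooth_circle_topology smooth_circle"
    unfolding openin_smooth_circle Cr_ball_def using zero_less_one by blast
  then show "smooth_circle \<subseteq> topspace smooth_circle_topology"
    by (rule openin_subset)
qed


section \<open>Cocycles and the Lyapunov exponent\<close>

primrec cocycle_iter :: "real \<Rightarrow> (real \<Rightarrow> real^2^2) \<Rightarrow> nat \<Rightarrow> real \<Rightarrow> real^2^2" where
  "cocycle_iter \<alpha> A 0 \<theta> = mat 1"
| "cocycle_iter \<alpha> A (Suc n) \<theta> = A (\<theta> + real n * \<alpha>) ** cocycle_iter \<alpha> A n \<theta>"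

text \<open>The matrix norm is the Euclidean operator norm; the value of the limit does not depend on
  this choice. For continuous 1-periodic \<open>A\<close> with values in \<open>SL(2,\<real>)\<close> the limit exists by
  subadditivity.\<close>

definition lyapunov :: "real \<Rightarrow> (real \<Rightarrow> real^2^2) \<Rightarrow> real" where
  "lyapunov \<alpha> A =
    lim (\<lambda>n. 1 / real n * (LBINT \<theta>:{0..1}. ln (onorm ((*v) (cocycle_iter \<alpha> A n \<theta>)))))"

definition schrodinger :: "(real \<Rightarrow> real) \<Rightarrow> real \<Rightarrow> real^2^2" where
  "schrodinger V \<theta> = vector [vector [V \<theta>, 1], vector [-1, 0]]"

lemma det_schrodinger: "det (schrodinger V \<theta>) = 1"
  by (simp add: schrodinger_def det_2)


section \<open>Diophantine numbers, the Gauss map and the frequency set\<close>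

definition CD :: "real \<Rightarrow> real \<Rightarrow> real set" where
  "CD \<gamma> \<sigma> = {\<alpha>. \<forall>k::int. k \<noteq> 0 \<longrightarrow>
    (INF l::int. \<bar>of_int k * \<alpha> - of_int l\<bar>) \<ge> inverse \<gamma> * \<bar>of_int k\<bar> powr (- \<sigma>)}"

definition gauss_map :: "real \<Rightarrow> real" where
  "gauss_map x = frac (1 / x)"

definition gauss_measure :: "real measure" where
  "gauss_measure =
    density lborel (\<lambda>x. ennreal (indicator {0<..<1} x * (1 / ln 2) * (1 / (1 + x))))"

text \<open>The preimage \<open>G\<^sup>-\<^sup>1(S)\<close> under the Gauss map with domain \<open>(0,1)\<close>.\<close>

definition gauss_preimage :: "real set \<Rightarrow> real set" where
  "gauss_preimage S = gauss_map -` S \<inter> {0<..<1}"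

text \<open>For rational \<open>\<alpha>\<close> the orbit under \<^const>\<open>gauss_map\<close> is eventually 0 (as \<open>1 / 0 = 0\<close>), so
  rational numbers do not belong to the following set.\<close>

definition Sigma_freq :: "real \<Rightarrow> real \<Rightarrow> real set" where
  "Sigma_freq \<gamma> \<sigma> = {\<alpha> \<in> {0<..<1}. \<forall>N. \<exists>k\<ge>N.
    (gauss_map ^^ k) \<alpha> \<in> CD \<gamma> \<sigma> \<inter> {1/5<..1/4} \<and>
    (gauss_map ^^ (k + 1)) \<alpha> \<in> CD \<gamma> \<sigma> \<inter> {1/5<..1/4}}"

end

theory Submission
  imports Defs "HOL-Complex_Analysis.Complex_Analysis"
begin

text \<open>
  The frequency \<open>\<alpha>\<close> is irrational: some iterate of \<open>\<alpha>\<close> under the Gauss map is Diophantine, hence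
  irrational, and the Gauss map preserves rationality. Fix a smooth \<open>V\<close> and suppose that every
  potential in some \<open>C\<^sup>r\<close>-ball around \<open>V\<close> has exponent \<open>\<le> 0\<close>; this leads to a contradiction.

  \<^bold>\<open>Complexification.\<close> If \<open>Im v > 0\<close>, the Moebius maps \<open>w \<mapsto> v(\<theta>) - 1/w\<close> contract the hyperbolic
  metric of the upper half-plane, so they have a unique invariant section, \<open>m_past\<close>. The exponent
  becomes the real part of \<open>\<Lambda>(v) = \<integral> Ln m_past\<close> (\<open>complex_exponent\<close>). An exact formula for
  \<open>\<Lambda>(v') - \<Lambda>(v)\<close> in terms of the Green function (\<open>complex_exponent_diff\<close>) gives both the
  holomorphy of \<open>\<Lambda>\<close> and its second order expansion.

  \<^bold>\<open>Reflection.\<close> For small real functions \<open>b\<close> consider the potentials \<open>V + z + (R\<^sup>2 - z\<^sup>2)\<^sup>3 b\<close> with \<open>z\<close>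
  in the upper half disc of radius \<open>R\<close>. For real \<open>z\<close> they lie in the ball, so their exponents vanish,
  and since the exponent is bounded by averages of \<open>ln \<parallel>A\<^sub>n\<parallel> / n\<close> that are continuous up to the diameter,
  \<open>Re \<Lambda> \<rightarrow> 0\<close> there (\<open>complex_exponent_boundary_zero\<close>). Therefore \<open>\<Lambda>\<close>, as a function of \<open>z\<close>, continues to the whole disc by
  Schwarz reflection, and Cauchy's formula recovers it from its values on the upper half circle
  alone (\<open>reflection_formula\<close>). This relation is linear over the reals and stable under bounded
  pointwise limits.

  \<^bold>\<open>Variation.\<close> The factor \<open>(R\<^sup>2 - z\<^sup>2)\<^sup>3\<close> is of order \<open>(Im z)\<^sup>3\<close> on the half circle. It keeps the normalised
  first and second differences of \<open>\<Lambda>\<close> in the direction \<open>b\<close> bounded up to the end points \<open>\<plusminus>R\<close>, where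
  the contraction is lost. Take \<open>b = \<plusminus>s\<^sub>n (sin \<pi>\<theta>)\<^sup>2\<^sup>n\<close> with \<open>s\<^sub>n \<rightarrow> 0\<close> fast. The first differences tend
  to \<open>g(z) = (R\<^sup>2 - z\<^sup>2)\<^sup>3 G(z)\<close>, where \<open>G\<close> is the diagonal Green function at \<open>\<theta> = 1/2\<close>, and the second
  differences tend to \<open>-g\<^sup>2\<close>: as \<open>\<alpha>\<close> is irrational, the bump does not meet its translates by
  multiples of \<open>\<alpha>\<close>, so only the diagonal term survives (\<open>second_variation_limit\<close>).

  \<^bold>\<open>Contradiction.\<close> Both \<open>g\<close> and \<open>g\<^sup>2\<close> now satisfy the reflection relation, so the continuations of both are purely
  imaginary on the diameter. A number which is imaginary together with its square is \<open>0\<close>; so \<open>g = 0\<close>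
  (\<open>reflection_square_zero\<close>). But a Green function has no zeros in the upper half-plane.
\<close>

section \<open>A reflection formula on the half disc\<close>

text \<open>Only half discs of radius at most 1 are used below; the radius 2 leaves room to shift them
  upwards.\<close>
definition half_disc_nbhd :: "complex set" where
  "half_disc_nbhd = {z. 0 < Im z \<and> cmod z < 2}"

lemma open_half_disc_nbhd: "open half_disc_nbhd"
proof -
  have "half_disc_nbhd = {z. 0 < Im z} \<inter> ball 0 2"
    by (auto simp: half_disc_nbhd_def)
  then show ?thesis by (metis open_halfspace_Im_gt open_Int open_ball)
qed

lemma arc_has_integral:
  assumes "0 < R" "a < b" "continuous_on (sphere 0 R) f"
  shows "(f has_contour_integral integral {a..b} (\<lambda>t. f (R * cis t) * (\<i> * R * cis t)))
           (part_circlepath 0 R a b)"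
    and "(\<lambda>t. f (R * cis t) * (\<i> * R * cis t)) integrable_on {a..b}"
proof -
  have *: "continuous_on {a..b} (\<lambda>t. f (R * cis t) * (\<i> * R * cis t))"
    by (intro continuous_intros continuous_on_compose2[OF assms(3)])
      (use assms in \<open>auto simp: norm_mult\<close>)
  then show i: "(\<lambda>t. f (R * cis t) * (\<i> * R * cis t)) integrable_on {a..b}"
    using integrable_continuous_real by blast
  show "(f has_contour_integral integral {a..b} (\<lambda>t. f (R * cis t) * (\<i> * R * cis t)))
           (part_circlepath 0 R a b)"
    unfolding has_contour_integral_part_circlepath_iff[OF assms(2)]
    using integrable_integral[OF i] by (simp add: mult_ac)
qed

lemma exp_i_2pi: "exp (\<i> * (2 * complex_of_real pi)) = 1"
  using exp_two_pi_i by (simp add: mult_ac)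

text \<open>The two closed half circles sharing the diameter add up to the full circle, and the lower one
  does not wind around a point of the upper half-plane.\<close>
lemma half_circle_winding:
  fixes \<zeta> :: complex
  assumes R: "0 < R" and z: "0 < Im \<zeta>" "cmod \<zeta> < R"
  shows "contour_integral (part_circlepath 0 R 0 pi +++ linepath (-of_real R) (of_real R)) (\<lambda>w. 1 / (w - \<zeta>))
    = 2 * pi * \<i>"
proof -
  let ?f = "\<lambda>w. 1 / (w - \<zeta>)"
  have c: "continuous_on (sphere 0 R) ?f"
    by (intro continuous_intros) (use z in auto)
  have lin: "continuous_on (closed_segment (-of_real R) (of_real R)) ?f"
    by (intro continuous_intros)
      (use z in \<open>auto simp: closed_segment_same_Im in_segment complex_eq_iff\<close>)
  have li: "?f contour_integrable_on linepath (-of_real R) (of_real R)"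
    using contour_integrable_continuous_linepath[OF lin] .
  note A = arc_has_integral[OF R _ c]
  have 1: "(?f has_contour_integral 2 * pi * \<i>) (circlepath 0 R)"
    using Cauchy_integral_circlepath_simple[of "\<lambda>_. 1" 0 R \<zeta>] z by simp
  have "(?f has_contour_integral
     integral {0..2*pi} (\<lambda>t. ?f (R * cis t) * (\<i> * R * cis t))) (circlepath 0 R)"
    using A(1)[of 0 "2*pi"] by (simp add: circlepath_def)
  then have "2 * pi * \<i> = integral {0..2*pi} (\<lambda>t. ?f (R * cis t) * (\<i> * R * cis t))"
    using 1 contour_integral_unique by metis
  also have "\<dots> = integral {0..pi} (\<lambda>t. ?f (R * cis t) * (\<i> * R * cis t)) +
      integral {pi..2*pi} (\<lambda>t. ?f (R * cis t) * (\<i> * R * cis t))"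
    by (rule Henstock_Kurzweil_Integration.integral_combine[symmetric]) (use A(2)[of 0 "2*pi"] in auto)
  also have "\<dots> = contour_integral (part_circlepath 0 R 0 pi) ?f +
      contour_integral (part_circlepath 0 R pi (2*pi)) ?f"
    using A(1)[of 0 pi] A(1)[of pi "2*pi"] by (simp add: contour_integral_unique)
  finally have 2: "contour_integral (part_circlepath 0 R 0 pi) ?f +
      contour_integral (part_circlepath 0 R pi (2*pi)) ?f = 2 * pi * \<i>" by simp
  have "(?f has_contour_integral 0) (part_circlepath 0 R pi (2*pi) +++ linepath (of_real R) (-of_real R))"
  proof (rule Cauchy_theorem_convex_simple)
    show "?f holomorphic_on {w. Im w < Im \<zeta>}"
      by (intro holomorphic_intros) auto
    show "convex {w. Im w < Im \<zeta>}" by (rule convex_halfspace_Im_lt)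
    show "valid_path (part_circlepath 0 R pi (2*pi) +++ linepath (of_real R) (-of_real R))"
      by (intro valid_path_join) (auto simp: exp_i_2pi simp flip: cis_conv_exp)
    have "Im x < Im \<zeta>" if "x \<in> path_image (part_circlepath 0 R pi (2*pi))" for x
    proof -
      from that obtain t where t: "pi \<le> t" "t \<le> 2*pi" "x = R * exp (\<i> * t)"
        unfolding path_image_part_circlepath'
        by (auto simp: closed_segment_eq_real_ivl cis_conv_exp)
      have "sin t \<le> 0"
        using t sin_le_zero[of t] by (cases "t = 2*pi") auto
      then have "Im x \<le> 0" using t R by (simp add: Im_exp mult_nonneg_nonpos)
      then show ?thesis using z by simp
    qed
    moreover have "Im x < Im \<zeta>" if "x \<in> path_image (linepath (of_real R) (-of_real R))" for x
      using that z by (auto simp: in_segment complex_eq_iff)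
    ultimately show "path_image (part_circlepath 0 R pi (2*pi) +++ linepath (of_real R) (-of_real R))
       \<subseteq> {w. Im w < Im \<zeta>}"
      by (auto simp: path_image_join exp_i_2pi simp flip: cis_conv_exp)
  qed (auto simp: exp_i_2pi simp flip: cis_conv_exp)
  then have 3: "contour_integral (part_circlepath 0 R pi (2*pi)) ?f =
     contour_integral (linepath (-of_real R) (of_real R)) ?f"
  proof -
    have li': "?f contour_integrable_on linepath (of_real R) (-of_real R)"
      using contour_integrable_continuous_linepath[of "of_real R" "-of_real R" ?f] lin
      by (simp add: closed_segment_commute)
    have "contour_integral (part_circlepath 0 R pi (2*pi) +++ linepath (of_real R) (-of_real R)) ?f = 
      contour_integral (part_circlepath 0 R pi (2*pi)) ?f +
      contour_integral (linepath (of_real R) (-of_real R)) ?f"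
      using A(1)[of pi "2*pi"] li' contour_integrable_on_def
      by (intro contour_integral_join) auto
    then show ?thesis
      using contour_integral_unique[OF \<open>(?f has_contour_integral 0) _\<close>]
        contour_integral_reverse_linepath[OF lin]
      by (metis eq_neg_iff_add_eq_0)
  qed
  show ?thesis using 2 3 A(1)[of 0 pi] li
    by (subst contour_integral_join) (auto simp: contour_integrable_on_def)
qed

text \<open>Cauchy's formula on the half disc, written with ordinary integrals so that limits can be taken
  by dominated convergence. The case \<open>Im \<zeta> < 0\<close>, with value 0, is what makes the reflection possible: it is
  used at the mirror image of the point of interest.\<close>
lemma half_disc_Cauchy_formula:
  fixes \<zeta> :: complex
  assumes R: "0 < R" "R < R'" and z: "Im \<zeta> \<noteq> 0" "cmod \<zeta> < R" and e: "e > 0"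
    and f: "f holomorphic_on {w. - e < Im w \<and> cmod w < R'}"
  shows "integral {0..pi} (\<lambda>t. f (R * cis t) * (\<i> * R * cis t / (R * cis t - \<zeta>))) +
      integral {-R..R} (\<lambda>x. f (of_real x) / (of_real x - \<zeta>))
      = (if 0 < Im \<zeta> then 2 * pi * \<i> * f \<zeta> else 0)"
proof -
  let ?S = "{w. - e < Im w \<and> cmod w < R'}"
  let ?g = "part_circlepath 0 R 0 pi +++ linepath (-of_real R) (of_real R)"
  have S: "?S = {w. - e < Im w} \<inter> ball 0 R'" by auto
  have cS: "convex ?S" unfolding S
    by (intro convex_Int convex_halfspace_Im_gt convex_ball)
  have oS: "open ?S" unfolding S by (simp add: open_halfspace_Im_gt open_Int)
  have vp: "valid_path ?g"
    by (intro valid_path_join) (auto simp: exp_i_2pi simp flip: cis_conv_exp)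
  have closed: "pathfinish ?g = pathstart ?g"
    by (auto simp: exp_i_2pi simp flip: cis_conv_exp)
  have im1: "Im x \<ge> 0 \<and> cmod x = R" if "x \<in> path_image (part_circlepath 0 R 0 pi)" for x
  proof -
    from that obtain t where t: "0 \<le> t" "t \<le> pi" "x = R * exp (\<i> * t)"
      unfolding path_image_part_circlepath'
      by (auto simp: closed_segment_eq_real_ivl cis_conv_exp)
    then show ?thesis using R by (simp add: Im_exp sin_ge_zero norm_mult)
  qed
  have im2: "Im x = 0 \<and> cmod x \<le> R" if "x \<in> path_image (linepath (-of_real R) (of_real R))" for x
  proof -
    have "closed_segment (-of_real R) (of_real R) \<subseteq> cball (0::complex) R"
      using R by (intro closed_segment_subset) auto
    moreover have "Im x = 0" using that by (auto simp: in_segment)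
    ultimately show ?thesis using that by auto
  qed
  have pi: "path_image ?g = path_image (part_circlepath 0 R 0 pi) \<union> path_image (linepath (-of_real R) (of_real R))"
    by (intro path_image_join) (auto simp: exp_i_2pi simp flip: cis_conv_exp)
  have sub: "path_image ?g \<subseteq> ?S - {\<zeta>}"
    unfolding pi using im1 im2 R z e by fastforce
  have fc: "continuous_on ?S f" using f holomorphic_on_imp_continuous_on by blast
  have c: "continuous_on (path_image (part_circlepath 0 R 0 pi)) (\<lambda>w. f w / (w - \<zeta>))"
    by (intro continuous_intros continuous_on_subset[OF fc]) (use sub pi in auto)
  have l: "continuous_on (closed_segment (-of_real R) (of_real R)) (\<lambda>w. f w / (w - \<zeta>))"
    by (intro continuous_intros continuous_on_subset[OF fc]) (use sub pi in auto)
  have 1: "(\<lambda>w. f w / (w - \<zeta>)) contour_integrable_on part_circlepath 0 R 0 pi"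
    using contour_integrable_continuous_part_circlepath[OF c] .
  have 2: "(\<lambda>w. f w / (w - \<zeta>)) contour_integrable_on linepath (-of_real R) (of_real R)"
    using contour_integrable_continuous_linepath[OF l] .
  have "contour_integral ?g (\<lambda>w. f w / (w - \<zeta>)) = 
    contour_integral (part_circlepath 0 R 0 pi) (\<lambda>w. f w / (w - \<zeta>))
    + contour_integral (linepath (-of_real R) (of_real R)) (\<lambda>w. f w / (w - \<zeta>))"
    using 1 2 by (intro contour_integral_join) auto
  also have "contour_integral (part_circlepath 0 R 0 pi) (\<lambda>w. f w / (w - \<zeta>)) =
    integral {0..pi} (\<lambda>t. f (R * cis t) * (\<i> * R * cis t / (R * cis t - \<zeta>)))"
    by (subst contour_integral_part_circlepath_eq) (auto simp: mult_ac)
  also have "contour_integral (linepath (-of_real R) (of_real R)) (\<lambda>w. f w / (w - \<zeta>)) = 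
    integral {-R..R} (\<lambda>x. f (of_real x) / (of_real x - \<zeta>))"
    using R by (subst contour_integral_linepath_Reals_eq) auto
  finally have A: "contour_integral ?g (\<lambda>w. f w / (w - \<zeta>)) =
    integral {0..pi} (\<lambda>t. f (R * cis t) * (\<i> * R * cis t / (R * cis t - \<zeta>))) +
      integral {-R..R} (\<lambda>x. f (of_real x) / (of_real x - \<zeta>))" .
  show ?thesis
  proof (cases "0 < Im \<zeta>")
    case True
    have zS: "\<zeta> \<in> interior ?S" using oS True z R e by (auto simp: interior_open)
    have i1: "((\<lambda>w. 1 / (w-\<zeta>)) has_contour_integral (2*pi * \<i> * winding_number ?g \<zeta> * 1)) ?g"
      using sub vp closed by (intro Cauchy_integral_formula_convex_simple[OF cS _ zS]) auto
    then have "winding_number ?g \<zeta> = 1"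
      using half_circle_winding[OF R(1) True z(2)] contour_integral_unique[OF i1] by simp
    then show ?thesis
      using Cauchy_integral_formula_convex_simple[OF cS f zS vp sub closed] True A
      by (simp add: contour_integral_unique)
  next
    case False
    define e' where "e' = min e (- Im \<zeta>)"
    have "((\<lambda>w. f w / (w - \<zeta>)) has_contour_integral 0) ?g"
    proof (rule Cauchy_theorem_convex_simple[OF _ _ vp _ closed])
      have e': "{w. - e' < Im w \<and> cmod w < R'} = {w. - e' < Im w} \<inter> ball 0 R'" by auto
      show "convex {w. - e' < Im w \<and> cmod w < R'}" unfolding e'
        by (intro convex_Int convex_halfspace_Im_gt convex_ball)
      show "(\<lambda>w. f w / (w - \<zeta>)) holomorphic_on {w. - e' < Im w \<and> cmod w < R'}"
        by (intro holomorphic_intros holomorphic_on_subset[OF f]) (auto simp: e'_def)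
      have "e' > 0" using e z False by (auto simp: e'_def)
      then show "path_image ?g \<subseteq> {w. - e' < Im w \<and> cmod w < R'}"
        unfolding pi using im1 im2 R by fastforce
    qed
    then show ?thesis using A False by (simp add: contour_integral_unique)
  qed
qed

text \<open>The Cauchy integral of \<open>f\<close> over the upper half circle of radius \<open>R\<close>. The end points are left out,
  since the functions of interest are controlled only for \<open>Im z > 0\<close>.\<close>
definition arc_cauchy :: "real \<Rightarrow> (complex \<Rightarrow> complex) \<Rightarrow> complex \<Rightarrow> complex" where
  "arc_cauchy R f \<zeta> =
    integral {0<..<pi} (\<lambda>t. f (R * cis t) * (\<i> * R * cis t / (R * cis t - \<zeta>)))"

lemma bounded_continuous_integrable:
  fixes f :: "real \<Rightarrow> complex"
  assumes "continuous_on {a<..<b} f" and "\<And>t. a < t \<Longrightarrow> t < b \<Longrightarrow> cmod (f t) \<le> B"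
  shows "f integrable_on {a<..<b}"
proof (rule measurable_bounded_by_integrable_imp_integrable)
  show "f \<in> borel_measurable (lebesgue_on {a<..<b})"
    using assms(1) by (rule continuous_imp_measurable_on_sets_lebesgue) auto
  show "(\<lambda>x. B) integrable_on {a<..<b}"
    using integrable_const_ivl[of B a b] by (simp add: integrable_on_open_interval_real)
qed (use assms(2) in auto)

text \<open>Integrability of the limit is part of the conclusion, because the limits of the variations below
  are not known to be continuous on the arc a priori.\<close>
lemma arc_dominated_convergence:
  fixes f :: "nat \<Rightarrow> real \<Rightarrow> complex"
  assumes c: "\<And>n. continuous_on {0<..<pi} (f n)" and B: "\<And>n t. 0 < t \<Longrightarrow> t < pi \<Longrightarrow> cmod (f n t) \<le> B"
    and lim: "\<And>t. 0 < t \<Longrightarrow> t < pi \<Longrightarrow> (\<lambda>n. f n t) \<longlonglongrightarrow> g t"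
    and K: "continuous_on {0..pi} K"
  shows "(\<lambda>t. g t * K t) integrable_on {0<..<pi}"
    and "(\<lambda>n. integral {0<..<pi} (\<lambda>t. f n t * K t)) \<longlonglongrightarrow> integral {0<..<pi} (\<lambda>t. g t * K t)"
proof -
  obtain C where C: "\<And>t. t \<in> {0..pi} \<Longrightarrow> cmod (K t) \<le> C"
    using compact_imp_bounded[OF compact_continuous_image[OF K compact_Icc]]
    unfolding bounded_iff by (metis imageI)
  have b: "cmod (f n t * K t) \<le> B * C" if "0 < t" "t < pi" for n t
    using B[OF that] C[of t] that order_trans[OF norm_ge_zero B[OF that]] 
    by (auto simp: norm_mult intro!: mult_mono)
  have i: "(\<lambda>t. f n t * K t) integrable_on {0<..<pi}" for n
    by (rule bounded_continuous_integrable[OF _ b])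
      (auto intro!: continuous_intros c continuous_on_subset[OF K])
  have h: "(\<lambda>x. B * C) integrable_on {0<..<pi}"
    using integrable_const_ivl[of "B*C" 0 pi] by (simp add: integrable_on_open_interval_real)
  have l: "(\<lambda>n. f n t * K t) \<longlonglongrightarrow> g t * K t" if "t \<in> {0<..<pi}" for t
    using that by (intro tendsto_intros lim) auto
  have b': "cmod (f n t * K t) \<le> B * C" if "t \<in> {0<..<pi}" for n t using b that by auto
  show "(\<lambda>t. g t * K t) integrable_on {0<..<pi}"
    by (rule dominated_convergence(1)[OF i h b' l])
  show "(\<lambda>n. integral {0<..<pi} (\<lambda>t. f n t * K t)) \<longlonglongrightarrow> integral {0<..<pi} (\<lambda>t. g t * K t)"
    by (rule dominated_convergence(2)[OF i h b' l])
qed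

lemma arc_kernel_continuous:
  assumes "cmod \<zeta> < R"
  shows "continuous_on S (\<lambda>t. \<i> * R * cis t / (R * cis t - \<zeta>))"
proof -
  have "R * cis t \<noteq> \<zeta>" for t using assms by (auto simp: norm_mult)
  then show ?thesis by (intro continuous_intros) auto
qed

text \<open>Adding the conjugate of the formula at \<open>cnj \<zeta>\<close> leaves only the real part of \<open>u\<close> on the diameter,
  because the kernel \<open>1 / (x - \<zeta>)\<close> is the conjugate of \<open>1 / (x - cnj \<zeta>)\<close> for real \<open>x\<close>.\<close>
lemma Re_over_bottom:
  fixes u :: "real \<Rightarrow> complex"
  assumes "continuous_on {-R..R} u" "Im \<zeta> \<noteq> 0"
  shows "integral {-R..R} (\<lambda>x. u x / (of_real x - \<zeta>)) +
     cnj (integral {-R..R} (\<lambda>x. u x / (of_real x - cnj \<zeta>))) =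
     integral {-R..R} (\<lambda>x. 2 * of_real (Re (u x)) / (of_real x - \<zeta>))"
proof -
  have nz: "of_real x - \<zeta> \<noteq> 0" "of_real x - cnj \<zeta> \<noteq> 0" for x
    using assms(2) by (auto simp: complex_eq_iff)
  have 1: "(\<lambda>x. u x / (of_real x - \<zeta>)) integrable_on {-R..R}"
    by (intro integrable_continuous_real continuous_intros assms) (use nz in auto)
  have 2: "(\<lambda>x. u x / (of_real x - cnj \<zeta>)) integrable_on {-R..R}"
    by (intro integrable_continuous_real continuous_intros assms) (use nz in auto)
  have "cnj (integral {-R..R} (\<lambda>x. u x / (of_real x - cnj \<zeta>))) =
    integral {-R..R} (\<lambda>x. cnj (u x / (of_real x - cnj \<zeta>)))"
    by (simp add: integral_cnj)
  then have "integral {-R..R} (\<lambda>x. u x / (of_real x - \<zeta>)) +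
     cnj (integral {-R..R} (\<lambda>x. u x / (of_real x - cnj \<zeta>))) =
     integral {-R..R} (\<lambda>x. u x / (of_real x - \<zeta>) + cnj (u x / (of_real x - cnj \<zeta>)))"
    using 1 2 by (simp add: Henstock_Kurzweil_Integration.integral_add integrable_on_cnj_iff
       del: complex_cnj_divide)
  also have "\<dots> = integral {-R..R} (\<lambda>x. 2 * of_real (Re (u x)) / (of_real x - \<zeta>))"
    by (intro integral_cong) (simp add: complex_add_cnj flip: add_divide_distrib)
  finally show ?thesis .
qed

text \<open>Schwarz reflection: the right hand side is holomorphic in the full disc and real for real \<open>\<zeta>\<close>, so
  it continues \<open>f\<close> by a function with imaginary values on the diameter. Only pointwise convergence of
  the real part is available here, not continuity of \<open>f\<close> up to the diameter, so the half disc is shifted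
  upwards by \<open>\<eta>\<close> and the limit \<open>\<eta> \<rightarrow> 0\<close> is taken.\<close>
theorem reflection_formula:
  assumes R: "0 < R" "R \<le> 1" and holf: "f holomorphic_on half_disc_nbhd"
    and B: "\<And>z. z \<in> half_disc_nbhd \<Longrightarrow> cmod (f z) \<le> B"
    and Re0: "\<And>x. \<bar>x\<bar> \<le> R \<Longrightarrow> ((\<lambda>y. Re (f (Complex x y))) \<longlongrightarrow> 0) (at_right 0)"
    and z: "0 < Im \<zeta>" "cmod \<zeta> < R"
  shows "2 * pi * \<i> * f \<zeta> = arc_cauchy R f \<zeta> + cnj (arc_cauchy R f (cnj \<zeta>))"
proof -
  \<comment> \<open>The shifts stay below 1/2, so that half discs of radius up to 1 remain in the domain.\<close>
  define \<eta> where "\<eta> n = 1 / (2 * real (Suc n))" for n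
  have \<eta>: "0 < \<eta> n" "\<eta> n \<le> 1/2" for n by (auto simp: \<eta>_def field_simps)
  have \<eta>0: "\<eta> \<longlonglongrightarrow> 0"
  proof -
    have "\<eta> = (\<lambda>n. inverse (real (Suc n)) * (1 / 2))"
      by (rule ext) (simp add: \<eta>_def inverse_eq_divide)
    then show ?thesis using tendsto_mult_right[OF LIMSEQ_inverse_real_of_nat, of "1/2"] by simp
  qed
  define F where "F n z = f (z + \<i> * \<eta> n)" for n z
  have in_nbhd: "w + \<i> * \<eta> n \<in> half_disc_nbhd" if "- \<eta> n < Im w" "cmod w < 3/2" for n w
  proof -
    have "cmod (w + \<i> * \<eta> n) \<le> cmod w + \<eta> n"
      using norm_triangle_ineq[of w "\<i> * \<eta> n"] \<eta>(1)[of n] by (simp add: norm_mult)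
    then show ?thesis using that \<eta>[of n] by (auto simp: half_disc_nbhd_def)
  qed
  have holF: "F n holomorphic_on {w. - \<eta> n < Im w \<and> cmod w < 3/2}" for n
    unfolding F_def
    by (rule holomorphic_on_compose_gen[OF _ holf, unfolded o_def])
      (use in_nbhd in \<open>auto intro!: holomorphic_intros\<close>)
  have FB: "cmod (F n w) \<le> B" if "0 \<le> Im w" "cmod w < 3/2" for n w
    unfolding F_def by (rule B) (use in_nbhd[of n w] that \<eta>(1)[of n] in auto)
  have contf: "continuous_on half_disc_nbhd f"
    using holf holomorphic_on_imp_continuous_on by blast
  have Flim: "(\<lambda>n. F n w) \<longlonglongrightarrow> f w" if "0 < Im w" "cmod w < 3/2" for w
  proof -
    have "isCont f w" using contf open_half_disc_nbhd that
      by (auto simp: continuous_on_eq_continuous_at half_disc_nbhd_def)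
    moreover have "(\<lambda>n. w + \<i> * \<eta> n) \<longlonglongrightarrow> w"
      using tendsto_add[OF tendsto_const tendsto_mult[OF tendsto_const tendsto_of_real[OF \<eta>0]], of w \<i>] by simp
    ultimately show ?thesis unfolding F_def by (rule isCont_tendsto_compose)
  qed
  have Fcont: "continuous_on {w. 0 \<le> Im w \<and> cmod w < 3/2} (F n)" for n
    by (rule continuous_on_subset[OF holomorphic_on_imp_continuous_on[OF holF[of n]]]) (use \<eta>(1)[of n] in auto)
  have arc_in: "0 \<le> Im (R * cis t) \<and> cmod (R * cis t) < 3/2" if "t \<in> {0..pi}" for t
    using that R by (auto simp: norm_mult sin_ge_zero)
  have arc_pos: "0 < Im (R * cis t)" if "0 < t" "t < pi" for t
    using that R by (auto simp: sin_gt_zero)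
  have arc_lim: "(\<lambda>n. arc_cauchy R (F n) w) \<longlonglongrightarrow> arc_cauchy R f w" if "cmod w < R" for w
    unfolding arc_cauchy_def
  proof (rule arc_dominated_convergence(2)[where B = B])
    show "continuous_on {0<..<pi} (\<lambda>t. F n (R * cis t))" for n
      by (rule continuous_on_compose2[OF Fcont]) (use arc_in in \<open>auto intro!: continuous_intros\<close>)
    show "cmod (F n (R * cis t)) \<le> B" if "0 < t" "t < pi" for n t
      using FB arc_in[of t] that by auto
    show "(\<lambda>n. F n (R * cis t)) \<longlonglongrightarrow> f (R * cis t)" if "0 < t" "t < pi" for t
      using Flim arc_in[of t] arc_pos[OF that] that by auto
    show "continuous_on {0..pi} (\<lambda>t. \<i> * R * cis t / (R * cis t - w))"
      by (rule arc_kernel_continuous[OF that])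
  qed
  have closed: "arc_cauchy R (F n) w = integral {0..pi} (\<lambda>t. F n (R * cis t) * (\<i> * R * cis t / (R * cis t - w)))"
    for n w
    by (simp add: arc_cauchy_def integral_open_interval_real)
  define u where "u n x = F n (of_real x)" for n x
  have ucont: "continuous_on {-R..R} (u n)" for n
    unfolding u_def by (rule continuous_on_compose2[OF Fcont]) (use R in \<open>auto intro!: continuous_intros\<close>)
  have eq: "arc_cauchy R (F n) \<zeta> + cnj (arc_cauchy R (F n) (cnj \<zeta>)) =
     2 * pi * \<i> * F n \<zeta> - integral {-R..R} (\<lambda>x. 2 * of_real (Re (u n x)) / (of_real x - \<zeta>))" for n
  proof -
    have 1: "arc_cauchy R (F n) \<zeta> + integral {-R..R} (\<lambda>x. u n x / (of_real x - \<zeta>)) = 2 * pi * \<i> * F n \<zeta>"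
      using half_disc_Cauchy_formula[OF R(1) _ _ _ \<eta>(1) holF[of n], of \<zeta>] z R
      by (simp add: closed u_def)
    have 2: "arc_cauchy R (F n) (cnj \<zeta>) + integral {-R..R} (\<lambda>x. u n x / (of_real x - cnj \<zeta>)) = 0"
      using half_disc_Cauchy_formula[OF R(1) _ _ _ \<eta>(1) holF[of n], of "cnj \<zeta>"] z R
      by (simp add: closed u_def)
    have 3: "cnj (arc_cauchy R (F n) (cnj \<zeta>)) = - cnj (integral {-R..R} (\<lambda>x. u n x / (of_real x - cnj \<zeta>)))"
      using 2 by (simp add: eq_neg_iff_add_eq_0 flip: complex_cnj_minus complex_cnj_add)
    show ?thesis
      unfolding 3 1[symmetric] Re_over_bottom[OF ucont[of n] less_imp_neq[OF z(1), symmetric], symmetric] by simp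
  qed
  have bottom: "(\<lambda>n. integral {-R..R} (\<lambda>x. 2 * of_real (Re (u n x)) / (of_real x - \<zeta>))) \<longlonglongrightarrow>
     integral {-R..R} (\<lambda>x. 0 :: complex)"
  proof (rule dominated_convergence(2))
    have nz: "of_real x - \<zeta> \<noteq> 0" for x using z by (auto simp: complex_eq_iff)
    have ge: "Im \<zeta> \<le> cmod (of_real x - \<zeta>)" for x
      using abs_Im_le_cmod[of "of_real x - \<zeta>"] z by simp
    show "(\<lambda>x. 2 * of_real (Re (u n x)) / (of_real x - \<zeta>)) integrable_on {-R..R}" for n
      by (intro integrable_continuous_real continuous_intros ucont) (use nz in auto)
    show "(\<lambda>x. 2 * B / Im \<zeta>) integrable_on {-R..R}" by (rule integrable_const_ivl)
    show "cmod (2 * of_real (Re (u n x)) / (of_real x - \<zeta>)) \<le> 2 * B / Im \<zeta>" if "x \<in> {-R..R}" for n x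
    proof -
      have "cmod (u n x) \<le> B" unfolding u_def using that R by (intro FB) auto
      then have "\<bar>Re (u n x)\<bar> \<le> B" using abs_Re_le_cmod order_trans by blast
      then show ?thesis using ge[of x] z
        by (auto simp: norm_divide norm_mult intro!: frac_le)
    qed
    show "(\<lambda>n. 2 * of_real (Re (u n x)) / (of_real x - \<zeta>)) \<longlonglongrightarrow> 0" if "x \<in> {-R..R}" for x
    proof -
      have "filterlim \<eta> (at_right 0) sequentially"
        by (rule tendsto_imp_filterlim_at_right[OF \<eta>0]) (simp add: \<eta>(1))
      from filterlim_compose[OF Re0 this]
      have "(\<lambda>n. Re (f (Complex x (\<eta> n)))) \<longlonglongrightarrow> 0"
        using that by (auto simp: abs_le_iff)
      moreover have "Complex x (\<eta> n) = of_real x + \<i> * \<eta> n" for n by (simp add: complex_eq_iff)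
      ultimately have "(\<lambda>n. Re (u n x)) \<longlonglongrightarrow> 0" by (simp add: u_def F_def)
      then have "(\<lambda>n. 2 * of_real (Re (u n x)) / (of_real x - \<zeta>)) \<longlonglongrightarrow> 2 * of_real 0 / (of_real x - \<zeta>)"
        by (intro tendsto_intros) (use nz in auto)
      then show ?thesis by simp
    qed
  qed
  have L: "(\<lambda>n. arc_cauchy R (F n) \<zeta> + cnj (arc_cauchy R (F n) (cnj \<zeta>))) \<longlonglongrightarrow>
    arc_cauchy R f \<zeta> + cnj (arc_cauchy R f (cnj \<zeta>))"
    by (intro tendsto_intros arc_lim) (use z in auto)
  have "(\<lambda>n. 2 * pi * \<i> * F n \<zeta> - integral {-R..R} (\<lambda>x. 2 * of_real (Re (u n x)) / (of_real x - \<zeta>))) \<longlonglongrightarrow>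
    2 * pi * \<i> * f \<zeta> - integral {-R..R} (\<lambda>x. 0 :: complex)"
    by (intro tendsto_intros bottom Flim) (use z R in auto)
  then show ?thesis using L unfolding eq using LIMSEQ_unique by fastforce
qed

lemma quadratic_remainder_imp_derivative:
  fixes F :: "complex \<Rightarrow> complex"
  assumes "\<delta> > 0" and q: "\<And>w. cmod (w - z) < \<delta> \<Longrightarrow> cmod (F w - F z - (w - z) * D) \<le> C * cmod (w - z) ^ 2"
  shows "(F has_field_derivative D) (at z)"
  unfolding has_field_derivative_iff
proof (rule LIM_I)
  fix r :: real assume r: "0 < r"
  define s where "s = min \<delta> (r / (\<bar>C\<bar> + 1))"
  have s: "0 < s" using assms(1) r by (auto simp: s_def)
  show "\<exists>s>0. \<forall>w. w \<noteq> z \<and> norm (w - z) < s \<longrightarrow> norm ((F w - F z) / (w - z) - D) < r"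
  proof (intro exI[of _ s] conjI s allI impI)
    fix w assume w: "w \<noteq> z \<and> norm (w - z) < s"
    have p: "0 < cmod (w - z)" using w by simp
    have "(F w - F z) / (w - z) - D = (F w - F z - (w - z) * D) / (w - z)"
      using w by (simp add: field_simps)
    then have "cmod ((F w - F z) / (w - z) - D) \<le> C * cmod (w - z) ^ 2 / cmod (w - z)"
      using q[of w] w by (auto simp: norm_divide s_def intro!: divide_right_mono)
    also have "\<dots> = C * cmod (w - z)" using p by (simp add: power2_eq_square)
    also have "\<dots> \<le> (\<bar>C\<bar> + 1) * cmod (w - z)" using p by (intro mult_right_mono) auto
    also have "\<dots> < (\<bar>C\<bar> + 1) * (r / (\<bar>C\<bar> + 1))"
      using w by (intro mult_strict_left_mono) (auto simp: s_def)
    also have "\<dots> = r" by (simp add: field_simps add_nonneg_eq_0_iff)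
    finally show "norm ((F w - F z) / (w - z) - D) < r" .
  qed
qed

lemma quotient_remainder:
  fixes a b k :: complex
  assumes "a \<noteq> 0" "b \<noteq> 0"
  shows "k / a - k / b - (b - a) * (k / b\<^sup>2) = k * (b - a)\<^sup>2 / (a * b\<^sup>2)"
  using assms by (simp add: field_simps power2_eq_square)

text \<open>Differentiation under the integral for a boundary function that is merely bounded and
  integrable against continuous kernels.\<close>
lemma arc_cauchy_holomorphic:
  assumes R: "0 < R" and B: "\<And>t. 0 < t \<Longrightarrow> t < pi \<Longrightarrow> cmod (g (R * cis t)) \<le> B"
    and int: "\<And>K. continuous_on {0..pi} K \<Longrightarrow> (\<lambda>t. g (R * cis t) * K t) integrable_on {0<..<pi}"
  shows "arc_cauchy R g holomorphic_on ball 0 R"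
proof -
  have "\<exists>D. (arc_cauchy R g has_field_derivative D) (at \<zeta>)" if z: "cmod \<zeta> < R" for \<zeta>
  proof -
    define D where "D = integral {0<..<pi} (\<lambda>t. g (R * cis t) * (\<i> * R * cis t / (R * cis t - \<zeta>)^2))"
    define d where "d = (R - cmod \<zeta>) / 2"
    have d: "d > 0" using z by (simp add: d_def)
    have B0: "0 \<le> B" using B[of 1] order_trans[OF norm_ge_zero] pi_gt3 by force
    have nz: "w \<noteq> R * cis t" if "cmod w < R" for w t using that by (auto simp: norm_mult)
    have "(arc_cauchy R g has_field_derivative D) (at \<zeta>)"
    proof (rule quadratic_remainder_imp_derivative[OF d])
      fix w assume w: "cmod (w - \<zeta>) < d"
      have wR: "cmod w < R"
        using norm_triangle_ineq2[of w \<zeta>] w z by (simp add: d_def)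
      have K1: "continuous_on {0..pi} (\<lambda>t. \<i> * R * cis t / (R * cis t - \<zeta>)^2)"
        by (intro continuous_intros) (use nz[OF z] in auto)
      have K2: "continuous_on {0..pi} (\<lambda>t. \<i> * R * cis t / (R * cis t - w) - \<i> * R * cis t / (R * cis t - \<zeta>)
          - (w - \<zeta>) * (\<i> * R * cis t / (R * cis t - \<zeta>)^2))"
        by (intro continuous_intros arc_kernel_continuous wR z K1) (use nz[OF z] in auto)
      have eq: "\<i> * R * cis t / (R * cis t - w) - \<i> * R * cis t / (R * cis t - \<zeta>)
          - (w - \<zeta>) * (\<i> * R * cis t / (R * cis t - \<zeta>)^2) = 
          \<i> * R * cis t * (w - \<zeta>)^2 / ((R * cis t - w) * (R * cis t - \<zeta>)^2)" for t
        using quotient_remainder[of "R * cis t - w" "R * cis t - \<zeta>" "\<i> * R * cis t"]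
          nz[OF z, of t] nz[OF wR, of t] by simp
      have le: "cmod (\<i> * R * cis t / (R * cis t - w) - \<i> * R * cis t / (R * cis t - \<zeta>)
          - (w - \<zeta>) * (\<i> * R * cis t / (R * cis t - \<zeta>)^2)) \<le> R * cmod (w - \<zeta>)^2 / (d * d^2)" for t
      proof -
        have 1: "d \<le> cmod (R * cis t - \<zeta>)" "d \<le> cmod (R * cis t - w)"
          using norm_triangle_ineq2[of "R * cis t" \<zeta>] norm_triangle_ineq2[of "R * cis t" w] R z w
            norm_triangle_ineq2[of w \<zeta>]
          by (auto simp: norm_mult d_def field_simps)
        show ?thesis unfolding eq norm_divide norm_mult norm_power
          using 1 R d by (intro frac_le mult_mono power_mono) (auto simp: )
      qed
      have "arc_cauchy R g w - arc_cauchy R g \<zeta> - (w - \<zeta>) * D = 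
        integral {0<..<pi} (\<lambda>t. g (R * cis t) * (\<i> * R * cis t / (R * cis t - w)) -
            g (R * cis t) * (\<i> * R * cis t / (R * cis t - \<zeta>))
          - (w - \<zeta>) * (g (R * cis t) * (\<i> * R * cis t / (R * cis t - \<zeta>)^2)))"
        unfolding arc_cauchy_def D_def
        by (rule integral_unique[symmetric]) (intro has_integral_diff has_integral_mult_right
          integrable_integral int arc_kernel_continuous wR z K1)
      also have "\<dots> = integral {0<..<pi} (\<lambda>t. g (R * cis t) * (\<i> * R * cis t / (R * cis t - w) - \<i> * R * cis t / (R * cis t - \<zeta>)
          - (w - \<zeta>) * (\<i> * R * cis t / (R * cis t - \<zeta>)^2)))"
        by (intro integral_cong) (simp add: algebra_simps)
      finally have rem: "arc_cauchy R g w - arc_cauchy R g \<zeta> - (w - \<zeta>) * D = \<dots>" .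
      have "cmod (arc_cauchy R g w - arc_cauchy R g \<zeta> - (w - \<zeta>) * D) \<le> integral {0<..<pi} (\<lambda>t. B * (R * cmod (w - \<zeta>)^2 / (d * d^2)))"
        unfolding rem
      proof (rule integral_norm_bound_integral[OF int[OF K2]])
        show "(\<lambda>t. B * (R * cmod (w - \<zeta>)^2 / (d * d^2))) integrable_on {0<..<pi}"
          using integrable_const_ivl[of _ 0 pi] by (simp add: integrable_on_open_interval_real)
        show "cmod (g (R * cis t) * (\<i> * R * cis t / (R * cis t - w) - \<i> * R * cis t / (R * cis t - \<zeta>)
          - (w - \<zeta>) * (\<i> * R * cis t / (R * cis t - \<zeta>)^2))) \<le> B * (R * cmod (w - \<zeta>)^2 / (d * d^2))"
          if "t \<in> {0<..<pi}" for t
          unfolding norm_mult[of "g _"] using that le B B0 by (intro mult_mono) auto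
      qed
      also have "\<dots> = pi * B * R / (d * d^2) * cmod (w - \<zeta>)^2"
      proof -
        have "integral {0<..<pi} (\<lambda>t. B * (R * cmod (w - \<zeta>)^2 / (d * d^2))) =
          integral {0..pi} (\<lambda>t. B * (R * cmod (w - \<zeta>)^2 / (d * d^2)))"
          by (rule integral_open_interval_real[symmetric])
        then show ?thesis by simp
      qed
      finally show "cmod (arc_cauchy R g w - arc_cauchy R g \<zeta> - (w - \<zeta>) * D) \<le> pi * B * R / (d * d^2) * cmod (w - \<zeta>)^2" .
    qed
    then show ?thesis by blast
  qed
  then show ?thesis
    by (auto simp: holomorphic_on_open)
qed

text \<open>Both \<open>g\<close> and \<open>g\<^sup>2\<close> extend to the disc with purely imaginary values on the diameter. The extension of
  \<open>g\<^sup>2\<close> is the square of that of \<open>g\<close>, hence real and nonpositive there. So it vanishes on the diameter, and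
  then everywhere by the identity theorem.\<close>
theorem reflection_square_zero:
  assumes R: "0 < R" and B: "\<And>t. 0 < t \<Longrightarrow> t < pi \<Longrightarrow> cmod (g (R * cis t)) \<le> B"
    and int1: "\<And>K. continuous_on {0..pi} K \<Longrightarrow> (\<lambda>t. g (R * cis t) * K t) integrable_on {0<..<pi}"
    and int2: "\<And>K. continuous_on {0..pi} K \<Longrightarrow> (\<lambda>t. (g (R * cis t))\<^sup>2 * K t) integrable_on {0<..<pi}"
    and g1: "\<And>\<zeta>. 0 < Im \<zeta> \<Longrightarrow> cmod \<zeta> < R \<Longrightarrow>
      2 * pi * \<i> * g \<zeta> = arc_cauchy R g \<zeta> + cnj (arc_cauchy R g (cnj \<zeta>))"
    and g2: "\<And>\<zeta>. 0 < Im \<zeta> \<Longrightarrow> cmod \<zeta> < R \<Longrightarrow>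
      2 * pi * \<i> * (g \<zeta>)\<^sup>2 =
        arc_cauchy R (\<lambda>z. (g z)\<^sup>2) \<zeta> + cnj (arc_cauchy R (\<lambda>z. (g z)\<^sup>2) (cnj \<zeta>))"
    and z: "0 < Im \<zeta>" "cmod \<zeta> < R"
  shows "g \<zeta> = 0"
proof -
  define H where "H f w = (arc_cauchy R f w + cnj (arc_cauchy R f (cnj w))) / (2 * pi * \<i>)" for f w
  let ?D = "ball (0::complex) R"
  have B2: "cmod ((g (R * cis t))\<^sup>2) \<le> B\<^sup>2" if "0 < t" "t < pi" for t
    unfolding norm_power by (intro power_mono B that) auto
  have hol: "H f holomorphic_on ?D" if "arc_cauchy R f holomorphic_on ?D" for f
  proof -
    have "cnj ` ?D = ?D" by (auto intro!: image_eqI[of _ cnj "cnj _"])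
    then have "(cnj \<circ> arc_cauchy R f \<circ> cnj) holomorphic_on ?D"
      using that by (simp add: holomorphic_on_compose_cnj_cnj)
    then show ?thesis unfolding H_def
      by (intro holomorphic_intros that) (auto simp: o_def)
  qed
  have h1: "H g holomorphic_on ?D"
    by (intro hol arc_cauchy_holomorphic[OF R _ int1, where B = B] B)
  have h2: "H (\<lambda>z. (g z)\<^sup>2) holomorphic_on ?D"
    by (intro hol arc_cauchy_holomorphic[OF R _ int2, where B = "B\<^sup>2"] B2)
  have e1: "H g w = g w" and e2: "H (\<lambda>z. (g z)\<^sup>2) w = (g w)\<^sup>2" if "0 < Im w" "cmod w < R" for w
    using g1[OF that] g2[OF that] by (auto simp: H_def field_simps)
  have zD: "\<zeta> \<in> ?D" using z by simp
  have lim: "w islimpt S" if "open S" "w \<in> S" for w :: complex and S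
    using that by (simp add: interior_limit_point interior_open)
  have sq: "H (\<lambda>z. (g z)\<^sup>2) w - (H g w)\<^sup>2 = 0" if "w \<in> ?D" for w
  proof (rule analytic_continuation[where S = ?D and U = "{w. 0 < Im w} \<inter> ?D" and \<xi> = \<zeta> and
        f = "\<lambda>w. H (\<lambda>z. (g z)\<^sup>2) w - (H g w)\<^sup>2"])
    show "(\<lambda>w. H (\<lambda>z. (g z)\<^sup>2) w - (H g w)\<^sup>2) holomorphic_on ?D"
      by (intro holomorphic_intros h1 h2)
    show "\<zeta> islimpt {w. 0 < Im w} \<inter> ?D"
      by (intro lim open_Int open_halfspace_Im_gt open_ball) (use z in auto)
  qed (use that zD e1 e2 in auto)
  have real0: "H g w = 0" if "w \<in> ?D" "Im w = 0" for w
  proof -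
    have "cnj w = w" using that by (simp add: complex_eq_iff)
    then have "\<exists>r. H f w = - \<i> * of_real r" for f
      by (intro exI[of _ "Re (arc_cauchy R f w) / pi"])
        (simp add: H_def complex_add_cnj field_simps)
    then obtain r s where rs: "H g w = - \<i> * of_real r" "H (\<lambda>z. (g z)\<^sup>2) w = - \<i> * of_real s" by metis
    have "- \<i> * of_real s - (- \<i> * of_real r)\<^sup>2 = 0" using sq[OF that(1)] rs by simp
    then have "r = 0" by (simp add: complex_eq_iff power_mult_distrib)
    then show ?thesis using rs by simp
  qed
  have lim0: "0 islimpt {w. Im w = 0} \<inter> ?D"
    unfolding islimpt_approachable
  proof (intro allI impI)
    fix e :: real assume e: "e > 0"
    have "of_real (min e R / 2) \<in> {w. Im w = 0} \<inter> ?D" "of_real (min e R / 2) \<noteq> (0::complex)"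
      "dist (of_real (min e R / 2)) (0::complex) < e"
      using R e by (auto simp: dist_norm simp del: of_real_divide)
    then show "\<exists>x'\<in>{w. Im w = 0} \<inter> ?D. x' \<noteq> 0 \<and> dist x' 0 < e" by blast
  qed
  have "H g \<zeta> = 0"
    by (rule analytic_continuation[where S = ?D and U = "{w. Im w = 0} \<inter> ?D" and \<xi> = 0 and f = "H g"])
      (use h1 real0 zD lim0 R in auto)
  then show ?thesis using e1 z by simp
qed

section \<open>The invariant section of a potential in the upper half-plane\<close>

lemma periodic_integral_shift:
  fixes f :: "real \<Rightarrow> 'a::euclidean_space"
  assumes c: "continuous_on UNIV f" and per: "\<And>x. f (x + 1) = f x"
  shows "integral {0..1} (\<lambda>x. f (x + a)) = integral {0..1} f"
proof -
  have i: "f integrable_on {x..y}" for x y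
    by (intro integrable_continuous_real continuous_on_subset[OF c]) auto
  have sh: "integral {x..y} (\<lambda>t. f (t + b)) = integral {x+b..y+b} f" for x y b
    using integral_shift_Icc_real[of x y f b] by (simp add: o_def add.commute)
  have per': "integral {x+1..y+1} f = integral {x..y} f" for x y
    using sh[of x y 1] per by simp
  have main: "integral {b..b+1} f = integral {0..1} f" if b: "0 \<le> b" "b \<le> 1" for b
  proof -
    have "integral {b..b+1} f = integral {b..1} f + integral {1..b+1} f"
      by (rule Henstock_Kurzweil_Integration.integral_combine[symmetric]) (use b i in auto)
    also have "integral {1..b+1} f = integral {0..b} f" using per'[of 0 b] by simp
    also have "integral {b..1} f + integral {0..b} f = integral {0..1} f"
      using Henstock_Kurzweil_Integration.integral_combine[of 0 b 1 f] b i by (simp add: add.commute)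
    finally show ?thesis .
  qed
  have nat: "integral {b + real n..b + real n + 1} f = integral {b..b+1} f" for b n
  proof (induction n)
    case (Suc n)
    then show ?case using per'[of "b + real n" "b + real n + 1"] by (simp add: add_ac)
  qed simp
  have int: "integral {b + of_int k..b + of_int k + 1} f = integral {b..b+1} f" for b k
    using nat[of b "nat k"] nat[of "b + of_int k" "nat (-k)"] by (cases "0 \<le> k") auto
  have "integral {0..1} (\<lambda>x. f (x + a)) = integral {a..a+1} f" using sh[of 0 1 a] by (simp add: add.commute)
  also have "\<dots> = integral {frac a..frac a+1} f"
    using int[of "frac a" "\<lfloor>a\<rfloor>"] by (simp add: frac_def)
  also have "\<dots> = integral {0..1} f"
    by (rule main) (auto simp: frac_lt_1 less_imp_le)
  finally show ?thesis .
qed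

text \<open>A continuous 1-periodic potential with values in a compact part of the upper half-plane; the
  constants \<open>y\<close> and \<open>M\<close> enter all estimates explicitly, because uniformity as \<open>y \<rightarrow> 0\<close> is needed.\<close>
definition uhp_potential :: "real \<Rightarrow> real \<Rightarrow> (real \<Rightarrow> complex) \<Rightarrow> bool" where
  "uhp_potential y M v \<longleftrightarrow> 0 < y \<and> continuous_on UNIV v \<and> (\<forall>\<theta>. v (\<theta> + 1) = v \<theta>) \<and>
     (\<forall>\<theta>. y \<le> Im (v \<theta>) \<and> cmod (v \<theta>) \<le> M)"

text \<open>Finite continued fractions in \<open>v(\<theta> - \<alpha>), v(\<theta> - 2\<alpha>), \<dots>\<close>, the iterates of the projective action of the
  Schroedinger cocycle in the coordinate \<open>-x/y\<close>. The starting value is immaterial in the limit; \<open>v\<close>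
  itself is a convenient point of the right height.\<close>
primrec m_approx :: "real \<Rightarrow> (real \<Rightarrow> complex) \<Rightarrow> nat \<Rightarrow> real \<Rightarrow> complex" where
  "m_approx \<alpha> v 0 \<theta> = v \<theta>"
| "m_approx \<alpha> v (Suc n) \<theta> = v (\<theta> - \<alpha>) - 1 / m_approx \<alpha> v n (\<theta> - \<alpha>)"

text \<open>The invariant section \<open>m(\<theta> + \<alpha>) = v(\<theta>) - 1 / m(\<theta>)\<close>; a Weyl m-function of the half line
  of past potential values.\<close>
definition m_past :: "real \<Rightarrow> (real \<Rightarrow> complex) \<Rightarrow> real \<Rightarrow> complex" where
  "m_past \<alpha> v \<theta> = lim (\<lambda>n. m_approx \<alpha> v n \<theta>)"

text \<open>Twice the hyperbolic sine of half the hyperbolic distance. It is not a metric, but it is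
  invariant under \<open>w \<mapsto> -1/w\<close> and controls the Euclidean distance directly.\<close>
definition hyp_dist :: "complex \<Rightarrow> complex \<Rightarrow> real" where
  "hyp_dist w w' = cmod (w - w') / sqrt (Im w * Im w')"

text \<open>The contraction factor of \<open>w \<mapsto> v - 1/w\<close> on \<open>{Im w \<ge> y}\<close> when \<open>Im v \<ge> y\<close>.\<close>
definition rate :: "real \<Rightarrow> real" where "rate y = 1 / (1 + y\<^sup>2)"

lemma rate_bounds: "0 < y \<Longrightarrow> 0 < rate y \<and> rate y < 1"
  by (auto simp: rate_def field_simps add_pos_nonneg power2_eq_square add_nonneg_eq_0_iff)

lemma Im_neg_inverse: "Im (- 1 / w) = Im w / (cmod w)\<^sup>2"
  by (simp add: Im_divide cmod_power2)

lemma hyp_dist_neg_inverse: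
  assumes "0 < Im w" "0 < Im w'"
  shows "hyp_dist (- 1 / w) (- 1 / w') = hyp_dist w w'"
proof -
  have nz: "w \<noteq> 0" "w' \<noteq> 0" using assms by auto
  have 1: "cmod (- 1 / w - - 1 / w') = cmod (w - w') / (cmod w * cmod w')"
    using nz by (simp add: divide_simps flip: norm_mult norm_divide) 
  have 2: "sqrt (Im (- 1 / w) * Im (- 1 / w')) = sqrt (Im w * Im w') / (cmod w * cmod w')"
    unfolding Im_neg_inverse by (simp add: real_sqrt_divide real_sqrt_mult)
  show ?thesis unfolding hyp_dist_def 1 2 using nz by simp
qed

lemma hyp_dist_nonneg: "0 < Im w \<Longrightarrow> 0 < Im w' \<Longrightarrow> 0 \<le> hyp_dist w w'"
  by (simp add: hyp_dist_def)

lemma cmod_diff_hyp_dist: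
  assumes "0 < Im w" "0 < Im w'"
  shows "cmod (w - w') = hyp_dist w w' * sqrt (Im w * Im w')"
  using assms by (simp add: hyp_dist_def)

lemma Im_neg_inverse_bounds:
  assumes "0 < y" "y \<le> Im w"
  shows "0 < Im (- 1 / w)" "Im (- 1 / w) \<le> 1 / y" "cmod (1 / w) \<le> 1 / y" "w \<noteq> 0"
proof -
  have le: "y \<le> cmod w" using abs_Im_le_cmod[of w] assms by simp
  then show "w \<noteq> 0" using assms by auto
  show 3: "cmod (1 / w) \<le> 1 / y" unfolding norm_divide using assms le by (intro frac_le) auto
  show "0 < Im (- 1 / w)" unfolding Im_neg_inverse using assms le by (intro divide_pos_pos) auto
  show "Im (- 1 / w) \<le> 1 / y"
    using abs_Im_le_cmod[of "-1/w"] 3 by (simp add: norm_divide)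
qed

lemma sqrt_le_of_le:
  assumes "0 \<le> a" "0 \<le> b" "a \<le> c" "b \<le> c"
  shows "sqrt (a * b) \<le> c"
  using assms by (intro real_le_lsqrt) (auto simp: power2_eq_square intro!: mult_mono)

lemma le_sqrt_of_le:
  assumes "0 \<le> c" "c \<le> a" "c \<le> b"
  shows "c \<le> sqrt (a * b)"
  using assms by (intro real_le_rsqrt) (auto simp: power2_eq_square intro!: mult_mono)

text \<open>The inversion is an isometry onto points of height at most \<open>1/y\<close>. Adding \<open>v\<close> raises such a point by
  at least \<open>y\<close>, that is by a factor of at least \<open>1 + y\<^sup>2\<close>, which shrinks \<open>hyp_dist\<close> by this factor; the difference of two
  potentials enters additively.\<close>
lemma hyp_dist_step:
  assumes y: "0 < y" and w: "y \<le> Im w" "y \<le> Im w'" and v: "y \<le> Im v" "y \<le> Im v'"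
  shows "hyp_dist (v - 1 / w) (v' - 1 / w') \<le> cmod (v - v') / y + rate y * hyp_dist w w'"
proof -
  define a a' where "a = - 1 / w" and "a' = - 1 / w'"
  have a: "0 < Im a" "Im a \<le> 1 / y" "0 < Im a'" "Im a' \<le> 1 / y"
    unfolding a_def a'_def using Im_neg_inverse_bounds[OF y] w by auto
  have grow: "(1 + y\<^sup>2) * t \<le> y + t" if "t \<le> 1 / y" for t
  proof -
    have "y\<^sup>2 * t \<le> y\<^sup>2 * (1 / y)" using that by (intro mult_left_mono) auto
    then show ?thesis using y by (simp add: power2_eq_square algebra_simps)
  qed
  have g: "(1 + y\<^sup>2) * Im a \<le> Im (v + a)" "(1 + y\<^sup>2) * Im a' \<le> Im (v' + a')"
    using grow[OF a(2)] grow[OF a(4)] v by auto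
  have "(1 + y\<^sup>2) * sqrt (Im a * Im a') = sqrt ((1 + y\<^sup>2)\<^sup>2 * (Im a * Im a'))"
    by (simp add: real_sqrt_mult)
  also have "\<dots> = sqrt ((1 + y\<^sup>2) * Im a * ((1 + y\<^sup>2) * Im a'))"
    by (simp add: power2_eq_square mult_ac)
  also have "\<dots> \<le> sqrt (Im (v + a) * Im (v' + a'))"
    using g a by (intro real_sqrt_le_mono mult_mono) (auto intro: order_trans[rotated])
  finally have s1: "(1 + y\<^sup>2) * sqrt (Im a * Im a') \<le> sqrt (Im (v + a) * Im (v' + a'))" .
  have s2: "y \<le> sqrt (Im (v + a) * Im (v' + a'))"
    using y v a by (intro le_sqrt_of_le) auto
  have "hyp_dist (v - 1 / w) (v' - 1 / w') = cmod ((v - v') + (a - a')) / sqrt (Im (v + a) * Im (v' + a'))"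
    by (simp add: hyp_dist_def a_def a'_def algebra_simps)
  also have "\<dots> \<le> cmod (v - v') / sqrt (Im (v + a) * Im (v' + a')) + cmod (a - a') / sqrt (Im (v + a) * Im (v' + a'))"
    unfolding add_divide_distrib[symmetric] using s2 y by (intro divide_right_mono norm_triangle_ineq) linarith
  also have "\<dots> \<le> cmod (v - v') / y + cmod (a - a') / ((1 + y\<^sup>2) * sqrt (Im a * Im a'))"
  proof (intro add_mono divide_left_mono s1 s2)
    show "0 < sqrt (Im (v + a) * Im (v' + a')) * ((1 + y\<^sup>2) * sqrt (Im a * Im a'))"
      using y a v by (intro mult_pos_pos real_sqrt_gt_zero) (auto simp: add_pos_nonneg)
    show "0 < sqrt (Im (v + a) * Im (v' + a')) * y"
      using s2 y by (intro mult_pos_pos) linarith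
  qed auto
  also have "cmod (a - a') / ((1 + y\<^sup>2) * sqrt (Im a * Im a')) = rate y * hyp_dist a a'"
    by (simp add: rate_def hyp_dist_def)
  also have "hyp_dist a a' = hyp_dist w w'"
    unfolding a_def a'_def using w y by (intro hyp_dist_neg_inverse) auto
  finally show ?thesis .
qed

lemma uhp_potentialD:
  assumes "uhp_potential y M v"
  shows "0 < y" "continuous_on UNIV v" "v (\<theta> + 1) = v \<theta>" "y \<le> Im (v \<theta>)" "cmod (v \<theta>) \<le> M" "0 < M"
proof -
  show y: "0 < y" and "continuous_on UNIV v" "v (\<theta> + 1) = v \<theta>" and i: "y \<le> Im (v \<theta>)" and m: "cmod (v \<theta>) \<le> M" for \<theta>
    using assms by (auto simp: uhp_potential_def)
  show "0 < M" using abs_Im_le_cmod[of "v 0"] y i[of 0] m[of 0] by linarith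
qed

lemma m_approx_bounds:
  assumes "uhp_potential y M v"
  shows "y \<le> Im (m_approx \<alpha> v n \<theta>) \<and> cmod (m_approx \<alpha> v n \<theta>) \<le> M + 1 / y"
proof (induction n arbitrary: \<theta>)
  case 0
  have "0 < 1 / y" using uhp_potentialD(1)[OF assms] by simp
  then show ?case using uhp_potentialD(4,5)[OF assms, of \<theta>] by (auto simp del: divide_eq_0_iff zero_less_divide_1_iff)
next
  case (Suc n)
  have w: "y \<le> Im (m_approx \<alpha> v n (\<theta> - \<alpha>))" using Suc by blast
  note b = Im_neg_inverse_bounds[OF uhp_potentialD(1)[OF assms] w]
  have "y \<le> Im (v (\<theta> - \<alpha>) - 1 / m_approx \<alpha> v n (\<theta> - \<alpha>))"
    using b(1) uhp_potentialD(4)[OF assms, of "\<theta> - \<alpha>"] by simp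
  moreover have "cmod (v (\<theta> - \<alpha>) - 1 / m_approx \<alpha> v n (\<theta> - \<alpha>)) \<le> M + 1 / y"
    using norm_triangle_ineq4[of "v (\<theta> - \<alpha>)" "1 / m_approx \<alpha> v n (\<theta> - \<alpha>)"] b(3)
      uhp_potentialD(5)[OF assms, of "\<theta> - \<alpha>"] by linarith
  ultimately show ?case by simp
qed

lemma hyp_dist_bound:
  assumes "0 < y" "y \<le> Im w" "y \<le> Im w'" "cmod w \<le> K" "cmod w' \<le> K"
  shows "hyp_dist w w' \<le> 2 * K / y"
proof -
  have "0 \<le> K" using assms(4) norm_ge_zero order_trans by blast
  then show ?thesis
    unfolding hyp_dist_def using assms norm_triangle_ineq4[of w w']
    by (intro frac_le le_sqrt_of_le) auto
qed

lemma cmod_diff_le_hyp_dist: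
  assumes "0 < Im w" "0 < Im w'" "cmod w \<le> K" "cmod w' \<le> K" "hyp_dist w w' \<le> D"
  shows "cmod (w - w') \<le> D * K"
proof -
  have "sqrt (Im w * Im w') \<le> K"
    using assms abs_Im_le_cmod[of w] abs_Im_le_cmod[of w'] by (intro sqrt_le_of_le) auto
  then show ?thesis unfolding cmod_diff_hyp_dist[OF assms(1,2)]
    using assms hyp_dist_nonneg[of w w'] by (intro mult_mono) auto
qed

definition approx_const :: "real \<Rightarrow> real \<Rightarrow> real" where
  "approx_const y M = 2 * (M + 1 / y) / y * (M + 1 / y)"

lemma m_approx_Cauchy_bound:
  assumes P: "uhp_potential y M v"
  shows "cmod (m_approx \<alpha> v (m + n) \<theta> - m_approx \<alpha> v n \<theta>) \<le> rate y ^ n * approx_const y M"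
proof -
  note y = uhp_potentialD(1)[OF P]
  note b = m_approx_bounds[OF P]
  have h: "hyp_dist (m_approx \<alpha> v (m + n) \<theta>) (m_approx \<alpha> v n \<theta>) \<le> rate y ^ n * (2 * (M + 1 / y) / y)"
  proof (induction n arbitrary: \<theta>)
    case 0
    have "hyp_dist (m_approx \<alpha> v m \<theta>) (m_approx \<alpha> v 0 \<theta>) \<le> 2 * (M + 1 / y) / y"
      by (rule hyp_dist_bound) (use b[of \<alpha> m \<theta>] b[of \<alpha> 0 \<theta>] y in auto)
    then show ?case by simp
  next
    case (Suc n)
    have "hyp_dist (m_approx \<alpha> v (m + Suc n) \<theta>) (m_approx \<alpha> v (Suc n) \<theta>)
       \<le> cmod (v (\<theta> - \<alpha>) - v (\<theta> - \<alpha>)) / y +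
         rate y * hyp_dist (m_approx \<alpha> v (m + n) (\<theta> - \<alpha>)) (m_approx \<alpha> v n (\<theta> - \<alpha>))"
      unfolding add_Suc_right m_approx.simps
      by (rule hyp_dist_step) (use b y uhp_potentialD(4)[OF P] in auto)
    also have "\<dots> \<le> 0 + rate y * (rate y ^ n * (2 * (M + 1 / y) / y))"
      using Suc rate_bounds[OF y] by (intro add_mono mult_left_mono) auto
    finally show ?case by (simp add: mult_ac)
  qed
  have "0 < Im (m_approx \<alpha> v k \<theta>)" for k using b[of \<alpha> k \<theta>] y by linarith
  then show ?thesis
    using cmod_diff_le_hyp_dist[OF _ _ _ _ h, of "M + 1 / y"] b[of \<alpha> "m + n" \<theta>] b[of \<alpha> n \<theta>]
    by (simp add: approx_const_def mult_ac)
qed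

lemma m_past_tendsto:
  assumes P: "uhp_potential y M v"
  shows "(\<lambda>n. m_approx \<alpha> v n \<theta>) \<longlonglongrightarrow> m_past \<alpha> v \<theta>"
proof -
  note y = uhp_potentialD(1)[OF P]
  have "(\<lambda>n. rate y ^ n * approx_const y M) \<longlonglongrightarrow> 0 * approx_const y M"
    using rate_bounds[OF y] by (intro tendsto_mult LIMSEQ_power_zero) auto
  then have l: "(\<lambda>n. rate y ^ n * approx_const y M) \<longlonglongrightarrow> 0" by simp
  have "Cauchy (\<lambda>n. m_approx \<alpha> v n \<theta>)"
  proof (rule CauchyI')
    fix e :: real assume "0 < e"
    then obtain N where N: "\<And>n. n \<ge> N \<Longrightarrow> rate y ^ n * approx_const y M < e"
      using order_tendstoD(2)[OF l] unfolding eventually_sequentially by metis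
    show "\<exists>M. \<forall>m\<ge>M. \<forall>n>m. dist (m_approx \<alpha> v m \<theta>) (m_approx \<alpha> v n \<theta>) < e"
    proof (intro exI allI impI)
      fix m n assume mn: "N \<le> m" "m < n"
      have "cmod (m_approx \<alpha> v ((n - m) + m) \<theta> - m_approx \<alpha> v m \<theta>) < e"
        using m_approx_Cauchy_bound[OF P] N[OF mn(1)] by (rule order.strict_trans1)
      then show "dist (m_approx \<alpha> v m \<theta>) (m_approx \<alpha> v n \<theta>) < e"
        using mn by (simp add: dist_norm norm_minus_commute)
    qed
  qed
  then show ?thesis
    unfolding m_past_def by (simp add: Cauchy_convergent_iff convergent_LIMSEQ_iff)
qed

lemma m_past_bounds:
  assumes P: "uhp_potential y M v"
  shows "y \<le> Im (m_past \<alpha> v \<theta>)" "cmod (m_past \<alpha> v \<theta>) \<le> M + 1 / y"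
    "0 < Im (m_past \<alpha> v \<theta>)" "m_past \<alpha> v \<theta> \<noteq> 0"
proof -
  show i: "y \<le> Im (m_past \<alpha> v \<theta>)"
    by (rule LIMSEQ_le_const[OF tendsto_Im[OF m_past_tendsto[OF P]]]) (use m_approx_bounds[OF P] in auto)
  show "cmod (m_past \<alpha> v \<theta>) \<le> M + 1 / y"
    by (rule LIMSEQ_le_const2[OF tendsto_norm[OF m_past_tendsto[OF P]]]) (use m_approx_bounds[OF P] in auto)
  show "0 < Im (m_past \<alpha> v \<theta>)" using i uhp_potentialD(1)[OF P] by linarith
  then show "m_past \<alpha> v \<theta> \<noteq> 0" by auto
qed

lemma m_past_approx:
  assumes P: "uhp_potential y M v"
  shows "cmod (m_approx \<alpha> v n \<theta> - m_past \<alpha> v \<theta>) \<le> rate y ^ n * approx_const y M"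
proof -
  have "(\<lambda>m. cmod (m_approx \<alpha> v n \<theta> - m_approx \<alpha> v (m + n) \<theta>)) \<longlonglongrightarrow> cmod (m_approx \<alpha> v n \<theta> - m_past \<alpha> v \<theta>)"
    by (intro tendsto_intros LIMSEQ_ignore_initial_segment m_past_tendsto[OF P])
  then show ?thesis
    by (rule LIMSEQ_le_const2) (use m_approx_Cauchy_bound[OF P] in \<open>auto simp: norm_minus_commute\<close>)
qed

lemma m_approx_continuous:
  assumes P: "uhp_potential y M v"
  shows "continuous_on UNIV (m_approx \<alpha> v n)"
proof (induction n)
  case 0
  have "m_approx \<alpha> v 0 = v" by (rule ext) simp
  then show ?case using uhp_potentialD(2)[OF P] by simp
next
  case (Suc n)
  have c: "continuous_on UNIV (\<lambda>\<theta>. g (\<theta> - \<alpha>))" if "continuous_on UNIV g" for g :: "real \<Rightarrow> complex"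
    by (rule continuous_on_compose2[OF that]) (auto intro!: continuous_intros)
  have "m_approx \<alpha> v n \<theta> \<noteq> 0" for \<theta>
    using m_approx_bounds[OF P, of \<alpha> n \<theta>] uhp_potentialD(1)[OF P] by auto
  then have "continuous_on UNIV (\<lambda>\<theta>. v (\<theta> - \<alpha>) - 1 / m_approx \<alpha> v n (\<theta> - \<alpha>))"
    by (intro continuous_intros c Suc uhp_potentialD(2)[OF P]) auto
  then show ?case by simp
qed

lemma m_past_continuous:
  assumes P: "uhp_potential y M v"
  shows "continuous_on UNIV (m_past \<alpha> v)"
proof (rule uniform_limit_theorem[of _ "m_approx \<alpha> v" sequentially])
  have "(\<lambda>n. rate y ^ n * approx_const y M) \<longlonglongrightarrow> 0 * approx_const y M"
    using rate_bounds[OF uhp_potentialD(1)[OF P]] by (intro tendsto_mult LIMSEQ_power_zero) auto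
  then have l: "(\<lambda>n. rate y ^ n * approx_const y M) \<longlonglongrightarrow> 0" by simp
  show "uniform_limit UNIV (m_approx \<alpha> v) (m_past \<alpha> v) sequentially"
  proof (rule uniform_limitI)
    fix e :: real assume "0 < e"
    from order_tendstoD(2)[OF l this]
    show "\<forall>\<^sub>F n in sequentially. \<forall>x\<in>UNIV. dist (m_approx \<alpha> v n x) (m_past \<alpha> v x) < e"
      by eventually_elim (use m_past_approx[OF P] in \<open>auto simp: dist_norm intro: order.strict_trans1\<close>)
  qed
qed (use m_approx_continuous[OF P] in auto)

lemma m_past_periodic:
  assumes P: "uhp_potential y M v"
  shows "m_past \<alpha> v (\<theta> + 1) = m_past \<alpha> v \<theta>"
proof -
  have "m_approx \<alpha> v n (\<theta> + 1) = m_approx \<alpha> v n \<theta>" for n \<theta>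
  proof (induction n arbitrary: \<theta>)
    case (Suc n)
    have "\<theta> + 1 - \<alpha> = (\<theta> - \<alpha>) + 1" by simp
    then show ?case using Suc[of "\<theta> - \<alpha>"] uhp_potentialD(3)[OF P, of "\<theta> - \<alpha>"]
      by (simp only: m_approx.simps)
  qed (use uhp_potentialD(3)[OF P] in auto)
  then show ?thesis by (simp add: m_past_def)
qed

lemma m_past_eq:
  assumes P: "uhp_potential y M v"
  shows "m_past \<alpha> v (\<theta> + \<alpha>) = v \<theta> - 1 / m_past \<alpha> v \<theta>"
proof -
  have "(\<lambda>n. m_approx \<alpha> v (Suc n) (\<theta> + \<alpha>)) \<longlonglongrightarrow> v \<theta> - 1 / m_past \<alpha> v \<theta>"
    by (auto intro!: tendsto_intros m_past_tendsto[OF P] m_past_bounds(4)[OF P])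
  moreover have "(\<lambda>n. m_approx \<alpha> v (Suc n) (\<theta> + \<alpha>)) \<longlonglongrightarrow> m_past \<alpha> v (\<theta> + \<alpha>)"
    using m_past_tendsto[OF P] LIMSEQ_Suc by blast
  ultimately show ?thesis using LIMSEQ_unique by blast
qed

section \<open>The complexified exponent and the Green function\<close>

text \<open>The principal logarithm is harmless since \<open>m_past\<close> takes values in the upper half-plane.\<close>
definition complex_exponent :: "real \<Rightarrow> (real \<Rightarrow> complex) \<Rightarrow> complex" where
  "complex_exponent \<alpha> v = integral {0..1} (\<lambda>\<theta>. Ln (m_past \<alpha> v \<theta>))"

text \<open>The section of the backward dynamics, indexed so that \<open>m_future \<theta>\<close> depends on
  \<open>v(\<theta>), v(\<theta> + \<alpha>), \<dots>\<close>.\<close>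
definition m_future :: "real \<Rightarrow> (real \<Rightarrow> complex) \<Rightarrow> real \<Rightarrow> complex" where
  "m_future \<alpha> v \<theta> = m_past (-\<alpha>) v (\<theta> - \<alpha>)"

text \<open>For \<open>v' = v\<close> this is the diagonal entry at 0 of the resolvent of the whole line operator over
  \<open>\<theta>\<close> (up to sign). With different arguments it is the Green function of the operator with potential \<open>v'\<close> in
  the past and \<open>v\<close> from the present on.\<close>
definition green :: "real \<Rightarrow> (real \<Rightarrow> complex) \<Rightarrow> (real \<Rightarrow> complex) \<Rightarrow> real \<Rightarrow> complex" where
  "green \<alpha> v v' \<theta> = 1 / (m_future \<alpha> v \<theta> - 1 / m_past \<alpha> v' \<theta>)"

lemma m_future_eq:
  assumes P: "uhp_potential y M v"
  shows "m_future \<alpha> v \<theta> = v \<theta> - 1 / m_future \<alpha> v (\<theta> + \<alpha>)"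
  using m_past_eq[OF P, of "-\<alpha>" \<theta>] by (simp add: m_future_def)

lemma m_future_bounds:
  assumes P: "uhp_potential y M v"
  shows "y \<le> Im (m_future \<alpha> v \<theta>)" "cmod (m_future \<alpha> v \<theta>) \<le> M + 1 / y"
    "0 < Im (m_future \<alpha> v \<theta>)" "m_future \<alpha> v \<theta> \<noteq> 0"
  unfolding m_future_def using m_past_bounds[OF P] by auto

lemma m_future_continuous:
  assumes P: "uhp_potential y M v"
  shows "continuous_on UNIV (m_future \<alpha> v)"
  unfolding m_future_def
  by (rule continuous_on_compose2[OF m_past_continuous[OF P]]) (auto intro!: continuous_intros)

lemma m_future_periodic:
  assumes P: "uhp_potential y M v"
  shows "m_future \<alpha> v (\<theta> + 1) = m_future \<alpha> v \<theta>"
  unfolding m_future_def using m_past_periodic[OF P, of "-\<alpha>" "\<theta> - \<alpha>"] by (simp add: algebra_simps)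

lemma continuous_Ln_uhp:
  assumes "continuous_on S f" "\<And>x. x \<in> S \<Longrightarrow> 0 < Im (f x)"
  shows "continuous_on S (\<lambda>x. Ln (f x))"
  using assms by (intro continuous_on_Ln') (force simp: complex_nonpos_Reals_iff)+

text \<open>Both sums have imaginary part between 0 and \<open>2 * pi\<close>, so they cannot differ by a period.\<close>
lemma Ln_add_uhp:
  assumes im: "0 < Im a" "0 < Im b" "0 < Im c" "0 < Im d" and eq: "a * b = c * d"
  shows "Ln a + Ln b = Ln c + Ln d"
proof -
  have nz: "a \<noteq> 0" "b \<noteq> 0" "c \<noteq> 0" "d \<noteq> 0" using im by auto
  have "exp (Ln a + Ln b) = exp (Ln c + Ln d)" using nz eq by (simp add: exp_add)
  moreover have "\<bar>Im (Ln a + Ln b) - Im (Ln c + Ln d)\<bar> < 2 * pi"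
    using im nz Im_Ln_pos_lt_imp[of a] Im_Ln_pos_lt_imp[of b] Im_Ln_pos_lt_imp[of c] Im_Ln_pos_lt_imp[of d]
    by auto
  ultimately show ?thesis by (rule exp_complex_eqI[rotated])
qed

lemma Ln_divide_uhp:
  assumes im: "0 < Im a" "0 < Im b"
  shows "Ln (a / b) = Ln a - Ln b"
proof (rule Ln_unique)
  have nz: "a \<noteq> 0" "b \<noteq> 0" using im by auto
  then show "exp (Ln a - Ln b) = a / b" by (simp add: exp_diff)
  show "- pi < Im (Ln a - Ln b)" "Im (Ln a - Ln b) \<le> pi"
    using im Im_Ln_pos_lt_imp[of a] Im_Ln_pos_lt_imp[of b] by auto
qed

lemma green_denom_Im:
  assumes P: "uhp_potential y M v" and P': "uhp_potential y' M' v'"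
  shows "y \<le> Im (m_future \<alpha> v \<theta> - 1 / m_past \<alpha> v' \<theta>)"
proof -
  have "0 < Im (- 1 / m_past \<alpha> v' \<theta>)"
    using Im_neg_inverse_bounds(1)[OF uhp_potentialD(1)[OF P'] m_past_bounds(1)[OF P']] .
  then show ?thesis using m_future_bounds(1)[OF P, of \<alpha> \<theta>] by simp
qed

lemma green_bounds:
  assumes P: "uhp_potential y M v" and P': "uhp_potential y' M' v'"
  shows "cmod (green \<alpha> v v' \<theta>) \<le> 1 / y" "green \<alpha> v v' \<theta> \<noteq> 0"
proof -
  note b = Im_neg_inverse_bounds[OF uhp_potentialD(1)[OF P] green_denom_Im[OF P P', of \<alpha> \<theta>]]
  show "cmod (green \<alpha> v v' \<theta>) \<le> 1 / y" using b(3) by (simp add: green_def)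
  show "green \<alpha> v v' \<theta> \<noteq> 0" using b(4) by (simp add: green_def)
qed

lemma green_continuous:
  assumes P: "uhp_potential y M v" and P': "uhp_potential y' M' v'"
  shows "continuous_on UNIV (green \<alpha> v v')"
proof -
  have "m_future \<alpha> v \<theta> - 1 / m_past \<alpha> v' \<theta> \<noteq> 0" for \<theta>
    using Im_neg_inverse_bounds(4)[OF uhp_potentialD(1)[OF P] green_denom_Im[OF P P', of \<alpha> \<theta>]] .
  then have "continuous_on UNIV (\<lambda>\<theta>. 1 / (m_future \<alpha> v \<theta> - 1 / m_past \<alpha> v' \<theta>))"
    by (intro continuous_intros m_future_continuous[OF P] m_past_continuous[OF P']) (use m_past_bounds(4)[OF P'] in auto)
  then show ?thesis by (simp add: green_def[abs_def])
qed

lemma Ln_m_past_continuous: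
  assumes P: "uhp_potential y M v"
  shows "continuous_on S (\<lambda>\<theta>. Ln (m_past \<alpha> v \<theta>))"
  by (intro continuous_Ln_uhp continuous_on_subset[OF m_past_continuous[OF P]]) (use m_past_bounds[OF P] in auto)

lemma Ln_m_future_continuous:
  assumes P: "uhp_potential y M v"
  shows "continuous_on S (\<lambda>\<theta>. Ln (m_future \<alpha> v \<theta>))"
  by (intro continuous_Ln_uhp continuous_on_subset[OF m_future_continuous[OF P]]) (use m_future_bounds[OF P] in auto)

text \<open>The logarithm telescopes: up to the coboundary of \<open>Ln F\<close> it is the difference of the logarithms of
  the two sections. The identity holds for principal values because all factors lie in the upper half-plane.\<close>
lemma Ln_green_cocycle:
  fixes \<alpha> :: real
  assumes P: "uhp_potential y M v" and P': "uhp_potential y' M' v'"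
  defines "F \<equiv> \<lambda>\<theta>. m_past \<alpha> v' \<theta> - 1 / m_future \<alpha> v \<theta>"
  shows "0 < Im (F \<theta>)"
    and "Ln (1 + (v' \<theta> - v \<theta>) * green \<alpha> v v' \<theta>) =
      Ln (F (\<theta> + \<alpha>)) - Ln (F \<theta>) + Ln (m_past \<alpha> v' \<theta>) - Ln (m_future \<alpha> v \<theta>)"
proof -
  note y = uhp_potentialD(1)[OF P]
  have Fpos: "0 < Im (F \<theta>)" for \<theta>
    using Im_neg_inverse_bounds(1)[OF y m_future_bounds(1)[OF P], of \<alpha> \<theta>] m_past_bounds(3)[OF P', of \<alpha> \<theta>]
    by (simp add: F_def)
  show "0 < Im (F \<theta>)" by (rule Fpos)
  define E where "E = m_future \<alpha> v \<theta> - 1 / m_past \<alpha> v' \<theta>"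
  have E: "0 < Im E" using green_denom_Im[OF P P', of \<alpha> \<theta>] y by (simp add: E_def)
  have nz: "E \<noteq> 0" "m_past \<alpha> v' \<theta> \<noteq> 0" "m_future \<alpha> v \<theta> \<noteq> 0"
    using E m_past_bounds(4)[OF P'] m_future_bounds(4)[OF P] by auto
  have 1: "1 + (v' \<theta> - v \<theta>) * green \<alpha> v v' \<theta> = (E + (v' \<theta> - v \<theta>)) / E"
    using nz by (simp add: green_def E_def[symmetric] field_simps)
  also have "E + (v' \<theta> - v \<theta>) = F (\<theta> + \<alpha>)"
    unfolding E_def F_def m_past_eq[OF P'] using m_future_eq[OF P, of \<alpha> \<theta>] by (simp add: algebra_simps)
  finally have 2: "Ln (1 + (v' \<theta> - v \<theta>) * green \<alpha> v v' \<theta>) = Ln (F (\<theta> + \<alpha>)) - Ln E"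
    using Ln_divide_uhp[OF Fpos E] by simp
  have "Ln E + Ln (m_past \<alpha> v' \<theta>) = Ln (F \<theta>) + Ln (m_future \<alpha> v \<theta>)"
  proof (rule Ln_add_uhp[OF E m_past_bounds(3)[OF P'] Fpos m_future_bounds(3)[OF P]])
    show "E * m_past \<alpha> v' \<theta> = F \<theta> * m_future \<alpha> v \<theta>"
      using nz by (simp add: E_def F_def left_diff_distrib mult.commute[of "m_past \<alpha> v' \<theta>"])
  qed
  then have "Ln E = Ln (F \<theta>) + Ln (m_future \<alpha> v \<theta>) - Ln (m_past \<alpha> v' \<theta>)"
    by (simp add: eq_diff_eq)
  then show "Ln (1 + (v' \<theta> - v \<theta>) * green \<alpha> v v' \<theta>) =
      Ln (F (\<theta> + \<alpha>)) - Ln (F \<theta>) + Ln (m_past \<alpha> v' \<theta>) - Ln (m_future \<alpha> v \<theta>)"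
    unfolding 2 by simp
qed

text \<open>For \<open>v' = v\<close> the right hand side is 0, so the forward and the backward section have
  the same exponent.\<close>
lemma complex_exponent_diff_m_future:
  assumes P: "uhp_potential y M v" and P': "uhp_potential y' M' v'"
  shows "complex_exponent \<alpha> v' - integral {0..1} (\<lambda>\<theta>. Ln (m_future \<alpha> v \<theta>)) =
    integral {0..1} (\<lambda>\<theta>. Ln (1 + (v' \<theta> - v \<theta>) * green \<alpha> v v' \<theta>))"
proof -
  define F where "F \<theta> = m_past \<alpha> v' \<theta> - 1 / m_future \<alpha> v \<theta>" for \<theta>
  have Fpos: "0 < Im (F \<theta>)" for \<theta>
    unfolding F_def by (rule Ln_green_cocycle(1)[OF P P'])
  have Fc: "continuous_on UNIV F"
    unfolding F_def using m_future_bounds(4)[OF P]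
    by (intro continuous_intros m_future_continuous[OF P] m_past_continuous[OF P']) auto
  have LF: "continuous_on UNIV (\<lambda>\<theta>. Ln (F \<theta>))"
    by (intro continuous_Ln_uhp Fc Fpos)
  have LF': "continuous_on UNIV (\<lambda>\<theta>. Ln (F (\<theta> + \<alpha>)))"
    by (rule continuous_on_compose2[OF LF]) (auto intro!: continuous_intros)
  have i: "f integrable_on {0..1}" if "continuous_on UNIV f" for f :: "real \<Rightarrow> complex"
    by (intro integrable_continuous_real continuous_on_subset[OF that]) auto
  have "integral {0..1} (\<lambda>\<theta>. Ln (1 + (v' \<theta> - v \<theta>) * green \<alpha> v v' \<theta>)) =
    integral {0..1} (\<lambda>\<theta>. Ln (F (\<theta> + \<alpha>)) - Ln (F \<theta>) + Ln (m_past \<alpha> v' \<theta>) - Ln (m_future \<alpha> v \<theta>))"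
    unfolding Ln_green_cocycle(2)[OF P P'] F_def ..
  also have "\<dots> = integral {0..1} (\<lambda>\<theta>. Ln (F (\<theta> + \<alpha>))) - integral {0..1} (\<lambda>\<theta>. Ln (F \<theta>))
     + integral {0..1} (\<lambda>\<theta>. Ln (m_past \<alpha> v' \<theta>)) - integral {0..1} (\<lambda>\<theta>. Ln (m_future \<alpha> v \<theta>))"
    by (intro integral_unique has_integral_add has_integral_diff integrable_integral i LF LF'
        Ln_m_past_continuous[OF P'] Ln_m_future_continuous[OF P])
  also have "integral {0..1} (\<lambda>\<theta>. Ln (F (\<theta> + \<alpha>))) = integral {0..1} (\<lambda>\<theta>. Ln (F \<theta>))"
    by (rule periodic_integral_shift[OF LF])
      (simp add: F_def m_future_periodic[OF P] m_past_periodic[OF P'])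
  finally show ?thesis by (simp add: complex_exponent_def)
qed

text \<open>The analogue of replacing the potential site by site in a determinant: each replacement changes
  the logarithm of the determinant by \<open>Ln (1 + c G)\<close>, with the Green function of the partially replaced
  potential.\<close>
theorem complex_exponent_diff:
  assumes P: "uhp_potential y M v" and P': "uhp_potential y' M' v'"
  shows "complex_exponent \<alpha> v' - complex_exponent \<alpha> v =
    integral {0..1} (\<lambda>\<theta>. Ln (1 + (v' \<theta> - v \<theta>) * green \<alpha> v v' \<theta>))"
  using complex_exponent_diff_m_future[OF P P', of \<alpha>] complex_exponent_diff_m_future[OF P P, of \<alpha>] by simp

lemma quotient_diff:
  fixes a b :: complex
  assumes "a \<noteq> 0" "b \<noteq> 0"
  shows "1 / a - 1 / b = 1 / a * (1 / b) * (b - a)"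
  using assms by (simp add: field_simps)

lemma hyp_dist_green:
  assumes P: "uhp_potential y M v" and P1: "uhp_potential y M1 v1" and P2: "uhp_potential y M2 v2"
  shows "cmod (green \<alpha> v v1 \<theta> - green \<alpha> v v2 \<theta>) \<le> hyp_dist (m_past \<alpha> v1 \<theta>) (m_past \<alpha> v2 \<theta>) / y ^ 3"
proof -
  note y = uhp_potentialD(1)[OF P]
  define w1 w2 where "w1 = m_past \<alpha> v1 \<theta>" and "w2 = m_past \<alpha> v2 \<theta>"
  have w: "y \<le> Im w1" "y \<le> Im w2" unfolding w1_def w2_def
    using m_past_bounds(1)[OF P1] m_past_bounds(1)[OF P2] by auto
  have nz: "m_future \<alpha> v \<theta> - 1 / w1 \<noteq> 0" "m_future \<alpha> v \<theta> - 1 / w2 \<noteq> 0"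
    unfolding w1_def w2_def
    using Im_neg_inverse_bounds(4)[OF y] green_denom_Im[OF P P1] green_denom_Im[OF P P2] by blast+
  have "green \<alpha> v v1 \<theta> - green \<alpha> v v2 \<theta> =
    green \<alpha> v v1 \<theta> * green \<alpha> v v2 \<theta> * ((- 1 / w2) - (- 1 / w1))"
    using quotient_diff[OF nz] by (simp add: green_def w1_def[symmetric] w2_def[symmetric])
  also have "cmod \<dots> \<le> 1 / y * (1 / y) * (hyp_dist w1 w2 * (1 / y))"
    unfolding norm_mult
  proof (intro mult_mono)
    show "cmod ((- 1 / w2) - (- 1 / w1)) \<le> hyp_dist w1 w2 * (1 / y)"
    proof -
      note b1 = Im_neg_inverse_bounds[OF y w(1)] and b2 = Im_neg_inverse_bounds[OF y w(2)]
      have "cmod ((- 1 / w2) - (- 1 / w1)) = cmod ((- 1 / w1) - (- 1 / w2))"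
        by (rule norm_minus_commute)
      also have "\<dots> = hyp_dist w1 w2 * sqrt (Im (- 1 / w1) * Im (- 1 / w2))"
        unfolding cmod_diff_hyp_dist[OF b1(1) b2(1)] using w y by (subst hyp_dist_neg_inverse) auto
      also have "\<dots> \<le> hyp_dist w1 w2 * (1 / y)"
        using b1 b2 w y by (intro mult_left_mono sqrt_le_of_le hyp_dist_nonneg) (auto intro: less_imp_le)
      finally show ?thesis .
    qed
  qed (use y green_bounds[OF P P1] green_bounds[OF P P2] in auto)
  finally show ?thesis by (simp add: w1_def w2_def power3_eq_cube field_simps)
qed

lemma hyp_dist_m_past_step:
  assumes P1: "uhp_potential y M1 v1" and P2: "uhp_potential y M2 v2"
  shows "hyp_dist (m_past \<alpha> v1 (\<theta> + \<alpha>)) (m_past \<alpha> v2 (\<theta> + \<alpha>)) \<le>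
    cmod (v1 \<theta> - v2 \<theta>) / y + rate y * hyp_dist (m_past \<alpha> v1 \<theta>) (m_past \<alpha> v2 \<theta>)"
  unfolding m_past_eq[OF P1] m_past_eq[OF P2]
  by (rule hyp_dist_step) (use m_past_bounds(1)[OF P1] m_past_bounds(1)[OF P2] uhp_potentialD[OF P1] uhp_potentialD[OF P2] in auto)

lemma hyp_dist_m_past_nonneg:
  assumes P1: "uhp_potential y M1 v1" and P2: "uhp_potential y M2 v2"
  shows "0 \<le> hyp_dist (m_past \<alpha> v1 \<theta>) (m_past \<alpha> v2 \<theta>)"
  by (rule hyp_dist_nonneg) (use m_past_bounds(3)[OF P1] m_past_bounds(3)[OF P2] in auto)

lemma hyp_dist_m_past_bounded:
  assumes P1: "uhp_potential y M v1" and P2: "uhp_potential y M v2"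
  shows "hyp_dist (m_past \<alpha> v1 \<theta>) (m_past \<alpha> v2 \<theta>) \<le> 2 * (M + 1 / y) / y"
  by (rule hyp_dist_bound) (use m_past_bounds[OF P1] m_past_bounds[OF P2] uhp_potentialD[OF P1] in auto)

lemma one_minus_rate: "0 < y \<Longrightarrow> 1 / (1 - rate y) = (1 + y\<^sup>2) / y\<^sup>2"
proof -
  assume y: "0 < y"
  have "1 - rate y = y\<^sup>2 / (1 + y\<^sup>2)"
    unfolding rate_def using y by (simp add: field_simps add_pos_nonneg add_nonneg_eq_0_iff)
  then show ?thesis by simp
qed

text \<open>Iterating the one step estimate gives a geometric series; the remainder \<open>rate y ^ n * D\<close> tends
  to 0.\<close>
lemma hyp_dist_m_past_sup:
  assumes P1: "uhp_potential y M v1" and P2: "uhp_potential y M v2"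
    and A: "\<And>\<theta>. cmod (v1 \<theta> - v2 \<theta>) \<le> A"
  shows "hyp_dist (m_past \<alpha> v1 \<theta>) (m_past \<alpha> v2 \<theta>) \<le> A / y / (1 - rate y)"
proof -
  note y = uhp_potentialD(1)[OF P1]
  note r = rate_bounds[OF y]
  define D where "D = 2 * (M + 1 / y) / y"
  have A0: "0 \<le> A" using A[of 0] norm_ge_zero order_trans by blast
  have "hyp_dist (m_past \<alpha> v1 \<theta>) (m_past \<alpha> v2 \<theta>) \<le> A / y / (1 - rate y) + rate y ^ n * D" for n
  proof (induction n arbitrary: \<theta>)
    case 0
    have "0 \<le> A / y / (1 - rate y)" using A0 y r by auto
    then show ?case using hyp_dist_m_past_bounded[OF P1 P2, of \<alpha> \<theta>] by (simp add: D_def)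
  next
    case (Suc n)
    have "hyp_dist (m_past \<alpha> v1 (\<theta> - \<alpha> + \<alpha>)) (m_past \<alpha> v2 (\<theta> - \<alpha> + \<alpha>)) \<le>
      cmod (v1 (\<theta> - \<alpha>) - v2 (\<theta> - \<alpha>)) / y + rate y * hyp_dist (m_past \<alpha> v1 (\<theta> - \<alpha>)) (m_past \<alpha> v2 (\<theta> - \<alpha>))"
      by (rule hyp_dist_m_past_step[OF P1 P2])
    also have "\<dots> \<le> A / y + rate y * (A / y / (1 - rate y) + rate y ^ n * D)"
      using y r by (intro add_mono divide_right_mono mult_left_mono A Suc) auto
    also have "\<dots> = A / y / (1 - rate y) + rate y ^ Suc n * D"
      using y r by (simp add: field_simps)
    finally show ?case by simp
  qed
  moreover have "(\<lambda>n. A / y / (1 - rate y) + rate y ^ n * D) \<longlonglongrightarrow> A / y / (1 - rate y) + 0 * D"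
    using r by (intro tendsto_intros LIMSEQ_power_zero) auto
  ultimately show ?thesis by (intro LIMSEQ_le_const) auto
qed

lemma Ln_linear:
  fixes x :: complex
  assumes "cmod x \<le> 1/2" shows "cmod (Ln (1 + x) - x) \<le> 2 * (cmod x)\<^sup>2"
proof -
  have "cmod (Ln (1 + x) - x) \<le> (cmod x)\<^sup>2 / (1 - cmod x)"
    using Ln_approx_linear[of x] assms by simp
  also have "\<dots> \<le> (cmod x)\<^sup>2 / (1/2)" using assms by (intro divide_left_mono) auto
  finally show ?thesis by simp
qed

lemma cmod_integral_le:
  fixes f :: "real \<Rightarrow> complex"
  assumes "continuous_on UNIV f" "continuous_on UNIV g" "\<And>x. cmod (f x) \<le> g x"
  shows "cmod (integral {0..1} f) \<le> integral {0..1} g"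
  by (intro integral_norm_bound_integral integrable_continuous_real continuous_on_subset[OF assms(1)]
      continuous_on_subset[OF assms(2)] assms(3)) auto

text \<open>The remainder is quadratic: one part comes from the logarithm, the other from
  the dependence of \<open>green \<alpha> v v'\<close> on \<open>v'\<close>.\<close>
theorem complex_exponent_first_order:
  assumes P: "uhp_potential y M v" and P': "uhp_potential y M v'"
    and A: "\<And>\<theta>. cmod (v' \<theta> - v \<theta>) \<le> A" and Ay: "A \<le> y / 2"
  shows "cmod (complex_exponent \<alpha> v' - complex_exponent \<alpha> v - integral {0..1} (\<lambda>\<theta>. (v' \<theta> - v \<theta>) * green \<alpha> v v \<theta>))
     \<le> (1 / (y ^ 4 * (1 - rate y)) + 2 / y\<^sup>2) * A\<^sup>2"
proof -
  note y = uhp_potentialD(1)[OF P]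
  note r = rate_bounds[OF y]
  have A0: "0 \<le> A" using A[of 0] norm_ge_zero order_trans by blast
  define x where "x \<theta> = (v' \<theta> - v \<theta>) * green \<alpha> v v' \<theta>" for \<theta>
  have xb: "cmod (x \<theta>) \<le> A / y" for \<theta>
    unfolding x_def norm_mult using mult_mono[OF A green_bounds(1)[OF P P', of \<alpha> \<theta>], of \<theta>] A0 by simp
  have xh: "cmod (x \<theta>) \<le> 1/2" for \<theta>
    using order_trans[OF xb[of \<theta>] divide_right_mono[OF Ay]] y by simp
  have pt: "cmod (Ln (1 + x \<theta>) - (v' \<theta> - v \<theta>) * green \<alpha> v v \<theta>) \<le> (1 / (y ^ 4 * (1 - rate y)) + 2 / y\<^sup>2) * A\<^sup>2" for \<theta>
  proof -
    have "cmod (Ln (1 + x \<theta>) - x \<theta>) \<le> 2 * (A / y)\<^sup>2"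
      using Ln_linear[OF xh[of \<theta>]] power_mono[OF xb[of \<theta>], of 2] by simp
    moreover have "cmod (x \<theta> - (v' \<theta> - v \<theta>) * green \<alpha> v v \<theta>) \<le> A * (A / y / (1 - rate y) / y ^ 3)"
      unfolding x_def right_diff_distrib[symmetric] norm_mult
      by (intro mult_mono A order_trans[OF hyp_dist_green[OF P P' P]] divide_right_mono hyp_dist_m_past_sup[OF P' P])
        (use y A0 in auto)
    ultimately have "cmod (Ln (1 + x \<theta>) - (v' \<theta> - v \<theta>) * green \<alpha> v v \<theta>) \<le> 2 * (A / y)\<^sup>2 + A * (A / y / (1 - rate y) / y ^ 3)"
      using norm_triangle_ineq[of "Ln (1 + x \<theta>) - x \<theta>" "x \<theta> - (v' \<theta> - v \<theta>) * green \<alpha> v v \<theta>"] by simp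
    also have "\<dots> = (1 / (y ^ 4 * (1 - rate y)) + 2 / y\<^sup>2) * A\<^sup>2"
      by (simp add: power2_eq_square power3_eq_cube power4_eq_xxxx algebra_simps)
    finally show ?thesis .
  qed
  have vc: "continuous_on UNIV (\<lambda>\<theta>. v' \<theta> - v \<theta>)"
    using uhp_potentialD(2)[OF P] uhp_potentialD(2)[OF P'] by (intro continuous_intros)
  have xc: "continuous_on UNIV x" unfolding x_def
    by (intro continuous_intros vc green_continuous[OF P P'])
  have Lc: "continuous_on UNIV (\<lambda>\<theta>. Ln (1 + x \<theta>))"
  proof (intro continuous_on_Ln' continuous_intros xc)
    fix \<theta> show "1 + x \<theta> \<notin> \<real>\<^sub>\<le>\<^sub>0"
      using xh[of \<theta>] abs_Re_le_cmod[of "x \<theta>"] by (auto simp: complex_nonpos_Reals_iff)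
  qed
  have Gc: "continuous_on UNIV (\<lambda>\<theta>. (v' \<theta> - v \<theta>) * green \<alpha> v v \<theta>)"
    by (intro continuous_intros vc green_continuous[OF P P])
  have i: "f integrable_on {0..1}" if "continuous_on UNIV f" for f :: "real \<Rightarrow> complex"
    by (intro integrable_continuous_real continuous_on_subset[OF that]) auto
  have "complex_exponent \<alpha> v' - complex_exponent \<alpha> v - integral {0..1} (\<lambda>\<theta>. (v' \<theta> - v \<theta>) * green \<alpha> v v \<theta>)
    = integral {0..1} (\<lambda>\<theta>. Ln (1 + x \<theta>) - (v' \<theta> - v \<theta>) * green \<alpha> v v \<theta>)"
    unfolding complex_exponent_diff[OF P P'] x_def[symmetric]
    by (simp add: Henstock_Kurzweil_Integration.integral_diff i Lc Gc)
  also have "cmod \<dots> \<le> integral {0..1} (\<lambda>\<theta>::real. (1 / (y ^ 4 * (1 - rate y)) + 2 / y\<^sup>2) * A\<^sup>2)"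
    by (rule cmod_integral_le) (auto intro!: continuous_intros Lc Gc pt)
  also have "\<dots> = (1 / (y ^ 4 * (1 - rate y)) + 2 / y\<^sup>2) * A\<^sup>2" by simp
  finally show ?thesis .
qed

lemma complex_exponent_Im:
  assumes P: "uhp_potential y M v"
  shows "0 \<le> Im (complex_exponent \<alpha> v)" "Im (complex_exponent \<alpha> v) \<le> pi"
proof -
  have i: "(\<lambda>\<theta>. Ln (m_past \<alpha> v \<theta>)) integrable_on {0..1}"
    by (intro integrable_continuous_real Ln_m_past_continuous[OF P])
  have e: "Im (complex_exponent \<alpha> v) = integral {0..1} (\<lambda>\<theta>. Im (Ln (m_past \<alpha> v \<theta>)))"
    unfolding complex_exponent_def using integral_linear[OF i bounded_linear_Im] by (simp add: o_def)
  have i': "(\<lambda>\<theta>. Im (Ln (m_past \<alpha> v \<theta>))) integrable_on {0..1}"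
    using integrable_linear[OF i bounded_linear_Im] by (simp add: o_def)
  have b: "0 \<le> Im (Ln (m_past \<alpha> v \<theta>))" "Im (Ln (m_past \<alpha> v \<theta>)) \<le> pi" for \<theta>
    using Im_Ln_pos_lt_imp[OF m_past_bounds(3)[OF P], of \<alpha> \<theta>] m_past_bounds(4)[OF P, of \<alpha> \<theta>] by auto
  show "0 \<le> Im (complex_exponent \<alpha> v)" unfolding e by (intro Henstock_Kurzweil_Integration.integral_nonneg i' b)
  have "integral {0..1} (\<lambda>\<theta>. Im (Ln (m_past \<alpha> v \<theta>))) \<le> integral {0..1} (\<lambda>\<theta>::real. pi)"
    by (intro integral_le i' b) auto
  then show "Im (complex_exponent \<alpha> v) \<le> pi" unfolding e by simp
qed

lemma complex_exponent_Re:
  assumes P: "uhp_potential y M v"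
  shows "Re (complex_exponent \<alpha> v) = integral {0..1} (\<lambda>\<theta>. ln (cmod (m_past \<alpha> v \<theta>)))"
proof -
  have i: "(\<lambda>\<theta>. Ln (m_past \<alpha> v \<theta>)) integrable_on {0..1}"
    by (intro integrable_continuous_real Ln_m_past_continuous[OF P])
  have "Re (complex_exponent \<alpha> v) = integral {0..1} (\<lambda>\<theta>. Re (Ln (m_past \<alpha> v \<theta>)))"
    unfolding complex_exponent_def using integral_linear[OF i bounded_linear_Re] by (simp add: o_def)
  then show ?thesis using m_past_bounds(4)[OF P] by simp
qed

lemma ln_m_past_continuous:
  assumes P: "uhp_potential y M v"
  shows "continuous_on UNIV (\<lambda>\<theta>. ln (cmod (m_past \<alpha> v \<theta>)))"
  by (intro continuous_intros m_past_continuous[OF P]) (use m_past_bounds(4)[OF P] in auto)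

text \<open>The height of the section satisfies \<open>Im m(\<theta> + \<alpha>) \<ge> Im m(\<theta>) / |m(\<theta>)|\<^sup>2\<close>. Taking logarithms and
  integrating, the invariance of the integral gives \<open>0 \<ge> -2 Re \<Lambda>\<close>.\<close>
lemma complex_exponent_Re_nonneg:
  assumes P: "uhp_potential y M v"
  shows "0 \<le> Re (complex_exponent \<alpha> v)"
proof -
  define g where "g \<theta> = ln (Im (m_past \<alpha> v \<theta>))" for \<theta>
  have gc: "continuous_on UNIV g" unfolding g_def
    by (intro continuous_intros m_past_continuous[OF P]) (use m_past_bounds(3)[OF P] less_irrefl in metis)
  have gc': "continuous_on UNIV (\<lambda>\<theta>. g (\<theta> + \<alpha>))"
    by (rule continuous_on_compose2[OF gc]) (auto intro!: continuous_intros)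
  have pt: "g \<theta> - 2 * ln (cmod (m_past \<alpha> v \<theta>)) \<le> g (\<theta> + \<alpha>)" for \<theta>
  proof -
    note w = m_past_bounds[OF P, of \<alpha> \<theta>]
    have "g \<theta> - 2 * ln (cmod (m_past \<alpha> v \<theta>)) = ln (Im (m_past \<alpha> v \<theta>) / (cmod (m_past \<alpha> v \<theta>))\<^sup>2)"
      using w by (simp add: g_def ln_div ln_realpow)
    also have "\<dots> \<le> ln (Im (m_past \<alpha> v (\<theta> + \<alpha>)))"
    proof (rule ln_mono)
      show "0 < Im (m_past \<alpha> v \<theta>) / (cmod (m_past \<alpha> v \<theta>))\<^sup>2" using w by simp
      show "Im (m_past \<alpha> v \<theta>) / (cmod (m_past \<alpha> v \<theta>))\<^sup>2 \<le> Im (m_past \<alpha> v (\<theta> + \<alpha>))"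
        unfolding m_past_eq[OF P] Im_neg_inverse[symmetric]
        using uhp_potentialD(1)[OF P] uhp_potentialD(4)[OF P, of \<theta>] by simp
    qed
    finally show ?thesis by (simp add: g_def)
  qed
  have i: "f integrable_on {0..1}" if "continuous_on UNIV f" for f :: "real \<Rightarrow> real"
    by (intro integrable_continuous_real continuous_on_subset[OF that]) auto
  note lc = ln_m_past_continuous[OF P, of \<alpha>]
  have "integral {0..1} (\<lambda>\<theta>. g \<theta> - 2 * ln (cmod (m_past \<alpha> v \<theta>))) \<le> integral {0..1} (\<lambda>\<theta>. g (\<theta> + \<alpha>))"
    by (intro integral_le i gc' pt continuous_intros gc lc)
  also have "integral {0..1} (\<lambda>\<theta>. g (\<theta> + \<alpha>)) = integral {0..1} g"
    by (rule periodic_integral_shift[OF gc]) (simp add: g_def m_past_periodic[OF P])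
  also have "integral {0..1} (\<lambda>\<theta>. g \<theta> - 2 * ln (cmod (m_past \<alpha> v \<theta>))) = integral {0..1} g - 2 * Re (complex_exponent \<alpha> v)"
    unfolding complex_exponent_Re[OF P]
    by (intro integral_unique has_integral_diff has_integral_mult_right integrable_integral i gc lc)
  finally show ?thesis by simp
qed

section \<open>The Lyapunov exponent of a real potential\<close>

text \<open>Fekete's lemma: division with remainder by an index \<open>k\<close> with \<open>x k / k\<close> close to the infimum.\<close>
lemma fekete_convergent:
  fixes x :: "nat \<Rightarrow> real"
  assumes sub: "\<And>m n. x (m + n) \<le> x m + x n" and low: "\<And>n. - c \<le> x n"
    and c: "0 \<le> c"
  shows "convergent (\<lambda>n. x n / real n)"
proof -
  define S where "S = (\<lambda>n. x n / real n) ` {1..}"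
  define L where "L = Inf S"
  have bdd: "bdd_below S"
  proof (rule bdd_belowI[of _ "- c"])
    fix s assume "s \<in> S"
    then obtain n where n: "1 \<le> n" "s = x n / real n" by (auto simp: S_def)
    have "- c \<le> - c / real n" 
      using mult_left_mono[of 1 "real n" c] n c by (simp add: field_simps)
    also have "\<dots> \<le> x n / real n" using low n by (intro divide_right_mono) auto
    finally show "- c \<le> s" using n by simp
  qed
  have ne: "S \<noteq> {}" by (auto simp: S_def)
  have mult: "x (q * k + r) \<le> real q * x k + x r" for q k r
  proof (induction q)
    case (Suc q)
    have "x (Suc q * k + r) = x (k + (q * k + r))" by (simp add: add_ac)
    also have "\<dots> \<le> x k + x (q * k + r)" by (rule sub)
    also have "\<dots> \<le> x k + (real q * x k + x r)" using Suc by simp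
    finally show ?case by (simp add: algebra_simps)
  qed simp
  have "(\<lambda>n. x n / real n) \<longlonglongrightarrow> L"
  proof (rule LIMSEQ_I)
    fix r :: real assume r: "0 < r"
    have "Inf S < L + r / 2" using r by (simp add: L_def)
    then obtain s where "s \<in> S" "s < L + r / 2" using cInf_lessD[OF ne] by blast
    then obtain k where k: "1 \<le> k" "x k / real k < L + r / 2" by (auto simp: S_def)
    define B where "B = \<bar>x k\<bar> + Max ((\<lambda>i. \<bar>x i\<bar>) ` {..<k})"
    have B0: "0 \<le> B"
    proof -
      have "\<bar>x 0\<bar> \<le> Max ((\<lambda>i. \<bar>x i\<bar>) ` {..<k})" using k by (intro Max_ge) auto
      then show ?thesis unfolding B_def by linarith
    qed
    obtain N where N: "2 * B / r < real N" using reals_Archimedean2 by blast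
    show "\<exists>no. \<forall>n\<ge>no. norm (x n / real n - L) < r"
    proof (intro exI[of _ "max N 1"] allI impI)
      fix n assume n: "max N 1 \<le> n"
      then have np: "0 < real n" by simp
      define q s where "q = n div k" and "s = n mod k"
      have nq: "n = q * k + s" by (simp add: q_def s_def)
      have s: "s < k" using k by (simp add: s_def)
      have xs: "x s \<le> Max ((\<lambda>i. \<bar>x i\<bar>) ` {..<k})"
        using s by (intro order_trans[OF abs_ge_self Max_ge]) auto
      have "real q * x k = (real n - real s) * (x k / real k)"
        unfolding nq using k by (simp add: field_simps)
      also have "\<dots> = real n * (x k / real k) - real s / real k * x k" using k by (simp add: field_simps)
      also have "\<dots> \<le> real n * (x k / real k) + \<bar>x k\<bar>"
      proof -
        have "\<bar>real s / real k * x k\<bar> \<le> 1 * \<bar>x k\<bar>"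
          unfolding abs_mult using s k by (intro mult_right_mono) auto
        then show ?thesis by linarith
      qed
      finally have "x n \<le> real n * (x k / real k) + B"
        using mult[of q k s] xs by (simp add: nq[symmetric] B_def)
      then have "x n / real n \<le> x k / real k + B / real n" using np by (simp add: field_simps)
      also have "B / real n < r / 2"
      proof -
        have "2 * B / r < real n" using N n by simp
        then show ?thesis using r np by (simp add: field_simps)
      qed
      finally have "x n / real n < L + r" using k by simp
      moreover have "L \<le> x n / real n"
        unfolding L_def by (rule cInf_lower[OF _ bdd]) (use n in \<open>auto simp: S_def\<close>)
      ultimately show "norm (x n / real n - L) < r" by simp
    qed
  qed
  then show ?thesis by (rule convergentI)
qed

lemma onorm_continuous:
  fixes M :: "real \<Rightarrow> real^2^2"
  assumes "\<And>i j. continuous_on UNIV (\<lambda>\<theta>. M \<theta> $ i $ j)"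
  shows "continuous_on UNIV (\<lambda>\<theta>. onorm ((*v) (M \<theta>)))"
proof -
  have bl: "bounded_linear ((*v) A)" for A :: "real^2^2"
    by (rule matrix_vector_mul_bounded_linear)
  have lip: "\<bar>onorm ((*v) A) - onorm ((*v) B)\<bar> \<le> (\<Sum>i\<in>UNIV. \<Sum>j\<in>UNIV. \<bar>(A - B) $ i $ j\<bar>)" for A B :: "real^2^2"
  proof -
    have 1: "onorm ((*v) A) \<le> onorm ((*v) B) + onorm ((*v) (A - B))" for A B :: "real^2^2"
    proof -
      have "(*v) A = (\<lambda>x. B *v x + (A - B) *v x)"
        by (auto simp: fun_eq_iff matrix_vector_mult_diff_rdistrib)
      then show ?thesis using onorm_triangle[OF bl bl] by metis
    qed
    have 2: "onorm ((*v) (B - A)) = onorm ((*v) (A - B))"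
    proof -
      have "(*v) (B - A) = (\<lambda>x. - ((A - B) *v x))"
        by (auto simp: fun_eq_iff matrix_vector_mult_diff_rdistrib)
      then show ?thesis by (simp only: onorm_neg)
    qed
    show ?thesis using 1[of A B] 1[of B A] 2 onorm_le_matrix_component_sum[of "A - B"] by linarith
  qed
  show ?thesis
    unfolding continuous_on_eq_continuous_at[OF open_UNIV] isCont_def
  proof
    fix \<theta>
    have "((\<lambda>t. \<Sum>i\<in>UNIV. \<Sum>j\<in>UNIV. \<bar>(M t - M \<theta>) $ i $ j\<bar>) \<longlongrightarrow> (\<Sum>i\<in>(UNIV::2 set). \<Sum>j\<in>(UNIV::2 set). \<bar>M \<theta> $ i $ j - M \<theta> $ i $ j\<bar>)) (at \<theta>)"
      unfolding vector_minus_component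
      by (intro tendsto_sum tendsto_rabs tendsto_diff tendsto_const) (use assms in \<open>auto simp: continuous_on_eq_continuous_at isCont_def\<close>)
    then have g: "((\<lambda>t. \<Sum>i\<in>UNIV. \<Sum>j\<in>UNIV. \<bar>(M t - M \<theta>) $ i $ j\<bar>) \<longlongrightarrow> 0) (at \<theta>)" by simp
    have "\<forall>\<^sub>F t in at \<theta>. norm (onorm ((*v) (M t)) - onorm ((*v) (M \<theta>)))
        \<le> (\<Sum>i\<in>UNIV. \<Sum>j\<in>UNIV. \<bar>(M t - M \<theta>) $ i $ j\<bar>)"
      unfolding real_norm_def by (intro always_eventually allI lip)
    from Lim_null_comparison[OF this g]
    have "((\<lambda>t. onorm ((*v) (M t)) - onorm ((*v) (M \<theta>))) \<longlongrightarrow> 0) (at \<theta>)" .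
    then show "((\<lambda>t. onorm ((*v) (M t))) \<longlongrightarrow> onorm ((*v) (M \<theta>))) (at \<theta>)"
      by (rule Lim_null[THEN iffD2])
  qed
qed

text \<open>The determinant is a signed sum of two products of entries, each bounded by the operator norm. This
  crude bound suffices, because constants disappear after division by \<open>n\<close>.\<close>
lemma onorm_ge_det1:
  fixes A :: "real^2^2"
  assumes "det A = 1"
  shows "1 \<le> 2 * (onorm ((*v) A))\<^sup>2" "0 < onorm ((*v) A)"
proof -
  note c = matrix_component_le_onorm[of A]
  have p: "\<bar>A $ i $ j * A $ k $ l\<bar> \<le> (onorm ((*v) A))\<^sup>2" for i j k l
    unfolding abs_mult power2_eq_square using c by (intro mult_mono) (auto intro: order_trans[OF abs_ge_zero])
  have "A $ 1 $ 1 * A $ 2 $ 2 - A $ 1 $ 2 * A $ 2 $ 1 = 1" using assms by (simp add: det_2)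
  then show 1: "1 \<le> 2 * (onorm ((*v) A))\<^sup>2" using p[of 1 1 2 2] p[of 1 2 2 1] by linarith
  show "0 < onorm ((*v) A)"
  proof (rule ccontr)
    assume "\<not> 0 < onorm ((*v) A)"
    then have "onorm ((*v) A) = 0" using order_trans[OF abs_ge_zero c[of 1 1]] by linarith
    then show False using 1 by simp
  qed
qed

lemma schrodinger_mult:
  "(schrodinger V \<theta> ** B) $ 1 $ j = V \<theta> * B $ 1 $ j + B $ 2 $ j"
  "(schrodinger V \<theta> ** B) $ 2 $ j = - B $ 1 $ j"
  by (auto simp: matrix_matrix_mult_def schrodinger_def sum_2)

lemma cocycle_entries_continuous:
  assumes "continuous_on UNIV V"
  shows "continuous_on UNIV (\<lambda>\<theta>. cocycle_iter \<alpha> (schrodinger V) n \<theta> $ i $ j)"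
proof (induction n arbitrary: i)
  case 0 then show ?case by simp
next
  case (Suc n)
  have c: "continuous_on UNIV (\<lambda>\<theta>. V (\<theta> + real n * \<alpha>))"
    by (rule continuous_on_compose2[OF assms]) (auto intro!: continuous_intros)
  have "i = 1 \<or> i = 2" using exhaust_2 by blast
  moreover have "continuous_on UNIV (\<lambda>\<theta>. V (\<theta> + real n * \<alpha>) * cocycle_iter \<alpha> (schrodinger V) n \<theta> $ 1 $ j
      + cocycle_iter \<alpha> (schrodinger V) n \<theta> $ 2 $ j)"
    "continuous_on UNIV (\<lambda>\<theta>. - cocycle_iter \<alpha> (schrodinger V) n \<theta> $ 1 $ j)"
    by (intro continuous_on_add continuous_on_mult continuous_on_minus Suc c)+
  ultimately show ?case by (auto simp: schrodinger_mult)
qed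

lemma det_cocycle: "det (cocycle_iter \<alpha> (schrodinger V) n \<theta>) = 1"
  by (induction n) (auto simp: det_mul det_schrodinger)

lemma cocycle_iter_add:
  "cocycle_iter \<alpha> A (m + n) \<theta> = cocycle_iter \<alpha> A n (\<theta> + real m * \<alpha>) ** cocycle_iter \<alpha> A m \<theta>"
proof (induction n)
  case (Suc n)
  then show ?case by (simp add: matrix_mul_assoc algebra_simps)
qed simp

lemma cocycle_iter_periodic:
  assumes "\<And>\<theta>. V (\<theta> + 1) = V \<theta>"
  shows "cocycle_iter \<alpha> (schrodinger V) n (\<theta> + 1) = cocycle_iter \<alpha> (schrodinger V) n \<theta>"
proof (induction n)
  case (Suc n)
  have "V (\<theta> + 1 + real n * \<alpha>) = V (\<theta> + real n * \<alpha>)"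
    using assms[of "\<theta> + real n * \<alpha>"] by (simp add: add_ac)
  then show ?case using Suc by (simp add: schrodinger_def)
qed simp

definition lognorm :: "real \<Rightarrow> (real \<Rightarrow> real) \<Rightarrow> nat \<Rightarrow> real \<Rightarrow> real" where
  "lognorm \<alpha> V n \<theta> = ln (onorm ((*v) (cocycle_iter \<alpha> (schrodinger V) n \<theta>)))"

lemma lognorm_continuous:
  assumes "continuous_on UNIV V"
  shows "continuous_on UNIV (lognorm \<alpha> V n)"
  unfolding lognorm_def
  by (intro continuous_on_ln onorm_continuous cocycle_entries_continuous[OF assms])
    (metis onorm_ge_det1(2)[OF det_cocycle] less_irrefl)

lemma lognorm_subadditive:
  "lognorm \<alpha> V (m + n) \<theta> \<le> lognorm \<alpha> V m \<theta> + lognorm \<alpha> V n (\<theta> + real m * \<alpha>)"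
proof -
  let ?A = "cocycle_iter \<alpha> (schrodinger V)"
  note p = onorm_ge_det1(2)[OF det_cocycle]
  have "onorm ((*v) (?A (m + n) \<theta>)) \<le> onorm ((*v) (?A n (\<theta> + real m * \<alpha>))) * onorm ((*v) (?A m \<theta>))"
    using onorm_compose[OF matrix_vector_mul_bounded_linear matrix_vector_mul_bounded_linear,
        of "?A n (\<theta> + real m * \<alpha>)" "?A m \<theta>"]
    by (simp add: cocycle_iter_add o_def matrix_vector_mul_assoc)
  then have "ln (onorm ((*v) (?A (m + n) \<theta>))) \<le> ln (onorm ((*v) (?A n (\<theta> + real m * \<alpha>))) * onorm ((*v) (?A m \<theta>)))"
    using p by (intro ln_mono) auto
  also have "\<dots> = ln (onorm ((*v) (?A n (\<theta> + real m * \<alpha>)))) + ln (onorm ((*v) (?A m \<theta>)))"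
    by (rule ln_mult_pos[OF p p])
  finally show ?thesis by (simp add: lognorm_def)
qed

lemma lognorm_lower: "- 1 \<le> lognorm \<alpha> V n \<theta>"
proof -
  let ?o = "onorm ((*v) (cocycle_iter \<alpha> (schrodinger V) n \<theta>))"
  note p = onorm_ge_det1[OF det_cocycle, of \<alpha> V n \<theta>]
  have "ln 1 \<le> ln (2 * ?o\<^sup>2)" using p by (intro ln_mono) auto
  also have "\<dots> = ln 2 + 2 * ln ?o" using p by (simp add: ln_mult ln_realpow)
  finally have "0 \<le> ln 2 + 2 * ln ?o" by simp
  moreover have "ln 2 \<le> (1::real)" using ln_2_less_1 by simp
  ultimately show ?thesis unfolding lognorm_def by linarith
qed

theorem lyapunov_tendsto:
  assumes c: "continuous_on UNIV V" and per: "\<And>\<theta>. V (\<theta> + 1) = V \<theta>"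
  shows "(\<lambda>n. integral {0..1} (lognorm \<alpha> V n) / real n) \<longlonglongrightarrow> lyapunov \<alpha> (schrodinger V)"
proof -
  define x where "x n = integral {0..1} (lognorm \<alpha> V n)" for n
  note lc = lognorm_continuous[OF c]
  have i: "f integrable_on {0..1}" if "continuous_on UNIV f" for f :: "real \<Rightarrow> real"
    by (intro integrable_continuous_real continuous_on_subset[OF that]) auto
  have lcs: "continuous_on UNIV (\<lambda>\<theta>. lognorm \<alpha> V n (\<theta> + a))" for n a
    by (rule continuous_on_compose2[OF lc]) (auto intro!: continuous_intros)
  have sub: "x (m + n) \<le> x m + x n" for m n
  proof -
    have "x (m + n) \<le> integral {0..1} (\<lambda>\<theta>. lognorm \<alpha> V m \<theta> + lognorm \<alpha> V n (\<theta> + real m * \<alpha>))"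
      unfolding x_def by (intro integral_le i continuous_intros lc lcs lognorm_subadditive)
    also have "\<dots> = x m + integral {0..1} (\<lambda>\<theta>. lognorm \<alpha> V n (\<theta> + real m * \<alpha>))"
      unfolding x_def by (intro Henstock_Kurzweil_Integration.integral_add i lc lcs)
    also have "integral {0..1} (\<lambda>\<theta>. lognorm \<alpha> V n (\<theta> + real m * \<alpha>)) = x n"
      unfolding x_def by (rule periodic_integral_shift[OF lc]) (simp add: lognorm_def cocycle_iter_periodic[of V, OF per])
    finally show ?thesis .
  qed
  have low: "- 1 \<le> x n" for n
  proof -
    have "integral {0..1} (\<lambda>\<theta>::real. - 1 :: real) \<le> x n"
      unfolding x_def by (intro integral_le i lc lognorm_lower) auto
    then show ?thesis by simp
  qed
  have "convergent (\<lambda>n. x n / real n)" using fekete_convergent[OF sub low] by simp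
  moreover have "lyapunov \<alpha> (schrodinger V) = lim (\<lambda>n. x n / real n)"
  proof -
    have "(LBINT \<theta>:{0..1}. lognorm \<alpha> V n \<theta>) = x n" for n
      unfolding x_def
      by (rule set_borel_integral_eq_integral(2)) (intro borel_integrable_atLeastAtMost' continuous_on_subset[OF lc], simp)
    then show ?thesis by (simp add: lyapunov_def lognorm_def)
  qed
  ultimately show ?thesis by (simp add: x_def convergent_LIMSEQ_iff)
qed

section \<open>Comparison of the two exponents\<close>

text \<open>The second order difference equation as a first order system, for complex potentials; for real
  potentials it reproduces the columns of the cocycle.\<close>
primrec solution :: "real \<Rightarrow> (real \<Rightarrow> complex) \<Rightarrow> complex \<times> complex \<Rightarrow> nat \<Rightarrow> real \<Rightarrow> complex \<times> complex" where
  "solution \<alpha> v s 0 \<theta> = s"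
| "solution \<alpha> v s (Suc n) \<theta> =
    (v (\<theta> + real n * \<alpha>) * fst (solution \<alpha> v s n \<theta>) + snd (solution \<alpha> v s n \<theta>), - fst (solution \<alpha> v s n \<theta>))"

definition transfer_norm :: "real \<Rightarrow> (real \<Rightarrow> complex) \<Rightarrow> nat \<Rightarrow> real \<Rightarrow> real" where
  "transfer_norm \<alpha> v n \<theta> = cmod (fst (solution \<alpha> v (1, 0) n \<theta>)) + cmod (snd (solution \<alpha> v (1, 0) n \<theta>))
     + cmod (fst (solution \<alpha> v (0, 1) n \<theta>)) + cmod (snd (solution \<alpha> v (0, 1) n \<theta>))"

lemma solution_linear:
  "fst (solution \<alpha> v (a, b) n \<theta>) = a * fst (solution \<alpha> v (1, 0) n \<theta>) + b * fst (solution \<alpha> v (0, 1) n \<theta>) \<and>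
   snd (solution \<alpha> v (a, b) n \<theta>) = a * snd (solution \<alpha> v (1, 0) n \<theta>) + b * snd (solution \<alpha> v (0, 1) n \<theta>)"
  by (induction n) (auto simp: algebra_simps)

text \<open>The invariant section gives the direction of an invariant line: a vector on it is multiplied by
  the product of the values of the section.\<close>
lemma solution_m_past:
  fixes \<alpha> :: real
  assumes P: "uhp_potential y M v"
  defines "Q \<equiv> \<lambda>n \<theta>. \<Prod>k<n. m_past \<alpha> v (\<theta> + real k * \<alpha>)"
  shows "solution \<alpha> v (m_past \<alpha> v \<theta>, - 1) n \<theta> = (Q n \<theta> * m_past \<alpha> v (\<theta> + real n * \<alpha>), - Q n \<theta>)"
proof (induction n)
  case (Suc n)
  define m m' where "m = m_past \<alpha> v (\<theta> + real n * \<alpha>)" and "m' = m_past \<alpha> v (\<theta> + real (Suc n) * \<alpha>)"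
  have "m' = v (\<theta> + real n * \<alpha>) - 1 / m"
    using m_past_eq[OF P, of \<alpha> "\<theta> + real n * \<alpha>"] by (simp add: m_def m'_def algebra_simps)
  moreover have "m \<noteq> 0" unfolding m_def by (rule m_past_bounds(4)[OF P])
  ultimately have "v (\<theta> + real n * \<alpha>) * m - 1 = m * m'" by (simp add: field_simps)
  then have "v (\<theta> + real n * \<alpha>) * (Q n \<theta> * m) + - Q n \<theta> = Q n \<theta> * m * m'"
    by (metis (no_types, opaque_lifting) mult.assoc mult.commute mult.right_neutral right_diff_distrib uminus_add_conv_diff add.commute)
  moreover have "Q (Suc n) \<theta> = Q n \<theta> * m" by (simp add: Q_def m_def)
  ultimately show ?case using Suc by (simp add: m_def m'_def del: of_nat_Suc)
qed (simp add: Q_def)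

lemma prod_m_past_le_transfer_norm:
  assumes P: "uhp_potential y M v"
  shows "(\<Prod>k<n. cmod (m_past \<alpha> v (\<theta> + real k * \<alpha>))) * (cmod (m_past \<alpha> v (\<theta> + real n * \<alpha>)) + 1)
    \<le> (cmod (m_past \<alpha> v \<theta>) + 1) * transfer_norm \<alpha> v n \<theta>"
proof -
  define Q where "Q = (\<Prod>k<n. m_past \<alpha> v (\<theta> + real k * \<alpha>))"
  define m where "m = m_past \<alpha> v \<theta>"
  define a b c d where "a = fst (solution \<alpha> v (1, 0) n \<theta>)" and "b = snd (solution \<alpha> v (1, 0) n \<theta>)"
    and "c = fst (solution \<alpha> v (0, 1) n \<theta>)" and "d = snd (solution \<alpha> v (0, 1) n \<theta>)"
  have 1: "Q * m_past \<alpha> v (\<theta> + real n * \<alpha>) = m * a + - 1 * c" "- Q = m * b + - 1 * d"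
    using solution_linear[of \<alpha> v m "- 1" n \<theta>] solution_m_past[OF P, of \<alpha> \<theta> n]
    by (simp_all add: Q_def m_def a_def b_def c_def d_def)
  have "cmod Q * (cmod (m_past \<alpha> v (\<theta> + real n * \<alpha>)) + 1) = cmod (m * a + - 1 * c) + cmod (m * b + - 1 * d)"
    unfolding 1[symmetric] by (simp add: norm_mult algebra_simps)
  also have "\<dots> \<le> (cmod m * cmod a + cmod c) + (cmod m * cmod b + cmod d)"
    using norm_triangle_ineq[of "m * a" "- 1 * c"] norm_triangle_ineq[of "m * b" "- 1 * d"]
    by (simp add: norm_mult)
  also have "\<dots> \<le> (cmod m + 1) * (cmod a + cmod b + cmod c + cmod d)"
    by (simp add: algebra_simps add_nonneg_nonneg)
  finally show ?thesis
    by (simp add: Q_def prod_norm transfer_norm_def m_def a_def b_def c_def d_def)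
qed

lemma transfer_norm_nonneg: "0 \<le> transfer_norm \<alpha> v n \<theta>"
  by (simp add: transfer_norm_def)

lemma solution_continuous_on:
  assumes "\<And>k. continuous_on S (\<lambda>p. w p (t p + real k * \<alpha>))"
  shows "continuous_on S (\<lambda>p. fst (solution \<alpha> (w p) s n (t p))) \<and> continuous_on S (\<lambda>p. snd (solution \<alpha> (w p) s n (t p)))"
proof (induction n)
  case (Suc n)
  then show ?case by (auto intro!: continuous_on_add continuous_on_mult continuous_on_minus assms)
qed simp

lemma ln_transfer_norm_continuous_on:
  assumes "\<And>k. continuous_on S (\<lambda>p. w p (t p + real k * \<alpha>))"
  shows "continuous_on S (\<lambda>p. ln (1 + transfer_norm \<alpha> (w p) n (t p)))"
proof -
  have "continuous_on S (\<lambda>p. transfer_norm \<alpha> (w p) n (t p))"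
    unfolding transfer_norm_def using solution_continuous_on[of S w t \<alpha>, OF assms]
    by (intro continuous_on_add continuous_on_norm) blast+
  moreover have "1 + transfer_norm \<alpha> (w p) n (t p) \<noteq> 0" for p using transfer_norm_nonneg[of \<alpha> "w p" n "t p"] by linarith
  ultimately show ?thesis by (intro continuous_on_ln continuous_on_add continuous_on_const) auto
qed

text \<open>The growth along the invariant line is at most the norm of the transfer matrix. The boundary
  terms \<open>h\<close> cancel upon integration, so the inequality has no error term.\<close>
theorem complex_exponent_le_transfer_norm:
  assumes P: "uhp_potential y M v"
  shows "real n * Re (complex_exponent \<alpha> v) \<le> integral {0..1} (\<lambda>\<theta>. ln (1 + transfer_norm \<alpha> v n \<theta>))"
proof -
  define g where "g \<theta> = ln (cmod (m_past \<alpha> v \<theta>))" for \<theta>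
  define h where "h \<theta> = ln (cmod (m_past \<alpha> v \<theta>) + 1)" for \<theta>
  have gc: "continuous_on UNIV g" unfolding g_def by (rule ln_m_past_continuous[OF P])
  have "cmod (m_past \<alpha> v \<theta>) + 1 \<noteq> 0" for \<theta> using norm_ge_zero[of "m_past \<alpha> v \<theta>"] by linarith
  then have hc: "continuous_on UNIV h" unfolding h_def
    by (intro continuous_on_ln continuous_on_add continuous_on_norm m_past_continuous[OF P] continuous_on_const) auto
  have per: "g (\<theta> + 1) = g \<theta>" "h (\<theta> + 1) = h \<theta>" for \<theta>
    by (simp_all add: g_def h_def m_past_periodic[OF P])
  have sh: "continuous_on UNIV (\<lambda>\<theta>. f (\<theta> + a))" if "continuous_on UNIV f" for f :: "real \<Rightarrow> real" and a
    by (rule continuous_on_compose2[OF that]) (auto intro!: continuous_intros)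
  have tc: "continuous_on UNIV (\<lambda>\<theta>. ln (1 + transfer_norm \<alpha> v n \<theta>))"
    by (rule ln_transfer_norm_continuous_on)
      (rule continuous_on_compose2[OF uhp_potentialD(2)[OF P]], auto intro!: continuous_intros)
  have i: "f integrable_on {0..1}" if "continuous_on UNIV f" for f :: "real \<Rightarrow> real"
    by (intro integrable_continuous_real continuous_on_subset[OF that]) auto
  have pt: "(\<Sum>k<n. g (\<theta> + real k * \<alpha>)) + h (\<theta> + real n * \<alpha>) \<le> h \<theta> + ln (1 + transfer_norm \<alpha> v n \<theta>)" for \<theta>
  proof -
    have nz: "m_past \<alpha> v \<phi> \<noteq> 0" for \<phi> using m_past_bounds(4)[OF P] .
    have p: "0 < (\<Prod>k<n. cmod (m_past \<alpha> v (\<theta> + real k * \<alpha>)))"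
      by (intro prod_pos) (use nz in auto)
    have q: "0 < cmod (m_past \<alpha> v \<phi>) + 1" for \<phi> using norm_ge_zero[of "m_past \<alpha> v \<phi>"] by linarith
    have "(\<Sum>k<n. g (\<theta> + real k * \<alpha>)) + h (\<theta> + real n * \<alpha>) =
      ln ((\<Prod>k<n. cmod (m_past \<alpha> v (\<theta> + real k * \<alpha>))) * (cmod (m_past \<alpha> v (\<theta> + real n * \<alpha>)) + 1))"
      unfolding ln_mult_pos[OF p q] g_def h_def using nz by (simp add: ln_prod)
    also have "\<dots> \<le> ln ((cmod (m_past \<alpha> v \<theta>) + 1) * (1 + transfer_norm \<alpha> v n \<theta>))"
    proof (rule ln_mono)
      show "0 < (\<Prod>k<n. cmod (m_past \<alpha> v (\<theta> + real k * \<alpha>))) * (cmod (m_past \<alpha> v (\<theta> + real n * \<alpha>)) + 1)"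
        using p q by simp
      have "(cmod (m_past \<alpha> v \<theta>) + 1) * transfer_norm \<alpha> v n \<theta> \<le> (cmod (m_past \<alpha> v \<theta>) + 1) * (1 + transfer_norm \<alpha> v n \<theta>)"
        using q[of \<theta>] by (intro mult_left_mono) auto
      then show "(\<Prod>k<n. cmod (m_past \<alpha> v (\<theta> + real k * \<alpha>))) * (cmod (m_past \<alpha> v (\<theta> + real n * \<alpha>)) + 1)
         \<le> (cmod (m_past \<alpha> v \<theta>) + 1) * (1 + transfer_norm \<alpha> v n \<theta>)"
        using prod_m_past_le_transfer_norm[OF P, where \<theta> = \<theta> and n = n and \<alpha> = \<alpha>] by linarith
    qed
    also have "\<dots> = h \<theta> + ln (1 + transfer_norm \<alpha> v n \<theta>)"
      unfolding h_def using q transfer_norm_nonneg[of \<alpha> v n \<theta>] by (intro ln_mult_pos) auto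
    finally show ?thesis .
  qed
  have "integral {0..1} (\<lambda>\<theta>. (\<Sum>k<n. g (\<theta> + real k * \<alpha>)) + h (\<theta> + real n * \<alpha>)) \<le>
     integral {0..1} (\<lambda>\<theta>. h \<theta> + ln (1 + transfer_norm \<alpha> v n \<theta>))"
    by (intro integral_le i continuous_on_add continuous_on_sum sh gc hc tc pt)
  also have "integral {0..1} (\<lambda>\<theta>. h \<theta> + ln (1 + transfer_norm \<alpha> v n \<theta>)) = integral {0..1} h + integral {0..1} (\<lambda>\<theta>. ln (1 + transfer_norm \<alpha> v n \<theta>))"
    by (intro Henstock_Kurzweil_Integration.integral_add i hc tc)
  also have "integral {0..1} (\<lambda>\<theta>. (\<Sum>k<n. g (\<theta> + real k * \<alpha>)) + h (\<theta> + real n * \<alpha>)) =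
    (\<Sum>k<n. integral {0..1} (\<lambda>\<theta>. g (\<theta> + real k * \<alpha>))) + integral {0..1} (\<lambda>\<theta>. h (\<theta> + real n * \<alpha>))"
    by (intro integral_unique has_integral_add has_integral_sum integrable_integral i sh gc hc finite_lessThan)
  also have "\<dots> = real n * Re (complex_exponent \<alpha> v) + integral {0..1} h"
    unfolding periodic_integral_shift[OF gc per(1)] periodic_integral_shift[OF hc per(2)] complex_exponent_Re[OF P]
    by (simp add: g_def[abs_def])
  finally show ?thesis by simp
qed

lemma solution_real:
  fixes U :: "real \<Rightarrow> real"
  shows "solution \<alpha> (\<lambda>\<theta>. of_real (U \<theta>)) (1, 0) n \<theta> =
     (of_real (cocycle_iter \<alpha> (schrodinger U) n \<theta> $ 1 $ 1), of_real (cocycle_iter \<alpha> (schrodinger U) n \<theta> $ 2 $ 1))"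
    "solution \<alpha> (\<lambda>\<theta>. of_real (U \<theta>)) (0, 1) n \<theta> =
     (of_real (cocycle_iter \<alpha> (schrodinger U) n \<theta> $ 1 $ 2), of_real (cocycle_iter \<alpha> (schrodinger U) n \<theta> $ 2 $ 2))"
  by (induction n) (auto simp: schrodinger_mult mat_def)

lemma ln_transfer_norm_real:
  "ln (1 + transfer_norm \<alpha> (\<lambda>\<theta>. of_real (U \<theta>)) n \<theta>) \<le> ln 6 + lognorm \<alpha> U n \<theta>"
proof -
  let ?A = "cocycle_iter \<alpha> (schrodinger U) n \<theta>"
  let ?o = "onorm ((*v) ?A)"
  note o = onorm_ge_det1[OF det_cocycle, of \<alpha> U n \<theta>]
  have "1 / 2 \<le> ?o"
  proof (rule ccontr)
    assume "\<not> 1 / 2 \<le> ?o"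
    then have "?o * ?o \<le> 1/2 * (1/2)" using o(2) by (intro mult_mono) auto
    then show False using o(1) by (simp add: power2_eq_square)
  qed
  moreover have "transfer_norm \<alpha> (\<lambda>\<theta>. of_real (U \<theta>)) n \<theta> \<le> 4 * ?o"
    unfolding transfer_norm_def solution_real
    using matrix_component_le_onorm[of ?A 1 1] matrix_component_le_onorm[of ?A 2 1]
      matrix_component_le_onorm[of ?A 1 2] matrix_component_le_onorm[of ?A 2 2] by simp
  ultimately have "1 + transfer_norm \<alpha> (\<lambda>\<theta>. of_real (U \<theta>)) n \<theta> \<le> 6 * ?o" by simp
  then have "ln (1 + transfer_norm \<alpha> (\<lambda>\<theta>. of_real (U \<theta>)) n \<theta>) \<le> ln (6 * ?o)"
    using transfer_norm_nonneg[of \<alpha> "\<lambda>\<theta>. of_real (U \<theta>)" n \<theta>] by (intro ln_mono) auto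
  also have "\<dots> = ln 6 + lognorm \<alpha> U n \<theta>"
    unfolding lognorm_def using o by (intro ln_mult_pos) auto
  finally show ?thesis .
qed

text \<open>At fixed \<open>n\<close> the bound of the exponent by transfer matrices is continuous up to \<open>t = 0\<close>, where it is close
  to the Lyapunov exponent if \<open>n\<close> is large. Together with nonnegativity this squeezes the real part to 0.\<close>
theorem complex_exponent_boundary_zero:
  fixes W :: "real \<Rightarrow> real \<Rightarrow> complex" and U :: "real \<Rightarrow> real"
  assumes cont: "continuous_on ({0..1} \<times> UNIV) (\<lambda>(t, \<theta>). W t \<theta>)"
    and P: "\<And>t. 0 < t \<Longrightarrow> t \<le> 1 \<Longrightarrow> uhp_potential (c t) M (W t)"
    and W0: "\<And>\<theta>. W 0 \<theta> = of_real (U \<theta>)"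
    and U: "continuous_on UNIV U" "\<And>\<theta>. U (\<theta> + 1) = U \<theta>"
    and lyap: "lyapunov \<alpha> (schrodinger U) \<le> 0"
  shows "((\<lambda>t. Re (complex_exponent \<alpha> (W t))) \<longlongrightarrow> 0) (at_right 0)"
proof (rule order_tendstoI)
  fix a :: real assume a: "a < 0"
  have "\<forall>\<^sub>F t in at_right 0. 0 < t \<and> t < (1::real)"
    using eventually_at_right_real[of 0 "1::real"] by simp
  then show "\<forall>\<^sub>F t in at_right 0. a < Re (complex_exponent \<alpha> (W t))"
  proof eventually_elim
    case (elim t)
    then show ?case using complex_exponent_Re_nonneg[OF P, of t \<alpha>] a by simp
  qed
next
  fix a :: real assume a: "0 < a"
  have "(\<lambda>n. ln 6 / real n + integral {0..1} (lognorm \<alpha> U n) / real n) \<longlonglongrightarrow> 0 + lyapunov \<alpha> (schrodinger U)"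
    by (intro tendsto_add lim_const_over_n lyapunov_tendsto U)
  then have "\<forall>\<^sub>F n in sequentially. ln 6 / real n + integral {0..1} (lognorm \<alpha> U n) / real n < a"
    by (rule order_tendstoD(2)) (use lyap a in auto)
  moreover have "\<forall>\<^sub>F n in sequentially. 0 < (n :: nat)" by (rule eventually_gt_at_top)
  ultimately have "\<forall>\<^sub>F n in sequentially. 0 < n \<and> ln 6 / real n + integral {0..1} (lognorm \<alpha> U n) / real n < a"
    by eventually_elim auto
  then obtain n where n: "0 < n" "ln 6 / real n + integral {0..1} (lognorm \<alpha> U n) / real n < a"
    by (auto simp: eventually_sequentially)
  define J where "J t = integral {0..1} (\<lambda>\<theta>. ln (1 + transfer_norm \<alpha> (W t) n \<theta>))" for t
  have "continuous_on {0..1} (\<lambda>t. integral (cbox 0 1) (\<lambda>\<theta>. ln (1 + transfer_norm \<alpha> (W t) n \<theta>)))"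
  proof (rule integral_continuous_on_param)
    have "continuous_on ({0..1} \<times> cbox 0 1) (\<lambda>p. ln (1 + transfer_norm \<alpha> (W (fst p)) n (snd p)))"
    proof (rule ln_transfer_norm_continuous_on)
      fix k
      have "continuous_on ({0..1} \<times> cbox 0 1) (\<lambda>p. (\<lambda>(t, \<theta>). W t \<theta>) (fst p, snd p + real k * \<alpha>))"
        by (rule continuous_on_compose2[OF cont]) (auto intro!: continuous_intros)
      then show "continuous_on ({0..1} \<times> cbox 0 1) (\<lambda>p. W (fst p) (snd p + real k * \<alpha>))" by simp
    qed
    then show "continuous_on ({0..1} \<times> cbox 0 1) (\<lambda>(t, \<theta>). ln (1 + transfer_norm \<alpha> (W t) n \<theta>))"
      by (simp add: case_prod_beta)
  qed
  then have Jc: "continuous_on {0..1} J" by (simp add: J_def[abs_def])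
  have J0: "J 0 < real n * a"
  proof -
    have lc: "continuous_on UNIV (\<lambda>\<theta>. ln (1 + transfer_norm \<alpha> (\<lambda>\<theta>. of_real (U \<theta>)) n \<theta>))"
      by (rule ln_transfer_norm_continuous_on)
        (rule continuous_on_compose2[of UNIV "\<lambda>\<theta>. of_real (U \<theta>)"], auto intro!: continuous_intros U)
    have i: "f integrable_on {0..1}" if "continuous_on UNIV f" for f :: "real \<Rightarrow> real"
      by (intro integrable_continuous_real continuous_on_subset[OF that]) auto
    have "W 0 = (\<lambda>\<theta>. of_real (U \<theta>))" using W0 by auto
    then have "J 0 \<le> integral {0..1} (\<lambda>\<theta>. ln 6 + lognorm \<alpha> U n \<theta>)"
      unfolding J_def by (auto intro!: integral_le i lc lognorm_continuous U ln_transfer_norm_real continuous_intros)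
    also have "\<dots> = ln 6 + integral {0..1} (lognorm \<alpha> U n)"
      by (subst Henstock_Kurzweil_Integration.integral_add) (auto intro!: i lognorm_continuous U)
    also have "\<dots> < real n * a" using n by (simp add: field_simps)
    finally show ?thesis .
  qed
  have "(J \<longlongrightarrow> J 0) (at 0 within {0..1})" using Jc by (simp add: continuous_on_def)
  then have "(J \<longlongrightarrow> J 0) (at_right 0)"
    by (rule filterlim_mono) (auto simp: at_within_Icc_at_right)
  then have "\<forall>\<^sub>F t in at_right 0. J t < real n * a" using J0 by (rule order_tendstoD(2))
  moreover have "\<forall>\<^sub>F t in at_right 0. 0 < t \<and> t < (1::real)"
    using eventually_at_right_real[of 0 "1::real"] by simp
  ultimately show "\<forall>\<^sub>F t in at_right 0. Re (complex_exponent \<alpha> (W t)) < a"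
  proof eventually_elim
    case (elim t)
    then have "real n * Re (complex_exponent \<alpha> (W t)) < real n * a"
      using complex_exponent_le_transfer_norm[OF P, of t n \<alpha>] by (simp add: J_def)
    then show ?case using n by simp
  qed
qed

section \<open>Concentrating bumps on the circle\<close>

text \<open>Powers of a trigonometric polynomial replace compactly supported bumps: they are smooth and
  periodic, squaring just doubles \<open>n\<close>, and they concentrate at \<open>1/2\<close> as \<open>n \<rightarrow> \<infinity>\<close>.\<close>
definition bump :: "nat \<Rightarrow> real \<Rightarrow> real" where
  "bump n \<theta> = ((sin (pi * \<theta>))\<^sup>2) ^ n"

definition mass :: "nat \<Rightarrow> real" where "mass n = integral {0..1} (bump n)"

lemma bump_bounds: "0 \<le> bump n \<theta>" "bump n \<theta> \<le> 1"
proof -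
  have "(sin (pi * \<theta>))\<^sup>2 \<le> 1" by (simp add: abs_square_le_1)
  then show "0 \<le> bump n \<theta>" "bump n \<theta> \<le> 1" by (auto simp: bump_def intro: power_le_one)
qed

lemma bump_continuous: "continuous_on S (bump n)"
  unfolding bump_def by (intro continuous_intros)

lemma bump_periodic: "bump n (\<theta> + 1) = bump n \<theta>"
  by (simp add: bump_def distrib_left sin_add)

lemma bump_square: "(bump n \<theta>)\<^sup>2 = bump (2 * n) \<theta>"
  unfolding bump_def by (metis mult.commute power_mult)

lemma bump_integrable: "bump n integrable_on {a..b}"
  by (intro integrable_continuous_real bump_continuous)

text \<open>The mass decays more slowly than any geometric sequence, since \<open>(sin (pi * \<theta>))\<^sup>2\<close> comes arbitrarily
  close to 1 on an interval.\<close>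
lemma mass_lower:
  assumes "0 \<le> \<beta>" "\<beta> < 1"
  shows "\<exists>\<delta>>0. \<forall>n. \<delta> * \<beta> ^ n \<le> mass n"
proof -
  have "isCont (\<lambda>\<theta>. (sin (pi * \<theta>))\<^sup>2) (1/2)" by (intro continuous_intros)
  then have "((\<lambda>\<theta>. (sin (pi * \<theta>))\<^sup>2) \<longlongrightarrow> 1) (at (1/2))" by (simp add: isCont_def)
  then have "\<forall>\<^sub>F \<theta> in at (1/2). \<beta> < (sin (pi * \<theta>))\<^sup>2" using assms by (intro order_tendstoD(1)) auto
  then obtain d where d: "d > 0" "\<And>\<theta>. \<theta> \<noteq> 1/2 \<Longrightarrow> dist \<theta> (1/2) < d \<Longrightarrow> \<beta> < (sin (pi * \<theta>))\<^sup>2"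
    by (auto simp: eventually_at)
  define \<delta> where "\<delta> = min (d / 2) (1 / 2)"
  have \<delta>: "0 < \<delta>" "\<delta> \<le> 1/2" "\<delta> < d" using d by (auto simp: \<delta>_def)
  have "\<delta> * \<beta> ^ n \<le> mass n" for n
  proof -
    have "\<delta> * \<beta> ^ n = integral {1/2..1/2+\<delta>} (\<lambda>_. \<beta> ^ n)" using \<delta> by simp
    also have "\<dots> \<le> integral {1/2..1/2+\<delta>} (bump n)"
    proof (rule integral_le)
      fix \<theta> assume "\<theta> \<in> {1/2..1/2+\<delta>}"
      then have "\<beta> \<le> (sin (pi * \<theta>))\<^sup>2"
      proof (cases "\<theta> = 1/2")
        case True
        then have "(sin (pi * \<theta>))\<^sup>2 = 1" by (simp only: sin_pi_half mult_1 times_divide_eq_right mult.right_neutral) simp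
        then show ?thesis using assms by simp
      next
        case False
        then show ?thesis using d(2)[of \<theta>] \<delta> \<open>\<theta> \<in> _\<close> by (auto simp: dist_real_def)
      qed
      then show "\<beta> ^ n \<le> bump n \<theta>" unfolding bump_def using assms by (intro power_mono) auto
    qed (auto intro: bump_integrable)
    also have "\<dots> \<le> mass n" unfolding mass_def
      by (rule integral_subset_le) (use \<delta> bump_bounds in \<open>auto intro: bump_integrable\<close>)
    finally show ?thesis .
  qed
  then show ?thesis using \<delta> by blast
qed

lemma mass_pos: "0 < mass n"
proof -
  obtain \<delta> where "\<delta> > 0" "\<And>n. \<delta> * (1/2) ^ n \<le> mass n" using mass_lower[of "1/2"] by auto
  moreover have "0 < \<delta> * (1/2) ^ n" using calculation(1) by simp
  ultimately show ?thesis using order.strict_trans2 by blast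
qed

lemma power_over_mass:
  assumes "0 \<le> \<beta>" "\<beta> < 1"
  shows "(\<lambda>n. \<beta> ^ n / mass n) \<longlonglongrightarrow> 0"
proof -
  define \<gamma> where "\<gamma> = (1 + \<beta>) / 2"
  have \<gamma>: "\<beta> < \<gamma>" "\<gamma> < 1" "0 < \<gamma>" using assms by (auto simp: \<gamma>_def)
  obtain \<delta> where \<delta>: "\<delta> > 0" "\<And>n. \<delta> * \<gamma> ^ n \<le> mass n" using mass_lower[of \<gamma>] \<gamma> by auto
  have "(\<lambda>n. (\<beta> / \<gamma>) ^ n * (1 / \<delta>)) \<longlonglongrightarrow> 0 * (1 / \<delta>)"
    using assms \<gamma> by (intro tendsto_mult tendsto_const LIMSEQ_power_zero) auto
  then have l: "(\<lambda>n. (\<beta> / \<gamma>) ^ n * (1 / \<delta>)) \<longlonglongrightarrow> 0" by simp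
  show ?thesis
  proof (rule tendsto_sandwich[OF _ _ tendsto_const l])
    show "\<forall>\<^sub>F n in sequentially. 0 \<le> \<beta> ^ n / mass n"
      using assms mass_pos by (intro always_eventually allI divide_nonneg_pos) auto
    have "\<beta> ^ n / mass n \<le> (\<beta> / \<gamma>) ^ n * (1 / \<delta>)" for n
    proof -
      have "\<beta> ^ n / mass n \<le> \<beta> ^ n / (\<delta> * \<gamma> ^ n)"
        using assms \<gamma> \<delta> mass_pos by (intro divide_left_mono) auto
      then show ?thesis by (simp add: power_divide mult.commute)
    qed
    then show "\<forall>\<^sub>F n in sequentially. \<beta> ^ n / mass n \<le> (\<beta> / \<gamma>) ^ n * (1 / \<delta>)" by simp
  qed
qed

text \<open>Away from \<open>1/2\<close> the bump is bounded by \<open>\<beta> ^ n\<close> with \<open>\<beta> < 1\<close>, which is negligible compared to its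
  mass.\<close>
theorem bump_concentrates:
  fixes G :: "real \<Rightarrow> complex"
  assumes G: "continuous_on UNIV G"
  shows "(\<lambda>n. integral {0..1} (\<lambda>\<theta>. of_real (bump n \<theta>) * G \<theta>) / of_real (mass n)) \<longlonglongrightarrow> G (1/2)"
proof (rule LIMSEQ_I)
  fix e :: real assume e: "0 < e"
  have Gc: "continuous_on UNIV (\<lambda>\<theta>. G \<theta> - G (1/2))" by (intro continuous_intros G)
  have "isCont G (1/2)" using G by (simp add: continuous_on_eq_continuous_at)
  then obtain d0 where d0: "d0 > 0" "\<And>\<theta>. dist \<theta> (1/2) < d0 \<Longrightarrow> dist (G \<theta>) (G (1/2)) < e / 2"
    using e unfolding continuous_at_eps_delta by (meson half_gt_zero)
  define d where "d = min d0 (1/2)"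
  have d: "0 < d" "d \<le> 1/2" "d \<le> d0" using d0 by (auto simp: d_def)
  have "bounded ((\<lambda>\<theta>. G \<theta> - G (1/2)) ` {0..1})"
    by (intro compact_imp_bounded compact_continuous_image continuous_on_subset[OF Gc] compact_Icc) auto
  then obtain K where K: "\<And>\<theta>. \<theta> \<in> {0..1} \<Longrightarrow> cmod (G \<theta> - G (1/2)) \<le> K"
    unfolding bounded_iff by blast
  have K0: "0 \<le> K" using order_trans[OF norm_ge_zero K[of 0]] by simp
  define \<beta> where "\<beta> = (cos (pi * d))\<^sup>2"
  have "pi * d < pi * 1" using d by (intro mult_strict_left_mono) auto
  then have "0 < sin (pi * d)" using d by (intro sin_gt_zero) auto
  then have sn: "sin (pi * d) \<noteq> 0" by simp
  have \<beta>: "0 \<le> \<beta>" by (simp add: \<beta>_def)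
  have \<beta>1: "\<beta> < 1" using sn unfolding \<beta>_def cos_squared_eq by simp
  have far: "bump n \<theta> \<le> \<beta> ^ n" if "\<theta> \<in> {0..1}" "d \<le> \<bar>\<theta> - 1/2\<bar>" for n \<theta>
  proof -
    have "sin (pi * \<theta>) = cos (pi * \<theta> - pi / 2)" by (simp add: cos_diff)
    also have "\<dots> = cos (pi * (\<theta> - 1/2))" by (simp add: right_diff_distrib)
    also have "\<dots> = cos (pi * \<bar>\<theta> - 1/2\<bar>)" by (cases "\<theta> \<le> 1/2") (auto simp: right_diff_distrib cos_diff)
    finally have s: "sin (pi * \<theta>) = cos (pi * \<bar>\<theta> - 1/2\<bar>)" .
    have le: "\<bar>\<theta> - 1/2\<bar> \<le> 1/2" unfolding abs_le_iff using that by auto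
    have "pi * \<bar>\<theta> - 1/2\<bar> \<le> pi * (1/2)" by (rule mult_left_mono[OF le]) simp
    then have half: "pi * \<bar>\<theta> - 1/2\<bar> \<le> pi / 2" by linarith
    have "cos (pi * \<bar>\<theta> - 1/2\<bar>) \<le> cos (pi * d)"
    proof (rule cos_monotone_0_pi_le)
      show "0 \<le> pi * d" using d by simp
      show "pi * d \<le> pi * \<bar>\<theta> - 1/2\<bar>" using that(2) by (intro mult_left_mono) auto
      show "pi * \<bar>\<theta> - 1/2\<bar> \<le> pi" using half pi_gt_zero by linarith
    qed
    moreover have "0 \<le> cos (pi * \<bar>\<theta> - 1/2\<bar>)"
    proof (rule cos_ge_zero)
      show "- (pi / 2) \<le> pi * \<bar>\<theta> - 1/2\<bar>"
        by (rule order_trans[of _ 0]) (use pi_gt_zero in auto)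
      show "pi * \<bar>\<theta> - 1/2\<bar> \<le> pi / 2" by (rule half)
    qed
    ultimately have "(sin (pi * \<theta>))\<^sup>2 \<le> \<beta>" unfolding s \<beta>_def by (intro power_mono) auto
    then show ?thesis unfolding bump_def by (intro power_mono) auto
  qed
  have pt: "cmod (of_real (bump n \<theta>) * (G \<theta> - G (1/2))) \<le> e / 2 * bump n \<theta> + K * \<beta> ^ n" if "\<theta> \<in> {0..1}" for n \<theta>
  proof (cases "d \<le> \<bar>\<theta> - 1/2\<bar>")
    case True
    have "cmod (of_real (bump n \<theta>) * (G \<theta> - G (1/2))) \<le> \<beta> ^ n * K"
      unfolding norm_mult using far[OF that True] K[OF that] bump_bounds \<beta> by (intro mult_mono) auto
    moreover have "0 \<le> e / 2 * bump n \<theta>" using e bump_bounds by simp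
    ultimately show ?thesis by (simp add: mult.commute)
  next
    case False
    then have "cmod (G \<theta> - G (1/2)) \<le> e / 2" using d0(2)[of \<theta>] d by (auto simp: dist_norm)
    then have "cmod (of_real (bump n \<theta>) * (G \<theta> - G (1/2))) \<le> bump n \<theta> * (e / 2)"
      unfolding norm_mult using bump_bounds[of n \<theta>] by (intro mult_mono) auto
    moreover have "0 \<le> K * \<beta> ^ n" using K0 \<beta> by simp
    ultimately show ?thesis by (simp add: mult.commute)
  qed
  have bc: "continuous_on {0..1} (\<lambda>\<theta>. complex_of_real (bump n \<theta>))" for n
    by (intro continuous_intros bump_continuous)
  have est: "cmod (integral {0..1} (\<lambda>\<theta>. of_real (bump n \<theta>) * G \<theta>) / of_real (mass n) - G (1/2))
     \<le> e / 2 + K * (\<beta> ^ n / mass n)" for n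
  proof -
    have i1: "(\<lambda>\<theta>. of_real (bump n \<theta>) * G \<theta>) integrable_on {0..1}"
      by (intro integrable_continuous_real continuous_on_mult bc continuous_on_subset[OF G]) auto
    have "((\<lambda>\<theta>. of_real (bump n \<theta>) * G (1/2)) has_integral of_real (mass n) * G (1/2)) {0..1}"
      unfolding mass_def
      by (intro has_integral_mult_left has_integral_of_real integrable_integral bump_integrable)
    then have "integral {0..1} (\<lambda>\<theta>. of_real (bump n \<theta>) * G \<theta>) - of_real (mass n) * G (1/2) =
      integral {0..1} (\<lambda>\<theta>. of_real (bump n \<theta>) * G \<theta> - of_real (bump n \<theta>) * G (1/2))"
      by (intro integral_unique[symmetric] has_integral_diff integrable_integral[OF i1])
    then have eq: "integral {0..1} (\<lambda>\<theta>. of_real (bump n \<theta>) * G \<theta>) - of_real (mass n) * G (1/2) =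
      integral {0..1} (\<lambda>\<theta>. of_real (bump n \<theta>) * (G \<theta> - G (1/2)))"
      by (simp add: right_diff_distrib)
    have "cmod (integral {0..1} (\<lambda>\<theta>. of_real (bump n \<theta>) * G \<theta>) - of_real (mass n) * G (1/2))
        \<le> integral {0..1} (\<lambda>\<theta>. e / 2 * bump n \<theta> + K * \<beta> ^ n)"
      unfolding eq
      by (intro integral_norm_bound_integral pt integrable_continuous_real continuous_on_mult bc
          continuous_on_subset[OF Gc] continuous_on_add continuous_on_const bump_continuous) auto
    also have "\<dots> = e / 2 * mass n + K * \<beta> ^ n"
    proof -
      have "((\<lambda>\<theta>. e / 2 * bump n \<theta> + K * \<beta> ^ n) has_integral e / 2 * mass n + K * \<beta> ^ n * (1 - 0)) {0..1}"
        unfolding mass_def using has_integral_const_real[of "K * \<beta> ^ n" 0 1]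
        by (intro has_integral_add has_integral_mult_right integrable_integral bump_integrable) simp
      then show ?thesis by (auto intro: integral_unique)
    qed
    finally have "cmod (integral {0..1} (\<lambda>\<theta>. of_real (bump n \<theta>) * G \<theta>) - of_real (mass n) * G (1/2)) / mass n
       \<le> (e / 2 * mass n + K * \<beta> ^ n) / mass n"
      using mass_pos[of n] by (intro divide_right_mono) auto
    moreover have "integral {0..1} (\<lambda>\<theta>. of_real (bump n \<theta>) * G \<theta>) / of_real (mass n) - G (1/2) =
       (integral {0..1} (\<lambda>\<theta>. of_real (bump n \<theta>) * G \<theta>) - of_real (mass n) * G (1/2)) / of_real (mass n)"
      using mass_pos[of n] by (simp add: diff_divide_distrib)
    ultimately show ?thesis
      using mass_pos[of n] by (simp add: norm_divide add_divide_distrib)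
  qed
  have "(\<lambda>n. K * (\<beta> ^ n / mass n)) \<longlonglongrightarrow> K * 0"
    by (intro tendsto_mult tendsto_const power_over_mass \<beta> \<beta>1)
  then have "\<forall>\<^sub>F n in sequentially. K * (\<beta> ^ n / mass n) < e / 2"
    by (rule order_tendstoD(2)) (use e in auto)
  then obtain N where N: "\<And>n. n \<ge> N \<Longrightarrow> K * (\<beta> ^ n / mass n) < e / 2"
    unfolding eventually_sequentially by blast
  show "\<exists>no. \<forall>n\<ge>no. norm (integral {0..1} (\<lambda>\<theta>. of_real (bump n \<theta>) * G \<theta>) / of_real (mass n) - G (1/2)) < e"
  proof (intro exI[of _ N] allI impI)
    fix n assume "N \<le> n"
    then show "norm (integral {0..1} (\<lambda>\<theta>. of_real (bump n \<theta>) * G \<theta>) / of_real (mass n) - G (1/2)) < e"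
      using est[of n] N[of n] by linarith
  qed
qed

definition overlap :: "nat \<Rightarrow> real \<Rightarrow> real" where
  "overlap n a = integral {0..1} (\<lambda>\<theta>. bump n (\<theta> + a) * bump n \<theta>)"

lemma bump_shift_continuous: "continuous_on S (\<lambda>\<theta>. bump n (\<theta> + a))"
  by (rule continuous_on_compose2[OF bump_continuous[of UNIV]]) (auto intro!: continuous_intros)

lemma overlap_le_mass: "overlap n a \<le> mass (2 * n)"
proof -
  have i: "bump (2 * n) integrable_on {0..1}" by (rule bump_integrable)
  have j: "(\<lambda>\<theta>. bump (2 * n) (\<theta> + a)) integrable_on {0..1}"
    by (intro integrable_continuous_real bump_shift_continuous)
  have "overlap n a \<le> integral {0..1} (\<lambda>\<theta>. 1/2 * bump (2 * n) (\<theta> + a) + 1/2 * bump (2 * n) \<theta>)"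
    unfolding overlap_def
  proof (rule integral_le)
    show "bump n (\<theta> + a) * bump n \<theta> \<le> 1/2 * bump (2 * n) (\<theta> + a) + 1/2 * bump (2 * n) \<theta>" for \<theta>
      using sum_squares_bound[of "bump n (\<theta> + a)" "bump n \<theta>"] by (simp add: bump_square)
  qed (intro integrable_continuous_real continuous_intros bump_shift_continuous bump_continuous)+
  also have "\<dots> = 1/2 * integral {0..1} (\<lambda>\<theta>. bump (2 * n) (\<theta> + a)) + 1/2 * mass (2 * n)"
    unfolding mass_def by (intro integral_unique has_integral_add has_integral_mult_right integrable_integral i j)
  also have "integral {0..1} (\<lambda>\<theta>. bump (2 * n) (\<theta> + a)) = mass (2 * n)"
    unfolding mass_def by (rule periodic_integral_shift[OF bump_continuous bump_periodic])
  finally show ?thesis by simp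
qed

lemma overlap_nonneg: "0 \<le> overlap n a"
  unfolding overlap_def
  by (intro Henstock_Kurzweil_Integration.integral_nonneg integrable_continuous_real
      continuous_intros bump_shift_continuous bump_continuous mult_nonneg_nonneg bump_bounds)

text \<open>The squared sines behind the two bumps take the value 1 on \<open>1/2 + \<int>\<close> and on \<open>1/2 - a + \<int>\<close>. For
  \<open>a \<notin> \<int>\<close> these sets are disjoint, so the maximum of the product is \<open>< 1\<close> and its powers decay
  geometrically.\<close>
theorem overlap_vanishes:
  assumes a: "a \<notin> \<int>"
  shows "(\<lambda>n. overlap n a / mass (2 * n)) \<longlonglongrightarrow> 0"
proof -
  define f where "f \<theta> = (sin (pi * (\<theta> + a)))\<^sup>2 * (sin (pi * \<theta>))\<^sup>2" for \<theta>
  have fb: "bump n (\<theta> + a) * bump n \<theta> = f \<theta> ^ n" for n \<theta>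
    by (simp add: f_def bump_def power_mult_distrib)
  have "continuous_on {0..1} f" unfolding f_def by (intro continuous_intros)
  then obtain \<theta>0 where \<theta>0: "\<theta>0 \<in> {0..1}" "\<And>\<theta>. \<theta> \<in> {0..1} \<Longrightarrow> f \<theta> \<le> f \<theta>0"
    using continuous_attains_sup[of "{0..1::real}" f] by auto
  have sq: "(sin x)\<^sup>2 \<le> 1" for x :: real by (simp add: abs_square_le_1)
  have f0: "0 \<le> f \<theta>" for \<theta> by (simp add: f_def)
  have "f \<theta>0 < 1"
  proof (rule ccontr)
    assume "\<not> f \<theta>0 < 1"
    then have ge: "1 \<le> (sin (pi * (\<theta>0 + a)))\<^sup>2 * (sin (pi * \<theta>0))\<^sup>2" by (simp add: f_def)
    have "(sin (pi * (\<theta>0 + a)))\<^sup>2 * (sin (pi * \<theta>0))\<^sup>2 \<le> (sin (pi * (\<theta>0 + a)))\<^sup>2"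
      "(sin (pi * (\<theta>0 + a)))\<^sup>2 * (sin (pi * \<theta>0))\<^sup>2 \<le> (sin (pi * \<theta>0))\<^sup>2"
      using sq by (auto intro: mult_left_le mult_left_le_one_le)
    then have "(sin (pi * (\<theta>0 + a)))\<^sup>2 = 1" "(sin (pi * \<theta>0))\<^sup>2 = 1" 
      using ge sq[of "pi * (\<theta>0 + a)"] sq[of "pi * \<theta>0"] by linarith+
    then have c: "cos (pi * (\<theta>0 + a)) = 0" "cos (pi * \<theta>0) = 0"
      by (auto simp: sin_squared_eq)
    have "sin (pi * a) = sin (pi * (\<theta>0 + a) - pi * \<theta>0)" by (simp add: algebra_simps)
    also have "\<dots> = 0" unfolding sin_diff c by simp
    finally obtain i :: int where "pi * a = of_int i * pi" using sin_zero_iff_int2 by blast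
    then have "a = of_int i" by simp
    then show False using a by simp
  qed
  define \<beta> where "\<beta> = sqrt (f \<theta>0)"
  have \<beta>: "0 \<le> \<beta>" "\<beta> < 1" "\<beta>\<^sup>2 = f \<theta>0" using f0 \<open>f \<theta>0 < 1\<close> by (auto simp: \<beta>_def)
  have le: "overlap n a \<le> \<beta> ^ (2 * n)" for n
  proof -
    have "overlap n a \<le> integral {0..1} (\<lambda>\<theta>::real. f \<theta>0 ^ n)"
      unfolding overlap_def fb
    proof (rule integral_le)
      show "(\<lambda>\<theta>. f \<theta> ^ n) integrable_on {0..1}"
        unfolding f_def by (intro integrable_continuous_real continuous_intros)
      show "f \<theta> ^ n \<le> f \<theta>0 ^ n" if "\<theta> \<in> {0..1}" for \<theta>
        using \<theta>0(2)[OF that] f0 by (intro power_mono)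
    qed auto
    then show ?thesis by (simp add: power_mult \<beta>(3))
  qed
  \<comment> \<open>The square root turns the bound into a power with exponent \<open>2 * n\<close>, matching \<open>mass (2 * n)\<close>.\<close>
  have "filterlim (\<lambda>n::nat. 2 * n) at_top sequentially" by (rule mult_nat_left_at_top) simp
  from filterlim_compose[OF power_over_mass[OF \<beta>(1,2)] this]
  have l: "(\<lambda>n. \<beta> ^ (2 * n) / mass (2 * n)) \<longlonglongrightarrow> 0" .
  show ?thesis
  proof (rule tendsto_sandwich[OF _ _ tendsto_const l])
    show "\<forall>\<^sub>F n in sequentially. 0 \<le> overlap n a / mass (2 * n)"
      using overlap_nonneg mass_pos by (intro always_eventually allI divide_nonneg_pos)
    show "\<forall>\<^sub>F n in sequentially. overlap n a / mass (2 * n) \<le> \<beta> ^ (2 * n) / mass (2 * n)"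
      using le mass_pos by (intro always_eventually allI divide_right_mono) (auto intro: less_imp_le)
  qed
qed

section \<open>Second order perturbation by a bump\<close>

lemma integral_cont_mono:
  fixes f g :: "real \<Rightarrow> real"
  assumes "continuous_on UNIV f" "continuous_on UNIV g" "\<And>x. f x \<le> g x"
  shows "integral {0..1} f \<le> integral {0..1} g"
  by (intro integral_le integrable_continuous_real continuous_on_subset[OF assms(1)]
      continuous_on_subset[OF assms(2)] assms(3)) auto

lemma continuous_integrable01:
  fixes f :: "real \<Rightarrow> 'a::banach"
  assumes "continuous_on UNIV f"
  shows "f integrable_on {0..1}"
  by (intro integrable_continuous_real continuous_on_subset[OF assms]) auto

text \<open>The potentials \<open>v \<plusminus> s p a\<close>, where \<open>a\<close> is the \<open>n\<close>-th bump and \<open>p\<close> a complex number. All bounds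
  are expressed through \<open>\<kappa> = s |p|\<close> and \<open>y\<close>.\<close>
locale perturbation =
  fixes y M \<alpha> s :: real and v :: "real \<Rightarrow> complex" and p :: complex and n :: nat
  assumes P: "uhp_potential y M v"
    and Pp: "uhp_potential y M (\<lambda>\<theta>. v \<theta> + of_real s * p * of_real (bump n \<theta>))"
    and Pm: "uhp_potential y M (\<lambda>\<theta>. v \<theta> - of_real s * p * of_real (bump n \<theta>))"
    and s: "0 < s" and small: "s * cmod p \<le> y / 8"
begin

abbreviation "vp \<equiv> \<lambda>\<theta>. v \<theta> + of_real s * p * of_real (bump n \<theta>)"
abbreviation "vm \<equiv> \<lambda>\<theta>. v \<theta> - of_real s * p * of_real (bump n \<theta>)"
abbreviation "\<kappa> \<equiv> s * cmod p"
abbreviation "q \<equiv> rate y"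
abbreviation "G \<equiv> green \<alpha> v v"
abbreviation "Gp \<equiv> green \<alpha> v vp"
abbreviation "Gm \<equiv> green \<alpha> v vm"

definition gap :: "real \<Rightarrow> real" where "gap \<theta> = hyp_dist (m_past \<alpha> vp \<theta>) (m_past \<alpha> vm \<theta>)"
definition xp :: "real \<Rightarrow> complex" where "xp \<theta> = of_real s * p * of_real (bump n \<theta>) * Gp \<theta>"
definition xm :: "real \<Rightarrow> complex" where "xm \<theta> = - (of_real s * p * of_real (bump n \<theta>) * Gm \<theta>)"
text \<open>Chosen such that \<open>(1 + xp) (1 + xm) = 1 + X\<close>: once the two logarithms are
  combined, a linear approximation of the logarithm suffices for second order asymptotics.\<close>
definition X :: "real \<Rightarrow> complex" where "X \<theta> = (xp \<theta> + xm \<theta>) + xp \<theta> * xm \<theta>"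
text \<open>The pairing of the gap with a translate of the bump. Since the gap at \<open>\<theta>\<close> is produced by bumps met in
  the past, its pairing with the bump measures the off-diagonal part of the second variation.\<close>
definition moment :: "nat \<Rightarrow> real" where "moment k = integral {0..1} (\<lambda>\<theta>. bump n (\<theta> + real k * \<alpha>) * gap \<theta>)"
text \<open>A Lipschitz constant of the Green function with respect to the potential of the past.\<close>
definition K1 :: real where "K1 = 1 / (y ^ 4 * (1 - q))"

lemma y: "0 < y" by (rule uhp_potentialD(1)[OF P])
lemma q: "0 < q" "q < 1" using rate_bounds[OF y] by auto
lemma kappa: "0 \<le> \<kappa>" using s by simp
lemma K1_nonneg: "0 \<le> K1" using y q by (simp add: K1_def)

lemma perturb_norm: "cmod (of_real s * p * of_real (bump n \<theta>)) = \<kappa> * bump n \<theta>"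
  using s bump_bounds[of n \<theta>] by (simp add: norm_mult)

lemma perturb_norm_le: "cmod (of_real s * p * of_real (bump n \<theta>)) \<le> \<kappa>"
  unfolding perturb_norm using kappa bump_bounds[of n \<theta>] by (intro mult_left_le) auto

lemma x_norm: "cmod (xp \<theta>) \<le> \<kappa> / y * bump n \<theta>" "cmod (xm \<theta>) \<le> \<kappa> / y * bump n \<theta>"
proof -
  have "\<kappa> * bump n \<theta> * cmod g \<le> \<kappa> * bump n \<theta> * (1 / y)" if "cmod g \<le> 1 / y" for g :: complex
    using that kappa bump_bounds[of n \<theta>] by (intro mult_left_mono) auto
  from this[OF green_bounds(1)[OF P Pp, of \<alpha> \<theta>]] this[OF green_bounds(1)[OF P Pm, of \<alpha> \<theta>]]
  show "cmod (xp \<theta>) \<le> \<kappa> / y * bump n \<theta>" "cmod (xm \<theta>) \<le> \<kappa> / y * bump n \<theta>"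
    unfolding xp_def xm_def norm_minus_cancel norm_mult[of _ "green _ _ _ _"] perturb_norm by simp_all
qed

lemma x_small: "cmod (xp \<theta>) \<le> 1 / 8" "cmod (xm \<theta>) \<le> 1 / 8"
proof -
  have "\<kappa> / y \<le> 1 / 8" using divide_right_mono[OF small, of y] y by simp
  then have "\<kappa> / y * bump n \<theta> \<le> 1 / 8 * 1"
    using bump_bounds[of n \<theta>] by (intro mult_mono) auto
  from order_trans[OF x_norm(1) this] order_trans[OF x_norm(2) this]
  show "cmod (xp \<theta>) \<le> 1 / 8" "cmod (xm \<theta>) \<le> 1 / 8" by simp_all
qed

lemma x_half: "cmod (xp \<theta>) \<le> 1 / 2" "cmod (xm \<theta>) \<le> 1 / 2"
  by (rule order_trans[OF x_small(1)], simp, rule order_trans[OF x_small(2)], simp)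

lemma x_continuous: "continuous_on UNIV xp" "continuous_on UNIV xm"
  unfolding xp_def xm_def
  by (intro continuous_intros bump_continuous green_continuous[OF P Pp] green_continuous[OF P Pm])+

lemma Ln_continuous:
  assumes "continuous_on UNIV f" "\<And>\<theta>. cmod (f \<theta>) \<le> 1 / 2"
  shows "continuous_on UNIV (\<lambda>\<theta>. Ln (1 + f \<theta>))"
proof (intro continuous_on_Ln' continuous_on_add continuous_on_const assms(1))
  fix \<theta> show "1 + f \<theta> \<notin> \<real>\<^sub>\<le>\<^sub>0"
    using assms(2)[of \<theta>] abs_Re_le_cmod[of "f \<theta>"] by (auto simp: complex_nonpos_Reals_iff)
qed

lemma complex_exponent_vp: "complex_exponent \<alpha> vp - complex_exponent \<alpha> v = integral {0..1} (\<lambda>\<theta>. Ln (1 + xp \<theta>))"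
  unfolding complex_exponent_diff[OF P Pp] by (simp add: xp_def)

lemma complex_exponent_vm: "complex_exponent \<alpha> vm - complex_exponent \<alpha> v = integral {0..1} (\<lambda>\<theta>. Ln (1 + xm \<theta>))"
  unfolding complex_exponent_diff[OF P Pm] by (simp add: xm_def)

lemma first_bound: "cmod (complex_exponent \<alpha> vp - complex_exponent \<alpha> v) \<le> 2 * (\<kappa> / y) * mass n"
proof -
  have "cmod (complex_exponent \<alpha> vp - complex_exponent \<alpha> v) \<le> integral {0..1} (\<lambda>\<theta>. 2 * (\<kappa> / y) * bump n \<theta>)"
    unfolding complex_exponent_vp
  proof (rule cmod_integral_le)
    show "continuous_on UNIV (\<lambda>\<theta>. Ln (1 + xp \<theta>))"
      by (rule Ln_continuous[OF x_continuous(1) x_half(1)])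
    show "continuous_on UNIV (\<lambda>\<theta>. 2 * (\<kappa> / y) * bump n \<theta>)" by (intro continuous_on_mult continuous_on_const bump_continuous)
    show "cmod (Ln (1 + xp \<theta>)) \<le> 2 * (\<kappa> / y) * bump n \<theta>" for \<theta>
    proof -
      have "cmod (Ln (1 + xp \<theta>)) \<le> 2 * cmod (xp \<theta>)" by (rule norm_Ln_le) (use x_small(1)[of \<theta>] in linarith)
      then show ?thesis using x_norm(1)[of \<theta>] by linarith
    qed
  qed
  also have "\<dots> = 2 * (\<kappa> / y) * mass n" unfolding mass_def by (rule integral_mult_right)
  finally show ?thesis .
qed

lemma gap_nonneg: "0 \<le> gap \<theta>" unfolding gap_def by (rule hyp_dist_m_past_nonneg[OF Pp Pm])

lemma gap_continuous: "continuous_on UNIV gap"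
proof -
  have "sqrt (Im (m_past \<alpha> vp \<theta>) * Im (m_past \<alpha> vm \<theta>)) \<noteq> 0" for \<theta>
    using m_past_bounds(3)[OF Pp, of \<alpha> \<theta>] m_past_bounds(3)[OF Pm, of \<alpha> \<theta>] by auto
  then show ?thesis unfolding gap_def hyp_dist_def
    by (intro continuous_intros m_past_continuous[OF Pp] m_past_continuous[OF Pm]) auto
qed

lemma gap_step: "gap (\<theta> + \<alpha>) \<le> 2 * \<kappa> / y * bump n \<theta> + q * gap \<theta>"
proof -
  have "vp \<theta> - vm \<theta> = 2 * (of_real s * p * of_real (bump n \<theta>))" by simp
  then have "cmod (vp \<theta> - vm \<theta>) = 2 * (\<kappa> * bump n \<theta>)"
    by (simp only: norm_mult[of 2] perturb_norm norm_numeral)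
  then show ?thesis using hyp_dist_m_past_step[OF Pp Pm, of \<alpha> \<theta>] by (simp add: gap_def)
qed

lemma moment_integrand_continuous: "continuous_on UNIV (\<lambda>\<theta>. bump n (\<theta> + a) * gap \<theta>)"
  by (intro continuous_on_mult bump_shift_continuous gap_continuous)

text \<open>Translating by \<open>\<alpha>\<close> and inserting the one step estimate of the gap trades the pairing with one
  translate for the overlap with the next one.\<close>
lemma moment_step: "moment k \<le> 2 * \<kappa> / y * overlap n (real (Suc k) * \<alpha>) + q * moment (Suc k)"
proof -
  let ?f = "\<lambda>\<theta>. bump n (\<theta> + real k * \<alpha>) * gap \<theta>"
  have "moment k = integral {0..1} (\<lambda>\<theta>. ?f (\<theta> + \<alpha>))"
    unfolding moment_def
  proof (rule periodic_integral_shift[symmetric, OF moment_integrand_continuous])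
    fix \<theta>
    have "bump n (\<theta> + 1 + real k * \<alpha>) = bump n (\<theta> + real k * \<alpha>)"
      using bump_periodic[of n "\<theta> + real k * \<alpha>"] by (simp add: add_ac)
    then show "?f (\<theta> + 1) = ?f \<theta>" by (simp add: gap_def m_past_periodic[OF Pp] m_past_periodic[OF Pm])
  qed
  also have "\<dots> \<le> integral {0..1} (\<lambda>\<theta>. 2 * \<kappa> / y * (bump n (\<theta> + real (Suc k) * \<alpha>) * bump n \<theta>) + q * (bump n (\<theta> + real (Suc k) * \<alpha>) * gap \<theta>))"
  proof (rule integral_cont_mono)
    show "continuous_on UNIV (\<lambda>\<theta>. ?f (\<theta> + \<alpha>))"
      by (rule continuous_on_compose2[OF moment_integrand_continuous]) (auto intro!: continuous_intros)
    show "continuous_on UNIV (\<lambda>\<theta>. 2 * \<kappa> / y * (bump n (\<theta> + real (Suc k) * \<alpha>) * bump n \<theta>) + q * (bump n (\<theta> + real (Suc k) * \<alpha>) * gap \<theta>))"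
      by (intro continuous_on_add continuous_on_mult continuous_on_const bump_shift_continuous bump_continuous gap_continuous)
    show "?f (\<theta> + \<alpha>) \<le> 2 * \<kappa> / y * (bump n (\<theta> + real (Suc k) * \<alpha>) * bump n \<theta>) + q * (bump n (\<theta> + real (Suc k) * \<alpha>) * gap \<theta>)" for \<theta>
    proof -
      have "?f (\<theta> + \<alpha>) = bump n (\<theta> + real (Suc k) * \<alpha>) * gap (\<theta> + \<alpha>)" by (simp add: algebra_simps)
      also have "\<dots> \<le> bump n (\<theta> + real (Suc k) * \<alpha>) * (2 * \<kappa> / y * bump n \<theta> + q * gap \<theta>)"
        by (intro mult_left_mono gap_step bump_bounds)
      finally show ?thesis by (simp only: distrib_left mult_ac)
    qed
  qed
  also have "\<dots> = 2 * \<kappa> / y * overlap n (real (Suc k) * \<alpha>) + q * moment (Suc k)"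
    unfolding overlap_def moment_def
    by (intro integral_unique has_integral_add has_integral_mult_right integrable_integral
        continuous_integrable01 continuous_on_mult bump_shift_continuous bump_continuous gap_continuous)
  finally show ?thesis .
qed

text \<open>Bounding every overlap by the mass of \<open>bump (2 * n)\<close> costs only explicit powers of \<open>y\<close>, which is what
  the estimates near the real axis need.\<close>
lemma moment_bound: "moment k \<le> 2 * \<kappa> / y * (mass (2 * n) / (1 - q))"
proof -
  define D where "D = 2 * (M + 1 / y) / y"
  define A where "A = 2 * \<kappa> / y * mass (2 * n)"
  have A0: "0 \<le> A" using kappa y mass_pos[of "2 * n"] by (simp add: A_def)
  have "moment k \<le> A / (1 - q) + q ^ m * D" for m
  proof (induction m arbitrary: k)
    case 0
    have "moment k \<le> integral {0..1} (\<lambda>\<theta>::real. D)"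
      unfolding moment_def
    proof (rule integral_cont_mono[OF moment_integrand_continuous])
      show "bump n (\<theta> + real k * \<alpha>) * gap \<theta> \<le> D" for \<theta>
        using hyp_dist_m_past_bounded[OF Pp Pm, of \<alpha> \<theta>]
          mult_left_le_one_le[OF gap_nonneg[of \<theta>] bump_bounds[of n "\<theta> + real k * \<alpha>"]]
        unfolding gap_def[symmetric] D_def by linarith
    qed simp
    moreover have "0 \<le> A / (1 - q)" using A0 q by simp
    ultimately show ?case by simp
  next
    case (Suc m)
    have "moment k \<le> 2 * \<kappa> / y * overlap n (real (Suc k) * \<alpha>) + q * moment (Suc k)" by (rule moment_step)
    also have "\<dots> \<le> A + q * (A / (1 - q) + q ^ m * D)"
      unfolding A_def using Suc[of "Suc k"] q kappa y
      by (intro add_mono mult_left_mono overlap_le_mass) (auto simp: A_def)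
    also have "\<dots> = A / (1 - q) + q ^ Suc m * D" using q by (simp add: field_simps)
    finally show ?case .
  qed
  moreover have "(\<lambda>m. A / (1 - q) + q ^ m * D) \<longlonglongrightarrow> A / (1 - q) + 0 * D"
    using q by (intro tendsto_intros LIMSEQ_power_zero) auto
  ultimately have "moment k \<le> A / (1 - q)" by (intro LIMSEQ_le_const) auto
  then show ?thesis by (simp add: A_def)
qed

text \<open>The form used for the limit \<open>n \<rightarrow> \<infinity>\<close>: finitely many overlaps, which vanish asymptotically compared
  to the mass if \<open>\<alpha>\<close> is irrational, and a tail with the factor \<open>q ^ N\<close>.\<close>
lemma moment_expand:
  "moment 0 \<le> 2 * \<kappa> / y * ((\<Sum>k<N. q ^ k * overlap n (real (Suc k) * \<alpha>)) + q ^ N * (mass (2 * n) / (1 - q)))"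
proof -
  have "moment 0 \<le> 2 * \<kappa> / y * (\<Sum>k<N. q ^ k * overlap n (real (Suc k) * \<alpha>)) + q ^ N * moment N"
  proof (induction N)
    case (Suc N)
    have "q ^ N * moment N \<le> q ^ N * (2 * \<kappa> / y * overlap n (real (Suc N) * \<alpha>) + q * moment (Suc N))"
      using q by (intro mult_left_mono moment_step) auto
    then show ?case using Suc by (simp add: algebra_simps del: of_nat_Suc)
  qed simp
  moreover have "q ^ N * moment N \<le> q ^ N * (2 * \<kappa> / y * (mass (2 * n) / (1 - q)))"
    using q by (intro mult_left_mono moment_bound) auto
  ultimately show ?thesis by (simp add: distrib_left mult_ac)
qed

lemma green_diff_gap: "cmod (Gp \<theta> - Gm \<theta>) \<le> gap \<theta> / y ^ 3"
  unfolding gap_def by (rule hyp_dist_green[OF P Pp Pm])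

lemma perturb_diff: "cmod (vp \<theta> - v \<theta>) \<le> \<kappa>" "cmod (vm \<theta> - v \<theta>) \<le> \<kappa>"
proof -
  have "vp \<theta> - v \<theta> = of_real s * p * of_real (bump n \<theta>)" "vm \<theta> - v \<theta> = - (of_real s * p * of_real (bump n \<theta>))"
    by simp_all
  then show "cmod (vp \<theta> - v \<theta>) \<le> \<kappa>" "cmod (vm \<theta> - v \<theta>) \<le> \<kappa>"
    using perturb_norm_le[of \<theta>] by (simp_all only: norm_minus_cancel)
qed

lemma green_diff: "cmod (Gp \<theta> - G \<theta>) \<le> \<kappa> * K1" "cmod (Gm \<theta> - G \<theta>) \<le> \<kappa> * K1"
proof -
  have eq: "\<kappa> / y / (1 - q) / y ^ 3 = \<kappa> * K1"
    by (simp add: K1_def power3_eq_cube power4_eq_xxxx)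
  have "hyp_dist (m_past \<alpha> vp \<theta>) (m_past \<alpha> v \<theta>) / y ^ 3 \<le> \<kappa> / y / (1 - q) / y ^ 3"
    using y by (intro divide_right_mono hyp_dist_m_past_sup[OF Pp P] perturb_diff) auto
  then show "cmod (Gp \<theta> - G \<theta>) \<le> \<kappa> * K1" using hyp_dist_green[OF P Pp P, of \<alpha> \<theta>] eq by linarith
  have "hyp_dist (m_past \<alpha> vm \<theta>) (m_past \<alpha> v \<theta>) / y ^ 3 \<le> \<kappa> / y / (1 - q) / y ^ 3"
    using y by (intro divide_right_mono hyp_dist_m_past_sup[OF Pm P] perturb_diff) auto
  then show "cmod (Gm \<theta> - G \<theta>) \<le> \<kappa> * K1" using hyp_dist_green[OF P Pm P, of \<alpha> \<theta>] eq by linarith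
qed

lemma x_sum: "xp \<theta> + xm \<theta> = of_real s * p * of_real (bump n \<theta>) * (Gp \<theta> - Gm \<theta>)"
  by (simp add: xp_def xm_def algebra_simps)

lemma x_sum_le_gap: "cmod (xp \<theta> + xm \<theta>) \<le> \<kappa> / y ^ 3 * (bump n (\<theta> + real 0 * \<alpha>) * gap \<theta>)"
proof -
  have "cmod (xp \<theta> + xm \<theta>) \<le> \<kappa> * bump n \<theta> * (gap \<theta> / y ^ 3)"
    unfolding x_sum norm_mult[of _ "_ - _"] perturb_norm
    using kappa bump_bounds by (intro mult_left_mono green_diff_gap) auto
  then show ?thesis by (simp add: mult_ac)
qed

lemma x_prod_norm: "cmod (xp \<theta> * xm \<theta>) \<le> (\<kappa> / y)\<^sup>2 * bump (2 * n) \<theta>"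
proof -
  have "cmod (xp \<theta>) * cmod (xm \<theta>) \<le> (\<kappa> / y * bump n \<theta>) * (\<kappa> / y * bump n \<theta>)"
    using x_norm[of \<theta>] kappa y bump_bounds[of n \<theta>] by (intro mult_mono) auto
  also have "\<dots> = (\<kappa> / y)\<^sup>2 * bump (2 * n) \<theta>"
    unfolding bump_square[symmetric] by (simp add: power2_eq_square mult_ac)
  finally show ?thesis by (simp only: norm_mult)
qed

lemma X_small: "cmod (X \<theta>) \<le> 3 / 8"
proof -
  have "cmod (xp \<theta> * xm \<theta>) \<le> 1 / 8 * (1 / 8)" unfolding norm_mult using x_small[of \<theta>] by (intro mult_mono) auto
  then show ?thesis unfolding X_def
    using norm_triangle_ineq[of "xp \<theta> + xm \<theta>" "xp \<theta> * xm \<theta>"] norm_triangle_ineq[of "xp \<theta>" "xm \<theta>"] x_small[of \<theta>]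
    by linarith
qed

lemma X_continuous: "continuous_on UNIV X"
  unfolding X_def by (intro continuous_on_add continuous_on_mult x_continuous)

lemma Ln_X: "Ln (1 + xp \<theta>) + Ln (1 + xm \<theta>) = Ln (1 + X \<theta>)"
proof -
  have a: "0 < Re (1 + xp \<theta>)" "0 < Re (1 + xm \<theta>)"
    using abs_Re_le_cmod[of "xp \<theta>"] abs_Re_le_cmod[of "xm \<theta>"] x_small[of \<theta>] by auto
  then have nz: "1 + xp \<theta> \<noteq> 0" "1 + xm \<theta> \<noteq> 0" by (auto simp del: plus_complex.sel)
  have b: "\<bar>Im (Ln (1 + xp \<theta>))\<bar> < pi / 2" "\<bar>Im (Ln (1 + xm \<theta>))\<bar> < pi / 2"
    using Re_Ln_pos_lt_imp[OF a(1)] Re_Ln_pos_lt_imp[OF a(2)] by auto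
  have "Ln (1 + X \<theta>) = Ln ((1 + xp \<theta>) * (1 + xm \<theta>))" by (simp add: X_def algebra_simps)
  also have "\<dots> = Ln (1 + xp \<theta>) + Ln (1 + xm \<theta>)"
    by (rule Ln_unique) (use nz b in \<open>auto simp: exp_add abs_less_iff\<close>)
  finally show ?thesis by simp
qed

lemma complex_exponent_second: "complex_exponent \<alpha> vp + complex_exponent \<alpha> vm - 2 * complex_exponent \<alpha> v = integral {0..1} (\<lambda>\<theta>. Ln (1 + X \<theta>))"
proof -
  have i: "(\<lambda>\<theta>. Ln (1 + xp \<theta>)) integrable_on {0..1}" "(\<lambda>\<theta>. Ln (1 + xm \<theta>)) integrable_on {0..1}"
    by (intro continuous_integrable01 Ln_continuous x_continuous x_half)+
  have "complex_exponent \<alpha> vp + complex_exponent \<alpha> vm - 2 * complex_exponent \<alpha> v = (complex_exponent \<alpha> vp - complex_exponent \<alpha> v) + (complex_exponent \<alpha> vm - complex_exponent \<alpha> v)" by simp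
  also have "\<dots> = integral {0..1} (\<lambda>\<theta>. Ln (1 + xp \<theta>) + Ln (1 + xm \<theta>))"
    unfolding complex_exponent_vp complex_exponent_vm by (rule Henstock_Kurzweil_Integration.integral_add[symmetric, OF i])
  finally show ?thesis unfolding Ln_X .
qed

lemma LnX_continuous: "continuous_on UNIV (\<lambda>\<theta>. Ln (1 + X \<theta>))"
  by (rule Ln_continuous[OF X_continuous order_trans[OF X_small]]) simp

text \<open>Used on the half circle, where \<open>\<kappa>\<close> is of order \<open>s y\<^sup>3\<close> and this bound becomes a constant times
  \<open>s\<^sup>2\<close> times the mass.\<close>
lemma second_bound:
  "cmod (complex_exponent \<alpha> vp + complex_exponent \<alpha> vm - 2 * complex_exponent \<alpha> v) \<le> 2 * \<kappa>\<^sup>2 * (2 / (y ^ 4 * (1 - q)) + 1 / y\<^sup>2) * mass (2 * n)"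
proof -
  have "cmod (complex_exponent \<alpha> vp + complex_exponent \<alpha> vm - 2 * complex_exponent \<alpha> v) \<le>
    integral {0..1} (\<lambda>\<theta>. 2 * (\<kappa> / y ^ 3) * (bump n (\<theta> + real 0 * \<alpha>) * gap \<theta>) + 2 * (\<kappa> / y)\<^sup>2 * bump (2 * n) \<theta>)"
    unfolding complex_exponent_second
  proof (rule cmod_integral_le[OF LnX_continuous])
    show "continuous_on UNIV (\<lambda>\<theta>. 2 * (\<kappa> / y ^ 3) * (bump n (\<theta> + real 0 * \<alpha>) * gap \<theta>) + 2 * (\<kappa> / y)\<^sup>2 * bump (2 * n) \<theta>)"
      by (intro continuous_on_add continuous_on_mult continuous_on_const bump_shift_continuous bump_continuous gap_continuous)
    show "cmod (Ln (1 + X \<theta>)) \<le> 2 * (\<kappa> / y ^ 3) * (bump n (\<theta> + real 0 * \<alpha>) * gap \<theta>) + 2 * (\<kappa> / y)\<^sup>2 * bump (2 * n) \<theta>" for \<theta>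
    proof -
      have "cmod (Ln (1 + X \<theta>)) \<le> 2 * cmod (X \<theta>)" by (rule norm_Ln_le) (use X_small[of \<theta>] in linarith)
      moreover have "cmod (X \<theta>) \<le> cmod (xp \<theta> + xm \<theta>) + cmod (xp \<theta> * xm \<theta>)"
        unfolding X_def by (rule norm_triangle_ineq)
      ultimately show ?thesis using x_sum_le_gap[of \<theta>] x_prod_norm[of \<theta>] by linarith
    qed
  qed
  also have "\<dots> = 2 * (\<kappa> / y ^ 3) * moment 0 + 2 * (\<kappa> / y)\<^sup>2 * mass (2 * n)"
    unfolding moment_def mass_def
    by (intro integral_unique has_integral_add has_integral_mult_right integrable_integral
        continuous_integrable01 continuous_on_mult bump_shift_continuous bump_continuous gap_continuous)
  also have "\<dots> \<le> 2 * (\<kappa> / y ^ 3) * (2 * \<kappa> / y * (mass (2 * n) / (1 - q))) + 2 * (\<kappa> / y)\<^sup>2 * mass (2 * n)"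
    using kappa y by (intro add_mono mult_left_mono moment_bound) auto
  also have "\<dots> = 2 * \<kappa>\<^sup>2 * (2 / (y ^ 4 * (1 - q)) + 1 / y\<^sup>2) * mass (2 * n)"
    by (simp add: power2_eq_square power3_eq_cube power4_eq_xxxx algebra_simps)
  finally show ?thesis .
qed

lemma G_continuous: "continuous_on UNIV G" by (rule green_continuous[OF P P])

text \<open>Used at a fixed point of the upper half-plane. The diagonal term is the integral; the moment is the
  off-diagonal contribution and the remaining terms are of order \<open>\<kappa>\<^sup>3\<close> times the mass and \<open>\<kappa>\<^sup>4\<close>.\<close>
lemma second_expansion:
  "cmod (complex_exponent \<alpha> vp + complex_exponent \<alpha> vm - 2 * complex_exponent \<alpha> v
      + of_real (s\<^sup>2) * p\<^sup>2 * integral {0..1} (\<lambda>\<theta>. of_real (bump (2 * n) \<theta>) * (G \<theta>)\<^sup>2))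
   \<le> \<kappa> / y ^ 3 * moment 0 + \<kappa>\<^sup>2 * (2 * \<kappa> * K1 / y) * mass (2 * n) + 2 * (\<kappa>\<^sup>2 * (2 * K1 + 1 / y\<^sup>2))\<^sup>2"
proof -
  define K where "K = 2 * K1 + 1 / y\<^sup>2"
  have XK: "cmod (X \<theta>) \<le> \<kappa>\<^sup>2 * K" for \<theta>
  proof -
    have "cmod (Gp \<theta> - Gm \<theta>) \<le> \<kappa> * K1 + \<kappa> * K1"
      using norm_triangle_ineq4[of "Gp \<theta> - G \<theta>" "Gm \<theta> - G \<theta>"] green_diff[of \<theta>]
      unfolding diff_diff_eq2 diff_add_cancel by linarith
    then have "cmod (xp \<theta> + xm \<theta>) \<le> \<kappa> * (\<kappa> * K1 + \<kappa> * K1)"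
      unfolding x_sum norm_mult[of _ "_ - _"] using kappa perturb_norm_le[of \<theta>] by (intro mult_mono) auto
    moreover have "(\<kappa> / y)\<^sup>2 * bump (2 * n) \<theta> \<le> (\<kappa> / y)\<^sup>2"
      using bump_bounds[of "2 * n" \<theta>] by (intro mult_left_le) auto
    ultimately have "cmod (X \<theta>) \<le> \<kappa> * (\<kappa> * K1 + \<kappa> * K1) + (\<kappa> / y)\<^sup>2"
      using norm_triangle_ineq[of "xp \<theta> + xm \<theta>" "xp \<theta> * xm \<theta>"] x_prod_norm[of \<theta>] unfolding X_def by linarith
    also have "\<dots> = \<kappa>\<^sup>2 * K" by (simp add: K_def power2_eq_square algebra_simps)
    finally show ?thesis .
  qed
  have prod: "cmod (xp \<theta> * xm \<theta> + of_real (s\<^sup>2) * p\<^sup>2 * (of_real (bump (2 * n) \<theta>) * (G \<theta>)\<^sup>2)) \<le> \<kappa>\<^sup>2 * (2 * \<kappa> * K1 / y) * bump (2 * n) \<theta>" for \<theta>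
  proof -
    have "xp \<theta> * xm \<theta> + of_real (s\<^sup>2) * p\<^sup>2 * (of_real (bump (2 * n) \<theta>) * (G \<theta>)\<^sup>2) =
      (of_real s * p * of_real (bump n \<theta>))\<^sup>2 * ((G \<theta>)\<^sup>2 - Gp \<theta> * Gm \<theta>)"
      unfolding xp_def xm_def bump_square[symmetric] by (simp add: power2_eq_square algebra_simps)
    also have "(G \<theta>)\<^sup>2 - Gp \<theta> * Gm \<theta> = - (G \<theta> * (Gm \<theta> - G \<theta>) + (Gp \<theta> - G \<theta>) * Gm \<theta>)"
      by (simp add: power2_eq_square algebra_simps)
    finally have "cmod (xp \<theta> * xm \<theta> + of_real (s\<^sup>2) * p\<^sup>2 * (of_real (bump (2 * n) \<theta>) * (G \<theta>)\<^sup>2)) =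
      (\<kappa> * bump n \<theta>)\<^sup>2 * cmod (G \<theta> * (Gm \<theta> - G \<theta>) + (Gp \<theta> - G \<theta>) * Gm \<theta>)"
      by (simp only: norm_mult norm_power norm_minus_cancel perturb_norm[unfolded norm_mult])
    also have "\<dots> \<le> (\<kappa> * bump n \<theta>)\<^sup>2 * (1 / y * (\<kappa> * K1) + \<kappa> * K1 * (1 / y))"
    proof (intro mult_left_mono order_trans[OF norm_triangle_ineq] add_mono)
      show "cmod (G \<theta> * (Gm \<theta> - G \<theta>)) \<le> 1 / y * (\<kappa> * K1)"
        unfolding norm_mult using y by (intro mult_mono green_bounds[OF P P] green_diff) auto
      show "cmod ((Gp \<theta> - G \<theta>) * Gm \<theta>) \<le> \<kappa> * K1 * (1 / y)"
        unfolding norm_mult using kappa K1_nonneg by (intro mult_mono green_bounds[OF P Pm] green_diff) auto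
    qed simp
    also have "\<dots> = \<kappa>\<^sup>2 * (2 * \<kappa> * K1 / y) * bump (2 * n) \<theta>"
      unfolding bump_square[symmetric] by (simp add: power_mult_distrib)
    finally show ?thesis .
  qed
  let ?H = "\<lambda>\<theta>. of_real (bump (2 * n) \<theta>) * (G \<theta>)\<^sup>2"
  have Hc: "continuous_on UNIV ?H"
    by (intro continuous_on_mult continuous_on_power continuous_on_of_real bump_continuous G_continuous)
  have "complex_exponent \<alpha> vp + complex_exponent \<alpha> vm - 2 * complex_exponent \<alpha> v + of_real (s\<^sup>2) * p\<^sup>2 * integral {0..1} ?H =
    integral {0..1} (\<lambda>\<theta>. Ln (1 + X \<theta>) + of_real (s\<^sup>2) * p\<^sup>2 * ?H \<theta>)"
    unfolding complex_exponent_second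
    by (intro integral_unique[symmetric] has_integral_add has_integral_mult_right integrable_integral
        continuous_integrable01 LnX_continuous Hc)
  moreover have "cmod (integral {0..1} (\<lambda>\<theta>. Ln (1 + X \<theta>) + of_real (s\<^sup>2) * p\<^sup>2 * ?H \<theta>)) \<le>
    integral {0..1} (\<lambda>\<theta>. \<kappa> / y ^ 3 * (bump n (\<theta> + real 0 * \<alpha>) * gap \<theta>) +
       \<kappa>\<^sup>2 * (2 * \<kappa> * K1 / y) * bump (2 * n) \<theta> + 2 * (\<kappa>\<^sup>2 * K)\<^sup>2)"
  proof (rule cmod_integral_le)
    show "continuous_on UNIV (\<lambda>\<theta>. Ln (1 + X \<theta>) + of_real (s\<^sup>2) * p\<^sup>2 * ?H \<theta>)"
      by (intro continuous_on_add continuous_on_mult[of UNIV "\<lambda>_. of_real (s\<^sup>2) * p\<^sup>2"] continuous_on_const LnX_continuous Hc)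
    show "continuous_on UNIV (\<lambda>\<theta>. \<kappa> / y ^ 3 * (bump n (\<theta> + real 0 * \<alpha>) * gap \<theta>) +
       \<kappa>\<^sup>2 * (2 * \<kappa> * K1 / y) * bump (2 * n) \<theta> + 2 * (\<kappa>\<^sup>2 * K)\<^sup>2)"
      by (intro continuous_on_add continuous_on_mult continuous_on_const bump_shift_continuous bump_continuous gap_continuous)
    show "cmod (Ln (1 + X \<theta>) + of_real (s\<^sup>2) * p\<^sup>2 * ?H \<theta>) \<le> \<kappa> / y ^ 3 * (bump n (\<theta> + real 0 * \<alpha>) * gap \<theta>) +
       \<kappa>\<^sup>2 * (2 * \<kappa> * K1 / y) * bump (2 * n) \<theta> + 2 * (\<kappa>\<^sup>2 * K)\<^sup>2" for \<theta>
    proof -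
      have "cmod (Ln (1 + X \<theta>) - X \<theta>) \<le> 2 * (cmod (X \<theta>))\<^sup>2" by (rule Ln_linear) (use X_small[of \<theta>] in linarith)
      also have "\<dots> \<le> 2 * (\<kappa>\<^sup>2 * K)\<^sup>2" using XK[of \<theta>] by (intro mult_left_mono power_mono) auto
      finally have 1: "cmod (Ln (1 + X \<theta>) - X \<theta>) \<le> 2 * (\<kappa>\<^sup>2 * K)\<^sup>2" .
      have "Ln (1 + X \<theta>) + of_real (s\<^sup>2) * p\<^sup>2 * ?H \<theta> =
        (Ln (1 + X \<theta>) - X \<theta>) + ((xp \<theta> + xm \<theta>) + (xp \<theta> * xm \<theta> + of_real (s\<^sup>2) * p\<^sup>2 * ?H \<theta>))"
        by (simp add: X_def)
      then have "cmod (Ln (1 + X \<theta>) + of_real (s\<^sup>2) * p\<^sup>2 * ?H \<theta>) \<le> cmod (Ln (1 + X \<theta>) - X \<theta>) +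
        (cmod (xp \<theta> + xm \<theta>) + cmod (xp \<theta> * xm \<theta> + of_real (s\<^sup>2) * p\<^sup>2 * ?H \<theta>))"
        by (simp only:) (intro order_trans[OF norm_triangle_ineq] add_left_mono norm_triangle_ineq)
      then show ?thesis using 1 x_sum_le_gap[of \<theta>] prod[of \<theta>] by linarith
    qed
  qed
  moreover have "integral {0..1} (\<lambda>\<theta>. \<kappa> / y ^ 3 * (bump n (\<theta> + real 0 * \<alpha>) * gap \<theta>) +
       \<kappa>\<^sup>2 * (2 * \<kappa> * K1 / y) * bump (2 * n) \<theta> + 2 * (\<kappa>\<^sup>2 * K)\<^sup>2)
    = \<kappa> / y ^ 3 * moment 0 + \<kappa>\<^sup>2 * (2 * \<kappa> * K1 / y) * mass (2 * n) + 2 * (\<kappa>\<^sup>2 * K)\<^sup>2"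
  proof (rule integral_unique)
    have c: "((\<lambda>\<theta>::real. 2 * (\<kappa>\<^sup>2 * K)\<^sup>2) has_integral 2 * (\<kappa>\<^sup>2 * K)\<^sup>2) {0..1}"
      using has_integral_const_real[of "2 * (\<kappa>\<^sup>2 * K)\<^sup>2" 0 1] by simp
    show "((\<lambda>\<theta>. \<kappa> / y ^ 3 * (bump n (\<theta> + real 0 * \<alpha>) * gap \<theta>) +
       \<kappa>\<^sup>2 * (2 * \<kappa> * K1 / y) * bump (2 * n) \<theta> + 2 * (\<kappa>\<^sup>2 * K)\<^sup>2) has_integral
       \<kappa> / y ^ 3 * moment 0 + \<kappa>\<^sup>2 * (2 * \<kappa> * K1 / y) * mass (2 * n) + 2 * (\<kappa>\<^sup>2 * K)\<^sup>2) {0..1}"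
      unfolding moment_def mass_def
      by (intro has_integral_add has_integral_mult_right integrable_integral c
        continuous_integrable01 continuous_on_mult bump_shift_continuous bump_continuous gap_continuous)
  qed
  ultimately show ?thesis unfolding K_def by simp
qed

text \<open>The moment is replaced by finitely many overlaps and a tail, the form in which the limit
  \<open>n \<rightarrow> \<infinity>\<close> can be taken.\<close>
lemma second_expansion_overlaps:
  "cmod (complex_exponent \<alpha> vp + complex_exponent \<alpha> vm - 2 * complex_exponent \<alpha> v
      + of_real (s\<^sup>2) * p\<^sup>2 * integral {0..1} (\<lambda>\<theta>. of_real (bump (2 * n) \<theta>) * (G \<theta>)\<^sup>2))
   \<le> \<kappa> / y ^ 3 * (2 * \<kappa> / y * ((\<Sum>k<N. q ^ k * overlap n (real (Suc k) * \<alpha>)) + q ^ N * (mass (2 * n) / (1 - q))))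
     + \<kappa>\<^sup>2 * (2 * \<kappa> * (1 / (y ^ 4 * (1 - q))) / y) * mass (2 * n)
     + 2 * (\<kappa>\<^sup>2 * (2 * (1 / (y ^ 4 * (1 - q))) + 1 / y\<^sup>2))\<^sup>2"
proof -
  have "\<kappa> / y ^ 3 * moment 0 \<le> \<kappa> / y ^ 3 * (2 * \<kappa> / y * ((\<Sum>k<N. q ^ k * overlap n (real (Suc k) * \<alpha>)) + q ^ N * (mass (2 * n) / (1 - q))))"
    by (intro mult_left_mono moment_expand divide_nonneg_pos kappa zero_less_power y)
  then show ?thesis using second_expansion unfolding K1_def by linarith
qed

end

section \<open>A family of potentials over the half disc\<close>

text \<open>Real on the real axis and vanishing to third order at the end points \<open>\<plusminus>R\<close> of the diameter. The
  power 3 balances the factor \<open>y\<^sup>-\<^sup>6\<close> in the bound of the second differences.\<close>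
definition damping :: "real \<Rightarrow> complex \<Rightarrow> complex" where
  "damping R z = (of_real (R\<^sup>2) - z\<^sup>2) ^ 3"

definition family_potential :: "real \<Rightarrow> (real \<Rightarrow> real) \<Rightarrow> (real \<Rightarrow> real) \<Rightarrow> complex \<Rightarrow> real \<Rightarrow> complex" where
  "family_potential R V b z \<theta> = of_real (V \<theta>) + z + damping R z * of_real (b \<theta>)"

lemma damping_base_bound:
  assumes "0 \<le> R" "R \<le> 1" "cmod z \<le> 2"
  shows "cmod (of_real (R\<^sup>2) - z\<^sup>2) \<le> 5"
proof -
  have "cmod (of_real (R\<^sup>2) - z\<^sup>2) \<le> R\<^sup>2 + (cmod z)\<^sup>2"
    using norm_triangle_ineq4[of "of_real (R\<^sup>2) :: complex" "z\<^sup>2"] by (simp add: norm_power)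
  also have "\<dots> \<le> 1\<^sup>2 + 2\<^sup>2" using assms by (intro add_mono power_mono) auto
  finally show ?thesis by simp
qed

lemma damping_bound:
  assumes "0 \<le> R" "R \<le> 1" "cmod z \<le> 2"
  shows "cmod (damping R z) \<le> 125"
  unfolding damping_def norm_power using power_mono[OF damping_base_bound[OF assms], of 3] by simp

text \<open>Since \<open>damping R\<close> is real on the real axis, its imaginary part is of order \<open>Im z\<close>. So a small real
  multiple of it cannot push \<open>V + z\<close> out of the upper half-plane.\<close>
lemma damping_Im:
  assumes "0 \<le> R" "R \<le> 1" "cmod z \<le> 2"
  shows "\<bar>Im (damping R z)\<bar> \<le> 300 * \<bar>Im z\<bar>"
proof -
  define u where "u = of_real (R\<^sup>2) - z\<^sup>2"
  have u: "cmod u \<le> 5" using damping_base_bound[OF assms] by (simp add: u_def)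
  have Imu: "\<bar>Im u\<bar> \<le> 4 * \<bar>Im z\<bar>"
  proof -
    have "\<bar>Im u\<bar> = 2 * \<bar>Re z\<bar> * \<bar>Im z\<bar>" by (simp add: u_def power2_eq_square abs_mult)
    also have "\<dots> \<le> 2 * 2 * \<bar>Im z\<bar>" using abs_Re_le_cmod[of z] assms by (intro mult_mono) auto
    finally show ?thesis by simp
  qed
  have "Im (u ^ 3) = Im u * (3 * (Re u)\<^sup>2 - (Im u)\<^sup>2)"
    by (simp add: power3_eq_cube power2_eq_square algebra_simps)
  moreover have "\<bar>3 * (Re u)\<^sup>2 - (Im u)\<^sup>2\<bar> \<le> 3 * (cmod u)\<^sup>2"
    unfolding cmod_power2 by (simp add: abs_le_iff)
  moreover have "3 * (cmod u)\<^sup>2 \<le> 3 * 5\<^sup>2" using power_mono[OF u, of 2] by simp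
  ultimately have "\<bar>Im (u ^ 3)\<bar> = \<bar>Im u\<bar> * \<bar>3 * (Re u)\<^sup>2 - (Im u)\<^sup>2\<bar>" "\<bar>3 * (Re u)\<^sup>2 - (Im u)\<^sup>2\<bar> \<le> 75"
    by (auto simp: abs_mult)
  then have "\<bar>Im (u ^ 3)\<bar> \<le> (4 * \<bar>Im z\<bar>) * 75" using mult_mono[OF Imu, of _ 75] by simp
  then show ?thesis by (simp add: damping_def u_def)
qed

text \<open>On the circle \<open>R\<^sup>2 = z * cnj z\<close>, so \<open>R\<^sup>2 - z\<^sup>2 = z (cnj z - z)\<close>.\<close>
lemma damping_on_circle:
  assumes "cmod z = R" "0 \<le> R" "R \<le> 1"
  shows "cmod (damping R z) \<le> 8 * \<bar>Im z\<bar> ^ 3"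
proof -
  have "of_real (R\<^sup>2) = z * cnj z" using assms(1) complex_norm_square[of z] by simp
  then have "of_real (R\<^sup>2) - z\<^sup>2 = z * (cnj z - z)" by (simp add: power2_eq_square right_diff_distrib)
  also have "cnj z - z = - (2 * \<i> * of_real (Im z))" by (simp add: complex_eq_iff)
  finally have "cmod (of_real (R\<^sup>2) - z\<^sup>2) = R * (2 * \<bar>Im z\<bar>)" using assms by (simp add: norm_mult)
  also have "\<dots> \<le> 1 * (2 * \<bar>Im z\<bar>)" using assms by (intro mult_right_mono) auto
  finally have "cmod (of_real (R\<^sup>2) - z\<^sup>2) \<le> 2 * \<bar>Im z\<bar>" by simp
  from power_mono[OF this, of 3] show ?thesis by (simp add: damping_def norm_power power_mult_distrib)
qed

lemma damping_expand:
  assumes R: "0 \<le> R" "R \<le> 1" and z: "cmod z \<le> 2" and h: "cmod (w - z) \<le> 1"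
  shows "cmod (damping R w - damping R z - (w - z) * (- 6 * z * (of_real (R\<^sup>2) - z\<^sup>2)\<^sup>2)) \<le> 575 * (cmod (w - z))\<^sup>2"
proof -
  define u h where "u = of_real (R\<^sup>2) - z\<^sup>2" and "h = w - z"
  define k where "k = 2 * z + h"
  have u: "cmod u \<le> 5" using damping_base_bound[OF R z] by (simp add: u_def)
  have h1: "cmod h \<le> 1" using h by (simp add: h_def)
  have k: "cmod k \<le> 5" unfolding k_def using norm_triangle_ineq[of "2 * z" h] z h1 by (simp add: norm_mult)
  have w: "w = z + h" by (simp add: h_def)
  have "damping R w - damping R z - h * (- 6 * z * u\<^sup>2) = h\<^sup>2 * (- 3 * u\<^sup>2 + 3 * u * k\<^sup>2 - h * k ^ 3)"
    unfolding damping_def w u_def k_def by (simp add: power2_eq_square power3_eq_cube algebra_simps)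
  then have "cmod (damping R w - damping R z - h * (- 6 * z * u\<^sup>2)) = (cmod h)\<^sup>2 * cmod (- 3 * u\<^sup>2 + 3 * u * k\<^sup>2 - h * k ^ 3)"
    by (simp add: norm_mult norm_power)
  also have "\<dots> \<le> (cmod h)\<^sup>2 * 575"
  proof (intro mult_left_mono)
    have 1: "cmod (- 3 * u\<^sup>2) \<le> 75" using power_mono[OF u, of 2] by (simp add: norm_mult norm_power)
    have 2: "cmod (3 * u * k\<^sup>2) \<le> 3 * 5 * 5\<^sup>2"
      unfolding norm_mult norm_power using u k by (intro mult_mono power_mono) auto
    have 3: "cmod (h * k ^ 3) \<le> 1 * 5 ^ 3"
      unfolding norm_mult norm_power using h1 k by (intro mult_mono power_mono) auto
    show "cmod (- 3 * u\<^sup>2 + 3 * u * k\<^sup>2 - h * k ^ 3) \<le> 575"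
      using 1 2 3 norm_triangle_ineq4[of "- 3 * u\<^sup>2 + 3 * u * k\<^sup>2" "h * k ^ 3"]
        norm_triangle_ineq[of "- 3 * u\<^sup>2" "3 * u * k\<^sup>2"] by simp
  qed simp
  finally show ?thesis by (simp add: h_def u_def mult.commute)
qed

locale family =
  fixes R :: real and V :: "real \<Rightarrow> real" and M0 \<alpha> :: real
  assumes R: "0 < R" "R \<le> 1"
    and V: "continuous_on UNIV V" "\<And>\<theta>. V (\<theta> + 1) = V \<theta>" "\<And>\<theta>. \<bar>V \<theta>\<bar> \<le> M0"
begin

text \<open>The bound \<open>1/600\<close> makes \<open>damping R z * b \<theta>\<close> contribute at most \<open>Im z / 2\<close> to the imaginary part.\<close>
definition small_profile :: "(real \<Rightarrow> real) \<Rightarrow> bool" where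
  "small_profile b \<longleftrightarrow> continuous_on UNIV b \<and> (\<forall>\<theta>. b (\<theta> + 1) = b \<theta>) \<and> (\<forall>\<theta>. \<bar>b \<theta>\<bar> \<le> 1 / 600)"

definition family_exponent :: "(real \<Rightarrow> real) \<Rightarrow> complex \<Rightarrow> complex" where
  "family_exponent b z = complex_exponent \<alpha> (family_potential R V b z)"

lemma family_potential_uhp:
  assumes b: "small_profile b" and z: "0 < y" "2 * y \<le> Im z" "cmod z \<le> 2"
  shows "uhp_potential y (M0 + 3) (family_potential R V b z)"
  unfolding uhp_potential_def
proof (intro conjI allI)
  have bc: "continuous_on UNIV b" and bp: "b (\<theta> + 1) = b \<theta>" and bb: "\<bar>b \<theta>\<bar> \<le> 1 / 600" for \<theta>
    using b by (auto simp: small_profile_def)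
  show "0 < y" by fact
  show "continuous_on UNIV (family_potential R V b z)"
    unfolding family_potential_def by (intro continuous_intros V bc)
  fix \<theta>
  show "family_potential R V b z (\<theta> + 1) = family_potential R V b z \<theta>" by (simp add: family_potential_def V bp)
  have "\<bar>Im (damping R z) * b \<theta>\<bar> \<le> (300 * Im z) * (1 / 600)"
    unfolding abs_mult using damping_Im[of R z] R z bb by (intro mult_mono) auto
  then have "\<bar>Im (damping R z) * b \<theta>\<bar> \<le> Im z / 2" by simp
  then show "y \<le> Im (family_potential R V b z \<theta>)" using z by (simp add: family_potential_def abs_le_iff)
  have "cmod (damping R z * of_real (b \<theta>)) \<le> 125 * (1 / 600)"
    unfolding norm_mult using damping_bound[of R z] R z bb by (intro mult_mono) auto
  then have "cmod (damping R z * of_real (b \<theta>)) \<le> 1" by simp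
  then show "cmod (family_potential R V b z \<theta>) \<le> M0 + 3"
    unfolding family_potential_def
    using norm_triangle_ineq[of "of_real (V \<theta>) + z" "damping R z * of_real (b \<theta>)"]
      norm_triangle_ineq[of "of_real (V \<theta>)" z] V(3)[of \<theta>] z by simp
qed

text \<open>The chain rule, obtained from the first order expansion of the exponent and the Taylor expansion
  of \<open>damping\<close>.\<close>
lemma family_exponent_derivative:
  assumes b: "small_profile b" and z: "z \<in> half_disc_nbhd"
  shows "(family_exponent b has_field_derivative integral {0..1} (\<lambda>\<theta>. (1 + (- 6 * z * (of_real (R\<^sup>2) - z\<^sup>2)\<^sup>2) * of_real (b \<theta>)) *
      green \<alpha> (family_potential R V b z) (family_potential R V b z) \<theta>)) (at z)"
proof -
  \<comment> \<open>Half of the height \<open>Im z / 2\<close> available at \<open>z\<close>, so that the same constant works at all nearby points.\<close>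
  define y where "y = Im z / 4"
  define D where "D = - 6 * z * (of_real (R\<^sup>2) - z\<^sup>2)\<^sup>2"
  define \<delta> where "\<delta> = min 1 (min (y / 6) (2 - cmod z))"
  define C where "C = (1 / (y ^ 4 * (1 - rate y)) + 2 / y\<^sup>2) * 9 + 1 / y"
  have zz: "0 < Im z" "cmod z < 2" using z by (auto simp: half_disc_nbhd_def)
  have y: "0 < y" using zz by (simp add: y_def)
  have bc: "continuous_on UNIV b" and bb: "\<bar>b \<theta>\<bar> \<le> 1 / 600" for \<theta> using b by (auto simp: small_profile_def)
  let ?G = "green \<alpha> (family_potential R V b z) (family_potential R V b z)"
  have P: "uhp_potential y (M0 + 3) (family_potential R V b z)"
    by (rule family_potential_uhp[OF b y]) (use zz in \<open>auto simp: y_def\<close>)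
  have D300: "cmod D \<le> 300"
  proof -
    have "cmod D = 6 * cmod z * (cmod (of_real (R\<^sup>2) - z\<^sup>2))\<^sup>2" by (simp add: D_def norm_mult norm_power)
    also have "\<dots> \<le> 6 * 2 * 5\<^sup>2"
      using zz R damping_base_bound[of R z] by (intro mult_mono power_mono) auto
    finally show ?thesis by simp
  qed
  show ?thesis unfolding D_def[symmetric]
  proof (rule quadratic_remainder_imp_derivative[where \<delta> = \<delta> and C = C])
    show "0 < \<delta>" using y zz by (simp add: \<delta>_def)
    fix w assume "cmod (w - z) < \<delta>"
    then have w: "cmod (w - z) \<le> 1" "cmod (w - z) \<le> y / 6" "cmod (w - z) < 2 - cmod z" by (auto simp: \<delta>_def)
    have w2: "cmod w \<le> 2" using norm_triangle_ineq[of "w - z" z] w by simp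
    have Imw: "2 * y \<le> Im w" using abs_Im_le_cmod[of "w - z"] w y by (simp add: y_def abs_le_iff)
    have P': "uhp_potential y (M0 + 3) (family_potential R V b w)" by (rule family_potential_uhp[OF b y Imw w2])
    define h where "h = cmod (w - z)"
    have h: "0 \<le> h" "h \<le> 1" "h \<le> y / 6" using w by (auto simp: h_def)
    have ex: "cmod (damping R w - damping R z - (w - z) * D) \<le> 575 * h\<^sup>2"
      using damping_expand[of R z w] R zz w by (simp add: D_def h_def)
    have h2: "h\<^sup>2 \<le> h" using h by (simp add: power2_eq_square mult_left_le)
    have pw: "cmod (damping R w - damping R z) \<le> 875 * h"
    proof -
      have "cmod ((w - z) * D) \<le> h * 300" unfolding norm_mult h_def using D300 by (intro mult_left_mono) auto
      then show ?thesis
        using norm_triangle_ineq[of "damping R w - damping R z - (w - z) * D" "(w - z) * D"] ex h2 by simp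
    qed
    have dq: "family_potential R V b w \<theta> - family_potential R V b z \<theta> = (w - z) + (damping R w - damping R z) * of_real (b \<theta>)" for \<theta>
      by (simp add: family_potential_def algebra_simps)
    have A: "cmod (family_potential R V b w \<theta> - family_potential R V b z \<theta>) \<le> 3 * h" for \<theta>
    proof -
      have "cmod ((damping R w - damping R z) * of_real (b \<theta>)) \<le> 875 * h * (1 / 600)"
        unfolding norm_mult using pw bb h by (intro mult_mono) auto
      then show ?thesis unfolding dq
        using norm_triangle_ineq[of "w - z" "(damping R w - damping R z) * of_real (b \<theta>)"] h(1)
        unfolding h_def by linarith
    qed
    have 1: "cmod (family_exponent b w - family_exponent b z - integral {0..1} (\<lambda>\<theta>. (family_potential R V b w \<theta> - family_potential R V b z \<theta>) * ?G \<theta>))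
      \<le> (1 / (y ^ 4 * (1 - rate y)) + 2 / y\<^sup>2) * (3 * h)\<^sup>2"
      unfolding family_exponent_def by (rule complex_exponent_first_order[OF P P' A]) (use h in auto)
    have Gc: "continuous_on S ?G" for S by (rule continuous_on_subset[OF green_continuous[OF P P]]) auto
    have i1: "(\<lambda>\<theta>. (family_potential R V b w \<theta> - family_potential R V b z \<theta>) * ?G \<theta>) integrable_on {0..1}"
      by (intro integrable_continuous_real continuous_intros Gc
          continuous_on_subset[OF uhp_potentialD(2)[OF P]] continuous_on_subset[OF uhp_potentialD(2)[OF P']]) auto
    have i2: "(\<lambda>\<theta>. (1 + D * of_real (b \<theta>)) * ?G \<theta>) integrable_on {0..1}"
      by (intro integrable_continuous_real continuous_intros Gc continuous_on_subset[OF bc]) auto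
    have "((\<lambda>\<theta>. (family_potential R V b w \<theta> - family_potential R V b z \<theta>) * ?G \<theta> - (w - z) * ((1 + D * of_real (b \<theta>)) * ?G \<theta>)) has_integral
       integral {0..1} (\<lambda>\<theta>. (family_potential R V b w \<theta> - family_potential R V b z \<theta>) * ?G \<theta>) - (w - z) * integral {0..1} (\<lambda>\<theta>. (1 + D * of_real (b \<theta>)) * ?G \<theta>)) {0..1}"
      by (intro has_integral_diff has_integral_mult_right integrable_integral i1 i2)
    moreover have "(family_potential R V b w \<theta> - family_potential R V b z \<theta>) * ?G \<theta> - (w - z) * ((1 + D * of_real (b \<theta>)) * ?G \<theta>) =
       (damping R w - damping R z - (w - z) * D) * of_real (b \<theta>) * ?G \<theta>" for \<theta>
      unfolding dq by (simp add: algebra_simps)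
    ultimately have I: "((\<lambda>\<theta>. (damping R w - damping R z - (w - z) * D) * of_real (b \<theta>) * ?G \<theta>) has_integral
       integral {0..1} (\<lambda>\<theta>. (family_potential R V b w \<theta> - family_potential R V b z \<theta>) * ?G \<theta>) - (w - z) * integral {0..1} (\<lambda>\<theta>. (1 + D * of_real (b \<theta>)) * ?G \<theta>)) {0..1}"
      by simp
    have 2: "cmod (integral {0..1} (\<lambda>\<theta>. (family_potential R V b w \<theta> - family_potential R V b z \<theta>) * ?G \<theta>) - (w - z) * integral {0..1} (\<lambda>\<theta>. (1 + D * of_real (b \<theta>)) * ?G \<theta>))
       \<le> integral {0..1::real} (\<lambda>_. h\<^sup>2 * (1 / y))"
      unfolding integral_unique[OF I, symmetric]
    proof (rule integral_norm_bound_integral)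
      show "(\<lambda>\<theta>. (damping R w - damping R z - (w - z) * D) * of_real (b \<theta>) * ?G \<theta>) integrable_on {0..1}"
        using I by blast
      show "cmod ((damping R w - damping R z - (w - z) * D) * of_real (b \<theta>) * ?G \<theta>) \<le> h\<^sup>2 * (1 / y)" for \<theta>
      proof -
        have "cmod ((damping R w - damping R z - (w - z) * D) * of_real (b \<theta>)) \<le> 575 * h\<^sup>2 * (1 / 600)"
          unfolding norm_mult[of _ "of_real _"] using ex bb by (intro mult_mono) auto
        also have "\<dots> \<le> h\<^sup>2" by simp
        finally show ?thesis unfolding norm_mult[of _ "?G \<theta>"]
          using green_bounds(1)[OF P P] by (intro mult_mono) auto
      qed
    qed auto
    have "cmod (family_exponent b w - family_exponent b z - (w - z) * integral {0..1} (\<lambda>\<theta>. (1 + D * of_real (b \<theta>)) * ?G \<theta>))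
      \<le> (1 / (y ^ 4 * (1 - rate y)) + 2 / y\<^sup>2) * (3 * h)\<^sup>2 + h\<^sup>2 * (1 / y)"
      using norm_diff_triangle_le[OF 1 2] by simp
    also have "\<dots> = C * h\<^sup>2" by (simp add: C_def power_mult_distrib algebra_simps)
    finally show "cmod (family_exponent b w - family_exponent b z - (w - z) * integral {0..1} (\<lambda>\<theta>. (1 + D * of_real (b \<theta>)) * ?G \<theta>))
      \<le> C * (cmod (w - z))\<^sup>2" by (simp add: h_def)
  qed
qed

lemma family_exponent_holomorphic:
  assumes "small_profile b" shows "family_exponent b holomorphic_on half_disc_nbhd"
  unfolding holomorphic_on_open[OF open_half_disc_nbhd] using family_exponent_derivative[OF assms] by blast

text \<open>The real part is bounded by one step of the transfer matrices, the imaginary part by \<open>pi\<close>; in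
  particular the bound does not deteriorate at the diameter.\<close>
lemma family_exponent_bounded:
  assumes b: "small_profile b" and z: "z \<in> half_disc_nbhd"
  shows "cmod (family_exponent b z) \<le> M0 + 5 + pi"
proof -
  have P: "uhp_potential (Im z / 2) (M0 + 3) (family_potential R V b z)"
    by (rule family_potential_uhp[OF b]) (use z in \<open>auto simp: half_disc_nbhd_def\<close>)
  have t: "ln (1 + transfer_norm \<alpha> (family_potential R V b z) 1 \<theta>) \<le> M0 + 5" for \<theta>
  proof -
    have "transfer_norm \<alpha> (family_potential R V b z) 1 \<theta> = cmod (family_potential R V b z \<theta>) + 2" by (simp add: transfer_norm_def)
    then have "transfer_norm \<alpha> (family_potential R V b z) 1 \<theta> \<le> M0 + 5" using uhp_potentialD(5)[OF P, of \<theta>] by simp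
    then show ?thesis using ln_add_one_self_le_self[OF transfer_norm_nonneg, of \<alpha> "family_potential R V b z" 1 \<theta>] by linarith
  qed
  have tc: "continuous_on {0..1} (\<lambda>\<theta>. ln (1 + transfer_norm \<alpha> (family_potential R V b z) 1 \<theta>))"
    by (rule ln_transfer_norm_continuous_on)
      (rule continuous_on_compose2[OF uhp_potentialD(2)[OF P]], auto intro!: continuous_intros)
  have "Re (family_exponent b z) \<le> integral {0..1} (\<lambda>\<theta>. ln (1 + transfer_norm \<alpha> (family_potential R V b z) 1 \<theta>))"
    using complex_exponent_le_transfer_norm[OF P, of 1 \<alpha>] by (simp add: family_exponent_def)
  also have "\<dots> \<le> integral {0..1} (\<lambda>\<theta>::real. M0 + 5)"
    by (intro integral_le integrable_continuous_real tc t) auto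
  finally have "Re (family_exponent b z) \<le> M0 + 5" by simp
  then show ?thesis
    using cmod_le[of "family_exponent b z"] complex_exponent_Re_nonneg[OF P, of \<alpha>] complex_exponent_Im[OF P, of \<alpha>]
    by (simp add: family_exponent_def)
qed

theorem family_exponent_reflection:
  assumes b: "small_profile b"
    and lyap: "\<And>x. \<bar>x\<bar> \<le> R \<Longrightarrow> lyapunov \<alpha> (schrodinger (\<lambda>\<theta>. V \<theta> + x + (R\<^sup>2 - x\<^sup>2) ^ 3 * b \<theta>)) \<le> 0"
    and z: "0 < Im \<zeta>" "cmod \<zeta> < R"
  shows "2 * pi * \<i> * family_exponent b \<zeta> = arc_cauchy R (family_exponent b) \<zeta> + cnj (arc_cauchy R (family_exponent b) (cnj \<zeta>))"
proof (rule reflection_formula[OF R family_exponent_holomorphic[OF b] family_exponent_bounded[OF b] _ z])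
  fix x :: real assume x: "\<bar>x\<bar> \<le> R"
  have bc: "continuous_on UNIV b" and bp: "b (\<theta> + 1) = b \<theta>" for \<theta> using b by (auto simp: small_profile_def)
  define W where "W t = family_potential R V b (Complex x t)" for t
  have "((\<lambda>t. Re (complex_exponent \<alpha> (W t))) \<longlongrightarrow> 0) (at_right 0)"
  proof (rule complex_exponent_boundary_zero[where c = "\<lambda>t. t / 2" and M = "M0 + 3" and U = "\<lambda>\<theta>. V \<theta> + x + (R\<^sup>2 - x\<^sup>2) ^ 3 * b \<theta>"])
    have "Complex x t = of_real x + \<i> * of_real t" for t by (simp add: complex_eq_iff)
    then show "continuous_on ({0..1} \<times> UNIV) (\<lambda>(t, \<theta>). W t \<theta>)"
      unfolding W_def family_potential_def damping_def case_prod_beta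
      by (auto intro!: continuous_intros continuous_on_compose2[OF V(1)] continuous_on_compose2[OF bc])
    show "uhp_potential (t / 2) (M0 + 3) (W t)" if "0 < t" "t \<le> 1" for t
      unfolding W_def
    proof (rule family_potential_uhp[OF b])
      show "cmod (Complex x t) \<le> 2" using cmod_le[of "Complex x t"] that x R by simp
    qed (use that in auto)
    show "W 0 \<theta> = of_real (V \<theta> + x + (R\<^sup>2 - x\<^sup>2) ^ 3 * b \<theta>)" for \<theta>
    proof -
      have "Complex x 0 = of_real x" by (simp add: complex_eq_iff)
      then show ?thesis by (simp add: W_def family_potential_def damping_def)
    qed
    show "continuous_on UNIV (\<lambda>\<theta>. V \<theta> + x + (R\<^sup>2 - x\<^sup>2) ^ 3 * b \<theta>)"
      by (intro continuous_intros V bc)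
    show "lyapunov \<alpha> (schrodinger (\<lambda>\<theta>. V \<theta> + x + (R\<^sup>2 - x\<^sup>2) ^ 3 * b \<theta>)) \<le> 0" by (rule lyap[OF x])
  qed (simp add: V bp)
  then show "((\<lambda>y. Re (family_exponent b (Complex x y))) \<longlongrightarrow> 0) (at_right 0)" by (simp add: family_exponent_def W_def)
qed

end

section \<open>Limits of the normalised variations\<close>

lemma mass_le_1: "mass n \<le> 1"
proof -
  have "mass n \<le> integral {0..1} (\<lambda>\<theta>::real. 1)"
    unfolding mass_def by (rule integral_cont_mono) (auto intro: bump_continuous bump_bounds)
  then show ?thesis by simp
qed

lemma mass_antimono: "mass (2 * n) \<le> mass n"
  unfolding mass_def
proof (rule integral_cont_mono)
  show "bump (2 * n) \<theta> \<le> bump n \<theta>" for \<theta>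
    unfolding bump_square[symmetric] using bump_bounds[of n \<theta>] by (simp add: power2_eq_square mult_left_le)
qed (auto intro: bump_continuous)

text \<open>The size of the perturbation will be chosen negligible even compared to the mass of the bump.\<close>
lemma ratio_tendsto:
  fixes s :: "nat \<Rightarrow> real"
  assumes s: "\<And>n. 0 < s n" and lim: "(\<lambda>n. s n / mass (2 * n)) \<longlonglongrightarrow> 0"
  shows "s \<longlonglongrightarrow> 0" "(\<lambda>n. s n / mass n) \<longlonglongrightarrow> 0"
proof -
  have 1: "s n \<le> s n / mass (2 * n)" for n
    using s[of n] mass_pos[of "2 * n"] mass_le_1[of "2 * n"] by (simp add: le_divide_eq mult_left_le)
  have 2: "s n / mass n \<le> s n / mass (2 * n)" for n
    using s[of n] mass_pos[of "2 * n"] mass_pos[of n] mass_antimono[of n] by (intro divide_left_mono) auto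
  show "s \<longlonglongrightarrow> 0"
    by (rule tendsto_sandwich[OF _ _ tendsto_const lim]) (use s 1 in \<open>auto intro!: always_eventually less_imp_le\<close>)
  have 3: "0 \<le> s n / mass n" for n using s[of n] mass_pos[of n] by simp
  show "(\<lambda>n. s n / mass n) \<longlonglongrightarrow> 0"
    by (rule tendsto_sandwich[OF _ _ tendsto_const lim]) (use 2 3 in \<open>auto intro!: always_eventually\<close>)
qed

text \<open>The quadratic remainder of the first order expansion is not weighted by the bump, but it is
  negligible because \<open>s n / mass n \<rightarrow> 0\<close>.\<close>
theorem first_variation_limit:
  fixes s :: "nat \<Rightarrow> real"
  assumes s: "\<And>n. 0 < s n" and lim: "(\<lambda>n. s n / mass (2 * n)) \<longlonglongrightarrow> 0"
    and ev: "\<forall>\<^sub>F n in sequentially. perturbation y M (s n) v p n"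
    and P: "uhp_potential y M v"
  shows "(\<lambda>n. (complex_exponent \<alpha> (\<lambda>\<theta>. v \<theta> + of_real (s n) * p * of_real (bump n \<theta>)) - complex_exponent \<alpha> v) / of_real (s n * mass n))
     \<longlonglongrightarrow> p * green \<alpha> v v (1/2)"
proof -
  let ?vp = "\<lambda>n \<theta>. v \<theta> + of_real (s n) * p * of_real (bump n \<theta>)"
  let ?I = "\<lambda>n. integral {0..1} (\<lambda>\<theta>. of_real (bump n \<theta>) * green \<alpha> v v \<theta>)"
  let ?K = "1 / (y ^ 4 * (1 - rate y)) + 2 / y\<^sup>2"
  have main: "cmod ((complex_exponent \<alpha> (?vp n) - complex_exponent \<alpha> v) / of_real (s n * mass n) - p * (?I n / of_real (mass n)))
      \<le> ?K * (cmod p)\<^sup>2 * (s n / mass n)" if pert: "perturbation y M (s n) v p n" for n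
  proof -
    have pos: "0 < s n * mass n" using s mass_pos by simp
    have "integral {0..1} (\<lambda>\<theta>. (?vp n \<theta> - v \<theta>) * green \<alpha> v v \<theta>) = of_real (s n) * p * ?I n"
      by (simp add: mult.assoc flip: integral_mult_right)
    then have "cmod (complex_exponent \<alpha> (?vp n) - complex_exponent \<alpha> v - of_real (s n) * p * ?I n) \<le> ?K * (s n * cmod p)\<^sup>2"
      using complex_exponent_first_order[OF P perturbation.Pp[OF pert] perturbation.perturb_diff(1)[OF pert], of \<alpha>]
        perturbation.small[OF pert] perturbation.y[OF pert] by simp
    then have "cmod (complex_exponent \<alpha> (?vp n) - complex_exponent \<alpha> v - of_real (s n) * p * ?I n) / (s n * mass n) \<le> ?K * (s n * cmod p)\<^sup>2 / (s n * mass n)"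
      using pos by (intro divide_right_mono) auto
    also have "\<dots> = ?K * (cmod p)\<^sup>2 * (s n / mass n)"
      using s[of n] by (simp add: power2_eq_square)
    finally have 1: "cmod (complex_exponent \<alpha> (?vp n) - complex_exponent \<alpha> v - of_real (s n) * p * ?I n) / (s n * mass n) \<le> ?K * (cmod p)\<^sup>2 * (s n / mass n)" .
    have "(complex_exponent \<alpha> (?vp n) - complex_exponent \<alpha> v) / of_real (s n * mass n) - p * (?I n / of_real (mass n)) =
      (complex_exponent \<alpha> (?vp n) - complex_exponent \<alpha> v - of_real (s n) * p * ?I n) / of_real (s n * mass n)"
      using s[of n] by (simp add: diff_divide_distrib)
    then have "cmod ((complex_exponent \<alpha> (?vp n) - complex_exponent \<alpha> v) / of_real (s n * mass n) - p * (?I n / of_real (mass n))) =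
      cmod (complex_exponent \<alpha> (?vp n) - complex_exponent \<alpha> v - of_real (s n) * p * ?I n) / (s n * mass n)"
      using pos by (simp only: norm_divide norm_of_real abs_of_pos)
    then show ?thesis using 1 by (simp only:)
  qed
  have z: "(\<lambda>n. ?K * (cmod p)\<^sup>2 * (s n / mass n)) \<longlonglongrightarrow> 0"
    using tendsto_mult[OF tendsto_const ratio_tendsto(2)[OF s lim], of "?K * (cmod p)\<^sup>2"] by simp
  have "(\<lambda>n. (complex_exponent \<alpha> (?vp n) - complex_exponent \<alpha> v) / of_real (s n * mass n) - p * (?I n / of_real (mass n))) \<longlonglongrightarrow> 0"
    by (rule Lim_null_comparison[OF eventually_mono[OF ev main] z])
  moreover have "(\<lambda>n. p * (?I n / of_real (mass n))) \<longlonglongrightarrow> p * green \<alpha> v v (1/2)"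
    by (intro tendsto_mult tendsto_const bump_concentrates green_continuous[OF P P])
  ultimately show ?thesis using tendsto_add by fastforce
qed

text \<open>The terms of \<open>second_expansion\<close>, divided by \<open>s\<^sup>2\<close> times the mass.\<close>
lemma normalised_second_order_terms:
  fixes a m y r P S Q K K' :: real
  assumes "a \<noteq> 0" "m \<noteq> 0" "y \<noteq> 0" "r \<noteq> 0"
  shows "(a * P / y ^ 3 * (2 * (a * P) / y * (S + Q * (m / r))) + (a * P)\<^sup>2 * (2 * (a * P) * K' / y) * m
      + 2 * ((a * P)\<^sup>2 * K)\<^sup>2) / (a\<^sup>2 * m) =
    2 * P\<^sup>2 / y ^ 4 * (S / m) + 2 * P ^ 3 * K' / y * a + 2 * P ^ 4 * K\<^sup>2 * (a * (a / m)) + 2 * P\<^sup>2 / y ^ 4 * (Q / r)"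
proof -
  have 1: "a * P / y ^ 3 * (2 * (a * P) / y * (S + Q * (m / r))) / (a\<^sup>2 * m) = 2 * P\<^sup>2 / y ^ 4 * (S / m + Q / r)"
    using assms by (simp add: field_simps power2_eq_square power3_eq_cube power4_eq_xxxx)
  have 2: "(a * P)\<^sup>2 * (2 * (a * P) * K' / y) * m / (a\<^sup>2 * m) = 2 * P ^ 3 * K' / y * a"
    using assms by (simp add: field_simps power2_eq_square power3_eq_cube)
  have 3: "2 * ((a * P)\<^sup>2 * K)\<^sup>2 / (a\<^sup>2 * m) = 2 * P ^ 4 * K\<^sup>2 * (a * (a / m))"
    using assms by (simp add: field_simps power2_eq_square power4_eq_xxxx)
  show ?thesis unfolding add_divide_distrib 1 2 3 by (simp add: distrib_left)
qed

text \<open>Irrationality enters here: the off-diagonal terms of the second variation are controlled by the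
  overlaps of the bump with its translates by \<open>k * \<alpha>\<close>, for finitely many \<open>k\<close>, up to a geometric tail.\<close>
theorem second_variation_limit:
  fixes s :: "nat \<Rightarrow> real"
  assumes s: "\<And>n. 0 < s n" and lim: "(\<lambda>n. s n / mass (2 * n)) \<longlonglongrightarrow> 0"
    and ev: "\<forall>\<^sub>F n in sequentially. perturbation y M (s n) v p n"
    and P: "uhp_potential y M v"
    and irr: "\<And>k. 0 < k \<Longrightarrow> real k * \<alpha> \<notin> \<int>"
  shows "(\<lambda>n. (complex_exponent \<alpha> (\<lambda>\<theta>. v \<theta> + of_real (s n) * p * of_real (bump n \<theta>))
      + complex_exponent \<alpha> (\<lambda>\<theta>. v \<theta> - of_real (s n) * p * of_real (bump n \<theta>)) - 2 * complex_exponent \<alpha> v) / of_real ((s n)\<^sup>2 * mass (2 * n)))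
     \<longlonglongrightarrow> - (p * green \<alpha> v v (1/2))\<^sup>2"
proof -
  let ?vp = "\<lambda>n \<theta>. v \<theta> + of_real (s n) * p * of_real (bump n \<theta>)"
  let ?vm = "\<lambda>n \<theta>. v \<theta> - of_real (s n) * p * of_real (bump n \<theta>)"
  let ?I = "\<lambda>n. integral {0..1} (\<lambda>\<theta>. of_real (bump (2 * n) \<theta>) * (green \<alpha> v v \<theta>)\<^sup>2)"
  define \<Delta> where "\<Delta> n = (complex_exponent \<alpha> (?vp n) + complex_exponent \<alpha> (?vm n) - 2 * complex_exponent \<alpha> v) / of_real ((s n)\<^sup>2 * mass (2 * n))" for n
  define q where "q = rate y"
  define K1 where "K1 = 1 / (y ^ 4 * (1 - q))"
  define c where "c = 2 * (cmod p)\<^sup>2 / y ^ 4"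
  define c2 where "c2 = 2 * (cmod p) ^ 3 * K1 / y"
  define c3 where "c3 = 2 * (cmod p) ^ 4 * (2 * K1 + 1 / y\<^sup>2)\<^sup>2"
  have y: "0 < y" by (rule uhp_potentialD(1)[OF P])
  have q: "0 < q" "q < 1" using rate_bounds[OF y] by (auto simp: q_def)
  have c0: "0 \<le> c" using y by (simp add: c_def)
  define S where "S N n = c * (\<Sum>k<N. q ^ k * (overlap n (real (Suc k) * \<alpha>) / mass (2 * n))) + c2 * s n + c3 * (s n * (s n / mass (2 * n)))" for N n
  have main: "cmod (\<Delta> n - - (p\<^sup>2 * (?I n / of_real (mass (2 * n))))) \<le> S N n + c * (q ^ N / (1 - q))"
    if pert: "perturbation y M (s n) v p n" for n N
  proof -
    define d where "d = (s n)\<^sup>2 * mass (2 * n)"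
    have m: "0 < mass (2 * n)" by (rule mass_pos)
    have d: "0 < d" using s[of n] m by (simp add: d_def)
    have "\<Delta> n - - (p\<^sup>2 * (?I n / of_real (mass (2 * n)))) =
      (complex_exponent \<alpha> (?vp n) + complex_exponent \<alpha> (?vm n) - 2 * complex_exponent \<alpha> v + of_real ((s n)\<^sup>2) * p\<^sup>2 * ?I n) / of_real d"
      using s[of n] m by (simp add: \<Delta>_def d_def add_divide_distrib)
    then have "cmod (\<Delta> n - - (p\<^sup>2 * (?I n / of_real (mass (2 * n))))) =
      cmod (complex_exponent \<alpha> (?vp n) + complex_exponent \<alpha> (?vm n) - 2 * complex_exponent \<alpha> v + of_real ((s n)\<^sup>2) * p\<^sup>2 * ?I n) / d"
      using d by (simp only: norm_divide norm_of_real abs_of_pos)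
    moreover have "\<dots> \<le> (s n * cmod p / y ^ 3 * (2 * (s n * cmod p) / y * ((\<Sum>k<N. q ^ k * overlap n (real (Suc k) * \<alpha>)) + q ^ N * (mass (2 * n) / (1 - q))))
      + (s n * cmod p)\<^sup>2 * (2 * (s n * cmod p) * K1 / y) * mass (2 * n)
      + 2 * ((s n * cmod p)\<^sup>2 * (2 * K1 + 1 / y\<^sup>2))\<^sup>2) / d"
      unfolding K1_def q_def
      by (rule divide_right_mono[OF perturbation.second_expansion_overlaps[OF pert] less_imp_le[OF d]])
    moreover have "\<dots> = S N n + c * (q ^ N / (1 - q))"
    proof -
      have s0: "s n \<noteq> 0" "mass (2 * n) \<noteq> 0" "y \<noteq> 0" "1 - q \<noteq> 0" using s[of n] m y q by auto
      define \<Sigma> where "\<Sigma> = (\<Sum>k<N. q ^ k * overlap n (real (Suc k) * \<alpha>))"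
      define \<mu> where "\<mu> = mass (2 * n)"
      have "(\<Sum>k<N. q ^ k * (overlap n (real (Suc k) * \<alpha>) / mass (2 * n))) = \<Sigma> / \<mu>"
        by (simp add: \<Sigma>_def \<mu>_def sum_divide_distrib)
      then have "S N n = c * (\<Sigma> / \<mu>) + c2 * s n + c3 * (s n * (s n / \<mu>))" by (simp add: S_def \<mu>_def)
      then show ?thesis
        unfolding \<Sigma>_def[symmetric] \<mu>_def[symmetric] d_def c_def c2_def c3_def
        using normalised_second_order_terms[of "s n" \<mu> y "1 - q"] s0(1,3,4) s0(2)[folded \<mu>_def] by simp
    qed
    ultimately show ?thesis by linarith
  qed
  have "(\<lambda>n. \<Delta> n - - (p\<^sup>2 * (?I n / of_real (mass (2 * n))))) \<longlonglongrightarrow> 0"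
  proof (rule LIMSEQ_I)
    fix r :: real assume r: "0 < r"
    have "(\<lambda>N. c * (q ^ N / (1 - q))) \<longlonglongrightarrow> c * (0 / (1 - q))"
      using q by (intro tendsto_intros LIMSEQ_power_zero) auto
    then have "\<forall>\<^sub>F N in sequentially. c * (q ^ N / (1 - q)) < r / 2"
      by (rule order_tendstoD(2)) (use r in auto)
    then obtain N where N: "c * (q ^ N / (1 - q)) < r / 2" by (auto simp: eventually_sequentially)
    have "S N \<longlonglongrightarrow> c * (\<Sum>k<N. q ^ k * 0) + c2 * 0 + c3 * (0 * 0)"
      unfolding S_def
      by (intro tendsto_add tendsto_mult tendsto_sum tendsto_const overlap_vanishes irr ratio_tendsto(1)[OF s lim] lim) auto
    then have "\<forall>\<^sub>F n in sequentially. S N n < r / 2" by (rule order_tendstoD(2)) (use r in auto)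
    with ev have "\<forall>\<^sub>F n in sequentially. norm (\<Delta> n - - (p\<^sup>2 * (?I n / of_real (mass (2 * n)))) - 0) < r"
    proof eventually_elim
      case (elim n)
      show ?case using main[OF elim(1), of N] elim(2) N unfolding diff_zero by linarith
    qed
    then show "\<exists>no. \<forall>n\<ge>no. norm (\<Delta> n - - (p\<^sup>2 * (?I n / of_real (mass (2 * n)))) - 0) < r"
      by (simp only: eventually_sequentially)
  qed
  moreover have "(\<lambda>n. - (p\<^sup>2 * (?I n / of_real (mass (2 * n))))) \<longlonglongrightarrow> - (p\<^sup>2 * (green \<alpha> v v (1/2))\<^sup>2)"
  proof -
    have f: "filterlim (\<lambda>n::nat. 2 * n) at_top sequentially" by (rule mult_nat_left_at_top) simp
    have "continuous_on UNIV (\<lambda>\<theta>. (green \<alpha> v v \<theta>)\<^sup>2)"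
      by (intro continuous_on_power green_continuous[OF P P])
    from filterlim_compose[OF bump_concentrates[OF this] f]
    show ?thesis by (intro tendsto_minus tendsto_mult tendsto_const)
  qed
  ultimately have "(\<lambda>n. (\<Delta> n - - (p\<^sup>2 * (?I n / of_real (mass (2 * n))))) + - (p\<^sup>2 * (?I n / of_real (mass (2 * n))))) \<longlonglongrightarrow> 0 + - (p\<^sup>2 * (green \<alpha> v v (1/2))\<^sup>2)"
    by (rule tendsto_add)
  then show ?thesis by (simp add: \<Delta>_def power_mult_distrib)
qed

section \<open>Impossibility of locally vanishing exponents\<close>

text \<open>The relation of \<open>reflection_formula\<close>, together with the integrability that makes it linear.\<close>
definition reflects :: "real \<Rightarrow> (complex \<Rightarrow> complex) \<Rightarrow> bool" where
  "reflects R f \<longleftrightarrow> (\<forall>\<zeta>. cmod \<zeta> < R \<longrightarrow>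
      (\<lambda>t. f (R * cis t) * (\<i> * R * cis t / (R * cis t - \<zeta>))) integrable_on {0<..<pi}) \<and>
    (\<forall>\<zeta>. 0 < Im \<zeta> \<longrightarrow> cmod \<zeta> < R \<longrightarrow>
      2 * pi * \<i> * f \<zeta> = arc_cauchy R f \<zeta> + cnj (arc_cauchy R f (cnj \<zeta>)))"

text \<open>The coefficients have to be real, since the relation involves a conjugation.\<close>
lemma reflects_combination:
  assumes f: "reflects R f" and h: "reflects R h"
  shows "reflects R (\<lambda>z. of_real a * f z + of_real b * h z)"
proof -
  have i: "((\<lambda>t. (of_real a * f (R * cis t) + of_real b * h (R * cis t)) * (\<i> * R * cis t / (R * cis t - \<zeta>)))
     has_integral of_real a * arc_cauchy R f \<zeta> + of_real b * arc_cauchy R h \<zeta>) {0<..<pi}" if "cmod \<zeta> < R" for \<zeta>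
  proof -
    have "((\<lambda>t. of_real a * (f (R * cis t) * (\<i> * R * cis t / (R * cis t - \<zeta>)))
       + of_real b * (h (R * cis t) * (\<i> * R * cis t / (R * cis t - \<zeta>))))
     has_integral of_real a * arc_cauchy R f \<zeta> + of_real b * arc_cauchy R h \<zeta>) {0<..<pi}"
      unfolding arc_cauchy_def using f h that
      by (intro has_integral_add has_integral_mult_right integrable_integral) (auto simp: reflects_def)
    then show ?thesis by (simp only: distrib_right mult.assoc)
  qed
  have e: "arc_cauchy R (\<lambda>z. of_real a * f z + of_real b * h z) \<zeta> = of_real a * arc_cauchy R f \<zeta> + of_real b * arc_cauchy R h \<zeta>"
    if "cmod \<zeta> < R" for \<zeta>
    unfolding arc_cauchy_def[of R "\<lambda>z. of_real a * f z + of_real b * h z"] by (rule integral_unique[OF i[OF that]])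
  show ?thesis unfolding reflects_def
  proof (intro conjI allI impI)
    fix \<zeta> assume "cmod \<zeta> < R"
    then show "(\<lambda>t. (of_real a * f (R * cis t) + of_real b * h (R * cis t)) * (\<i> * R * cis t / (R * cis t - \<zeta>))) integrable_on {0<..<pi}"
      using i by blast
  next
    fix \<zeta> assume z: "0 < Im \<zeta>" "cmod \<zeta> < R"
    have "2 * pi * \<i> * f \<zeta> = arc_cauchy R f \<zeta> + cnj (arc_cauchy R f (cnj \<zeta>))"
      "2 * pi * \<i> * h \<zeta> = arc_cauchy R h \<zeta> + cnj (arc_cauchy R h (cnj \<zeta>))"
      using f h z by (auto simp: reflects_def)
    then have "of_real a * (2 * pi * \<i> * f \<zeta>) + of_real b * (2 * pi * \<i> * h \<zeta>) =
      of_real a * (arc_cauchy R f \<zeta> + cnj (arc_cauchy R f (cnj \<zeta>))) + of_real b * (arc_cauchy R h \<zeta> + cnj (arc_cauchy R h (cnj \<zeta>)))"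
      by (simp only:)
    then show "2 * pi * \<i> * (of_real a * f \<zeta> + of_real b * h \<zeta>) =
      arc_cauchy R (\<lambda>z. of_real a * f z + of_real b * h z) \<zeta> + cnj (arc_cauchy R (\<lambda>z. of_real a * f z + of_real b * h z) (cnj \<zeta>))"
      using z by (simp add: e algebra_simps)
  qed
qed

lemma reflects_limit:
  assumes f: "\<And>n. reflects R (f n)"
    and c: "\<And>n. continuous_on {0<..<pi} (\<lambda>t. f n (R * cis t))"
    and B: "\<And>n t. 0 < t \<Longrightarrow> t < pi \<Longrightarrow> cmod (f n (R * cis t)) \<le> B"
    and lim: "\<And>z. z \<in> half_disc_nbhd \<Longrightarrow> (\<lambda>n. f n z) \<longlonglongrightarrow> g z"
    and R: "0 < R" "R \<le> 1"
  shows "\<And>\<zeta>. 0 < Im \<zeta> \<Longrightarrow> cmod \<zeta> < R \<Longrightarrow> 2 * pi * \<i> * g \<zeta> = arc_cauchy R g \<zeta> + cnj (arc_cauchy R g (cnj \<zeta>))"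
    and "\<And>K. continuous_on {0..pi} K \<Longrightarrow> (\<lambda>t. g (R * cis t) * K t) integrable_on {0<..<pi}"
    and "\<And>t. 0 < t \<Longrightarrow> t < pi \<Longrightarrow> cmod (g (R * cis t)) \<le> B"
proof -
  have arc: "R * cis t \<in> half_disc_nbhd" if "0 < t" "t < pi" for t
    using that R by (auto simp: half_disc_nbhd_def norm_mult sin_gt_zero)
  have l: "(\<lambda>n. f n (R * cis t)) \<longlonglongrightarrow> g (R * cis t)" if "0 < t" "t < pi" for t
    using lim arc that by blast
  show "(\<lambda>t. g (R * cis t) * K t) integrable_on {0<..<pi}" if "continuous_on {0..pi} K" for K
    by (rule arc_dominated_convergence(1)[OF c B l that])
  show "cmod (g (R * cis t)) \<le> B" if "0 < t" "t < pi" for t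
    by (rule LIMSEQ_le_const2[OF tendsto_norm[OF l[OF that]]]) (use B[OF that] in auto)
  have A: "(\<lambda>n. arc_cauchy R (f n) \<zeta>) \<longlonglongrightarrow> arc_cauchy R g \<zeta>" if "cmod \<zeta> < R" for \<zeta>
    unfolding arc_cauchy_def by (rule arc_dominated_convergence(2)[OF c B l arc_kernel_continuous[OF that]])
  fix \<zeta> assume z: "0 < Im \<zeta>" "cmod \<zeta> < R"
  have 1: "(\<lambda>n. arc_cauchy R (f n) \<zeta> + cnj (arc_cauchy R (f n) (cnj \<zeta>))) \<longlonglongrightarrow> arc_cauchy R g \<zeta> + cnj (arc_cauchy R g (cnj \<zeta>))"
    by (intro tendsto_add tendsto_cnj A) (use z in auto)
  have 2: "arc_cauchy R (f n) \<zeta> + cnj (arc_cauchy R (f n) (cnj \<zeta>)) = 2 * pi * \<i> * f n \<zeta>" for n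
    using f[of n] z by (simp add: reflects_def)
  have 3: "(\<lambda>n. 2 * pi * \<i> * f n \<zeta>) \<longlonglongrightarrow> 2 * pi * \<i> * g \<zeta>"
    by (intro tendsto_mult tendsto_const lim) (use z R in \<open>auto simp: half_disc_nbhd_def\<close>)
  show "2 * pi * \<i> * g \<zeta> = arc_cauchy R g \<zeta> + cnj (arc_cauchy R g (cnj \<zeta>))"
    by (rule LIMSEQ_unique[OF 3 1[unfolded 2]])
qed

context family
begin

abbreviation "base \<equiv> family_potential R V (\<lambda>_. 0)"

lemma small_bump:
  assumes "0 < s" "s \<le> 1 / 600"
  shows "small_profile (\<lambda>\<theta>. s * bump n \<theta>)" "small_profile (\<lambda>\<theta>. - (s * bump n \<theta>))" "small_profile (\<lambda>_. 0)"
proof -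
  have "\<bar>s * bump n \<theta>\<bar> \<le> 1 / 600" for \<theta>
    using mult_mono[of s "1 / 600" "bump n \<theta>" 1] assms bump_bounds[of n \<theta>] by (simp add: abs_mult)
  then show "small_profile (\<lambda>\<theta>. s * bump n \<theta>)" "small_profile (\<lambda>\<theta>. - (s * bump n \<theta>))" "small_profile (\<lambda>_. 0)"
    unfolding small_profile_def
    by (auto simp: bump_periodic intro!: continuous_on_mult continuous_on_minus bump_continuous)
qed

lemma family_potential_bump:
  "family_potential R V (\<lambda>\<theta>. s * bump n \<theta>) z = (\<lambda>\<theta>. base z \<theta> + of_real s * damping R z * of_real (bump n \<theta>))"
  "family_potential R V (\<lambda>\<theta>. - (s * bump n \<theta>)) z = (\<lambda>\<theta>. base z \<theta> - of_real s * damping R z * of_real (bump n \<theta>))"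
  by (auto simp: family_potential_def fun_eq_iff)

lemma perturbation_bump:
  assumes s: "0 < s" "s \<le> 1 / 600" and z: "z \<in> half_disc_nbhd"
    and small: "s * cmod (damping R z) \<le> Im z / 16"
  shows "perturbation (Im z / 2) (M0 + 3) s (base z) (damping R z) n"
proof -
  have y: "0 < Im z / 2" "2 * (Im z / 2) \<le> Im z" "cmod z \<le> 2" using z by (auto simp: half_disc_nbhd_def)
  show ?thesis
    unfolding perturbation_def family_potential_bump[symmetric]
    using family_potential_uhp[OF small_bump(1)[OF s] y] family_potential_uhp[OF small_bump(2)[OF s] y]
      family_potential_uhp[OF small_bump(3)[OF s] y] s small by simp
qed

text \<open>The normalised differences \<open>D n\<close> and \<open>E n\<close> are real combinations of the exponents of three
  families, so they satisfy the reflection relation, and their limits \<open>g\<close> and \<open>g\<^sup>2\<close> inherit it.\<close>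
theorem no_zero_exponents:
  fixes s :: "nat \<Rightarrow> real"
  assumes irr: "\<And>k. 0 < k \<Longrightarrow> real k * \<alpha> \<notin> \<int>"
    and s: "\<And>n. 0 < s n" "\<And>n. s n \<le> 1 / 600" and lim: "(\<lambda>n. s n / mass (2 * n)) \<longlonglongrightarrow> 0"
    and lyap: "\<And>n x \<sigma>. \<bar>x\<bar> \<le> R \<Longrightarrow> \<sigma> \<in> {0, s n, - s n} \<Longrightarrow>
       lyapunov \<alpha> (schrodinger (\<lambda>\<theta>. V \<theta> + x + (R\<^sup>2 - x\<^sup>2) ^ 3 * (\<sigma> * bump n \<theta>))) \<le> 0"
  shows False
proof -
  define bp bm where "bp n \<theta> = s n * bump n \<theta>" and "bm n \<theta> = - (s n * bump n \<theta>)" for n \<theta>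
  define b0 :: "real \<Rightarrow> real" where "b0 = (\<lambda>_. 0)"
  have sm: "small_profile (bp n)" "small_profile (bm n)" "small_profile b0" for n
    unfolding bp_def[abs_def] bm_def[abs_def] b0_def by (rule small_bump[OF s(1)[of n] s(2)[of n]])+
  define g where "g z = damping R z * green \<alpha> (base z) (base z) (1/2)" for z
  define D where "D n z = of_real (1 / (s n * mass n)) * family_exponent (bp n) z + of_real (- 1 / (s n * mass n)) * family_exponent b0 z" for n z
  define H where "H n z = of_real 1 * family_exponent (bp n) z + of_real 1 * family_exponent (bm n) z" for n z
  \<comment> \<open>The sign is chosen such that the limit is \<open>g\<^sup>2\<close>.\<close>
  define E where "E n z = of_real (- 1 / ((s n)\<^sup>2 * mass (2 * n))) * H n z + of_real (2 / ((s n)\<^sup>2 * mass (2 * n))) * family_exponent b0 z" for n z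
  have Deq: "D n z = (family_exponent (bp n) z - family_exponent b0 z) / of_real (s n * mass n)" for n z
    by (simp add: D_def diff_divide_distrib)
  have Eeq: "E n z = - ((family_exponent (bp n) z + family_exponent (bm n) z - 2 * family_exponent b0 z) / of_real ((s n)\<^sup>2 * mass (2 * n)))" for n z
    by (simp add: E_def H_def diff_divide_distrib add_divide_distrib)
  have arc: "R * cis t \<in> half_disc_nbhd" if "0 < t" "t < pi" for t
    using that R by (auto simp: half_disc_nbhd_def norm_mult sin_gt_zero)
  have arc_cont: "continuous_on {0<..<pi} (\<lambda>t. family_exponent b (R * cis t))" if "small_profile b" for b
    by (rule continuous_on_compose2[OF holomorphic_on_imp_continuous_on[OF family_exponent_holomorphic[OF that]]])
      (use arc in \<open>auto intro!: continuous_intros\<close>)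
  have refl: "reflects R (family_exponent b)" if "small_profile b" and
    "\<And>x. \<bar>x\<bar> \<le> R \<Longrightarrow> lyapunov \<alpha> (schrodinger (\<lambda>\<theta>. V \<theta> + x + (R\<^sup>2 - x\<^sup>2) ^ 3 * b \<theta>)) \<le> 0" for b
    unfolding reflects_def
  proof (intro conjI allI impI)
    fix \<zeta> :: complex assume "cmod \<zeta> < R"
    then show "(\<lambda>t. family_exponent b (R * cis t) * (\<i> * R * cis t / (R * cis t - \<zeta>))) integrable_on {0<..<pi}"
      by (intro arc_dominated_convergence(1)[where f = "\<lambda>_ t. family_exponent b (R * cis t)" and B = "M0 + 5 + pi"]
          arc_cont[OF that(1)] family_exponent_bounded[OF that(1)] arc tendsto_const arc_kernel_continuous)
  next
    fix \<zeta> assume z: "0 < Im \<zeta>" "cmod \<zeta> < R"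
    show "2 * pi * \<i> * family_exponent b \<zeta> = arc_cauchy R (family_exponent b) \<zeta> + cnj (arc_cauchy R (family_exponent b) (cnj \<zeta>))"
      by (rule family_exponent_reflection[OF that(1) _ z]) (rule that(2))
  qed
  have rp: "reflects R (family_exponent (bp n))" and rm: "reflects R (family_exponent (bm n))" and r0: "reflects R (family_exponent b0)" for n
    using refl[OF sm(1)[of n]] refl[OF sm(2)[of n]] refl[OF sm(3)] lyap[of _ "s n" n] lyap[of _ "- s n" n] lyap[of _ 0 n]
    by (auto simp: bp_def bm_def b0_def)
  have Dr: "reflects R (D n)" for n
    unfolding D_def by (rule reflects_combination[OF rp r0])
  have Hr: "reflects R (H n)" for n
    unfolding H_def by (rule reflects_combination[OF rp rm])
  have Er: "reflects R (E n)" for n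
    unfolding E_def by (rule reflects_combination[OF Hr r0])
  have Dc: "continuous_on {0<..<pi} (\<lambda>t. D n (R * cis t))" for n
    unfolding D_def by (intro continuous_on_add continuous_on_mult continuous_on_const arc_cont sm)
  have Ec: "continuous_on {0<..<pi} (\<lambda>t. E n (R * cis t))" for n
    unfolding E_def H_def by (intro continuous_on_add continuous_on_mult continuous_on_const arc_cont sm)
  have family_exponent_bp: "family_exponent (bp n) z = complex_exponent \<alpha> (\<lambda>\<theta>. base z \<theta> + of_real (s n) * damping R z * of_real (bump n \<theta>))"
    and family_exponent_bm: "family_exponent (bm n) z = complex_exponent \<alpha> (\<lambda>\<theta>. base z \<theta> - of_real (s n) * damping R z * of_real (bump n \<theta>))"
    and family_exponent_b0: "family_exponent b0 z = complex_exponent \<alpha> (base z)" for n z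
    unfolding family_exponent_def bp_def[abs_def] bm_def[abs_def] b0_def family_potential_bump by simp_all
  \<comment> \<open>On the arc the damping is of order \<open>y\<^sup>3\<close>, which compensates the negative powers of \<open>y\<close>.\<close>
  have bounds: "cmod (D n (R * cis t)) \<le> 32 \<and> cmod (E n (R * cis t)) \<le> 40960" if t: "0 < t" "t < pi" for n t
  proof -
    define z where "z = R * cis t"
    define y where "y = Im z / 2"
    have z: "z \<in> half_disc_nbhd" "cmod z = R" using arc[OF t] R by (auto simp: z_def norm_mult)
    have y: "0 < y" "y \<le> 1 / 2"
      using z R abs_Im_le_cmod[of z] by (auto simp: y_def half_disc_nbhd_def)
    have p: "cmod (damping R z) \<le> 64 * y ^ 3"
      using damping_on_circle[OF z(2)] R y by (simp add: y_def power_divide)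
    have "s n * cmod (damping R z) \<le> 1 / 600 * (64 * y ^ 3)"
      using s[of n] p by (intro mult_mono) auto
    also have "\<dots> \<le> 1 / 600 * (64 * (y * 1))"
      using y by (intro mult_left_mono) (auto simp: power3_eq_cube intro!: mult_left_le mult_le_one)
    also have "\<dots> \<le> Im z / 16" using y by (simp add: y_def)
    finally have sp: "s n * cmod (damping R z) \<le> Im z / 16" .
    let ?vp = "\<lambda>\<theta>. base z \<theta> + of_real (s n) * damping R z * of_real (bump n \<theta>)"
    let ?vm = "\<lambda>\<theta>. base z \<theta> - of_real (s n) * damping R z * of_real (bump n \<theta>)"
    have pert: "perturbation y (M0 + 3) (s n) (base z) (damping R z) n"
      unfolding y_def by (rule perturbation_bump[OF s(1) s(2) z(1) sp])
    have m: "0 < mass n" "0 < mass (2 * n)" by (rule mass_pos)+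
    have d: "0 < s n * mass n" "0 < (s n)\<^sup>2 * mass (2 * n)" using s(1)[of n] m by auto
    have "cmod (D n z) = cmod (complex_exponent \<alpha> ?vp - complex_exponent \<alpha> (base z)) / (s n * mass n)"
      unfolding Deq family_exponent_bp family_exponent_b0 norm_divide norm_of_real abs_of_pos[OF d(1)] ..
    also have "\<dots> \<le> 2 * (s n * cmod (damping R z) / y) * mass n / (s n * mass n)"
      by (rule divide_right_mono[OF perturbation.first_bound[OF pert] less_imp_le[OF d(1)]])
    also have "\<dots> = 2 / y * cmod (damping R z)" using s(1)[of n] m by (simp add: field_simps)
    also have "\<dots> \<le> 2 / y * (64 * y ^ 3)" using y p by (intro mult_left_mono) auto
    also have "\<dots> = 128 * y\<^sup>2" using y by (simp add: power2_eq_square power3_eq_cube)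
    also have "\<dots> \<le> 128 * (1 / 2)\<^sup>2" using y by (intro mult_left_mono power_mono) auto
    finally have Dn: "cmod (D n z) \<le> 32" by (simp add: power2_eq_square)
    have rate: "1 / (1 - rate y) \<le> 2 / y\<^sup>2"
    proof -
      have "y\<^sup>2 \<le> 1\<^sup>2" using y by (intro power_mono) auto
      then show ?thesis unfolding one_minus_rate[OF y(1)] by (intro divide_right_mono) auto
    qed
    define W where "W = 2 / (y ^ 4 * (1 - rate y)) + 1 / y\<^sup>2"
    have W: "0 \<le> W" "W \<le> 5 / y ^ 6"
    proof -
      have "2 / (y ^ 4 * (1 - rate y)) = 2 / y ^ 4 * (1 / (1 - rate y))" by simp
      also have "\<dots> \<le> 2 / y ^ 4 * (2 / y\<^sup>2)" using rate y by (intro mult_left_mono) auto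
      also have "\<dots> = 4 / y ^ 6" by (simp flip: power_add)
      finally have 1: "2 / (y ^ 4 * (1 - rate y)) \<le> 4 / y ^ 6" .
      have "y ^ 6 \<le> y ^ 2" using y by (intro power_decreasing) auto
      then have 2: "1 / y\<^sup>2 \<le> 1 / y ^ 6" using y by (intro divide_left_mono) auto
      show "W \<le> 5 / y ^ 6" using 1 2 unfolding W_def by linarith
      show "0 \<le> W" using rate_bounds[OF y(1)] y by (simp add: W_def)
    qed
    have "cmod (E n z) = cmod (complex_exponent \<alpha> ?vp + complex_exponent \<alpha> ?vm - 2 * complex_exponent \<alpha> (base z)) / ((s n)\<^sup>2 * mass (2 * n))"
      unfolding Eeq family_exponent_bp family_exponent_bm family_exponent_b0 norm_minus_cancel norm_divide norm_of_real abs_of_pos[OF d(2)] ..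
    also have "\<dots> \<le> 2 * (s n * cmod (damping R z))\<^sup>2 * W * mass (2 * n) / ((s n)\<^sup>2 * mass (2 * n))"
      unfolding W_def by (rule divide_right_mono[OF perturbation.second_bound[OF pert] less_imp_le[OF d(2)]])
    also have "\<dots> = 2 * (cmod (damping R z))\<^sup>2 * W" using s(1)[of n] m by (simp add: field_simps)
    also have "\<dots> \<le> 2 * (64 * y ^ 3)\<^sup>2 * (5 / y ^ 6)"
      using p W y by (intro mult_mono power_mono) auto
    also have "\<dots> = 40960" using y by (simp add: power_mult_distrib flip: power_mult)
    finally have En: "cmod (E n z) \<le> 40960" .
    show ?thesis using Dn En by (simp add: z_def)
  qed
  have limits: "(\<lambda>n. D n z) \<longlonglongrightarrow> g z \<and> (\<lambda>n. E n z) \<longlonglongrightarrow> (g z)\<^sup>2" if z: "z \<in> half_disc_nbhd" for z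
  proof -
    have y: "0 < Im z / 2" "2 * (Im z / 2) \<le> Im z" "cmod z \<le> 2" using z by (auto simp: half_disc_nbhd_def)
    have P: "uhp_potential (Im z / 2) (M0 + 3) (base z)"
      using family_potential_uhp[OF sm(3) y] by (simp add: b0_def)
    have "(\<lambda>n. s n * cmod (damping R z)) \<longlonglongrightarrow> 0 * cmod (damping R z)"
      by (intro tendsto_mult tendsto_const ratio_tendsto(1)[OF s(1) lim])
    then have "\<forall>\<^sub>F n in sequentially. s n * cmod (damping R z) < Im z / 16"
      by (rule order_tendstoD(2)) (use y in auto)
    then have ev: "\<forall>\<^sub>F n in sequentially. perturbation (Im z / 2) (M0 + 3) (s n) (base z) (damping R z) n"
      by (rule eventually_mono) (intro perturbation_bump s z less_imp_le)
    have 1: "(\<lambda>n. D n z) \<longlonglongrightarrow> g z"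
      unfolding Deq family_exponent_bp family_exponent_b0 g_def by (rule first_variation_limit[OF s(1) lim ev P])
    have "(\<lambda>n. E n z) \<longlonglongrightarrow> - (- (g z)\<^sup>2)"
      unfolding Eeq family_exponent_bp family_exponent_bm family_exponent_b0 g_def
      by (intro tendsto_minus second_variation_limit[OF s(1) lim ev P irr])
    with 1 show ?thesis by simp
  qed
  note Dlim = reflects_limit[OF Dr Dc conjunct1[OF bounds] conjunct1[OF limits] R]
  note Elim = reflects_limit[OF Er Ec conjunct2[OF bounds] conjunct2[OF limits] R]
  define \<zeta> where "\<zeta> = \<i> * of_real (R / 2)"
  have z: "0 < Im \<zeta>" "cmod \<zeta> < R" using R by (auto simp: \<zeta>_def norm_mult)
  have "g \<zeta> = 0"
    by (rule reflection_square_zero[OF R(1) Dlim(3) Dlim(2) Elim(2) Dlim(1) Elim(1) z])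
  moreover have "damping R \<zeta> \<noteq> 0"
  proof -
    have "of_real (R\<^sup>2) - \<zeta>\<^sup>2 = of_real (R\<^sup>2 + (R / 2)\<^sup>2)" by (simp add: \<zeta>_def complex_eq_iff power2_eq_square)
    moreover have "R\<^sup>2 + (R / 2)\<^sup>2 \<noteq> 0" using R by (simp add: add_pos_nonneg less_imp_neq[symmetric] power2_eq_square)
    ultimately show ?thesis unfolding damping_def by (metis of_real_eq_0_iff power_not_zero)
  qed
  moreover have "green \<alpha> (base \<zeta>) (base \<zeta>) (1/2) \<noteq> 0"
  proof -
    have "uhp_potential (Im \<zeta> / 2) (M0 + 3) (base \<zeta>)"
      using family_potential_uhp[OF sm(3), of "Im \<zeta> / 2" \<zeta>] z R by (simp add: b0_def)
    then show ?thesis using green_bounds(2) by blast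
  qed
  ultimately show False by (simp add: g_def)
qed

end

section \<open>Smooth functions on the circle\<close>

definition smooth :: "(real \<Rightarrow> real) \<Rightarrow> bool" where
  "smooth f \<longleftrightarrow> (\<forall>n. (deriv ^^ n) f differentiable_on UNIV)"

text \<open>Smoothness is the largest property that implies differentiability and is stable under
  \<open>deriv\<close>.\<close>
lemma smooth_coinduct:
  assumes "P f" and "\<And>g. P g \<Longrightarrow> g differentiable_on UNIV \<and> P (deriv g)"
  shows "smooth f"
proof -
  have "P ((deriv ^^ n) f)" for n by (induction n) (use assms in auto)
  then show ?thesis using assms(2) by (auto simp: smooth_def)
qed

lemma smooth_differentiable: "smooth f \<Longrightarrow> f differentiable_on UNIV"
  unfolding smooth_def by (metis funpow_0)

lemma smooth_deriv: "smooth f \<Longrightarrow> smooth (deriv f)"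
  unfolding smooth_def by (metis comp_apply funpow_Suc_right)

lemma smooth_funpow: "smooth f \<Longrightarrow> smooth ((deriv ^^ n) f)"
  by (induction n) (auto intro: smooth_deriv)

lemma smooth_has_derivative:
  assumes "smooth f" shows "(f has_real_derivative deriv f x) (at x)"
  using smooth_differentiable[OF assms]
  by (simp add: DERIV_deriv_iff_real_differentiable differentiable_on_def)

lemma smooth_const: "smooth (\<lambda>_. c)"
  by (rule smooth_coinduct[where P = "\<lambda>f. \<exists>c. f = (\<lambda>_. c)"]) auto

text \<open>Sums of products of smooth functions: a class closed under \<open>deriv\<close> by the product rule, which
  makes \<open>smooth_coinduct\<close> applicable.\<close>
inductive poly_smooth :: "(real \<Rightarrow> real) \<Rightarrow> bool" where
  gen: "smooth f \<Longrightarrow> poly_smooth f"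
| add: "poly_smooth f \<Longrightarrow> poly_smooth g \<Longrightarrow> poly_smooth (\<lambda>x. f x + g x)"
| mul: "smooth f \<Longrightarrow> smooth g \<Longrightarrow> poly_smooth (\<lambda>x. f x * g x)"

lemma poly_smooth_step:
  assumes "poly_smooth f"
  shows "(\<forall>x. (f has_real_derivative deriv f x) (at x)) \<and> poly_smooth (deriv f)"
  using assms
proof induction
  case (gen f)
  then show ?case by (auto intro: smooth_has_derivative smooth_deriv poly_smooth.gen)
next
  case (add f g)
  have d: "((\<lambda>x. f x + g x) has_real_derivative deriv f x + deriv g x) (at x)" for x
    using add by (intro DERIV_add) auto
  then have "deriv (\<lambda>x. f x + g x) = (\<lambda>x. deriv f x + deriv g x)" by (intro ext DERIV_imp_deriv)
  then show ?case using d add by (auto intro: poly_smooth.add)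
next
  case (mul f g)
  have d: "((\<lambda>x. f x * g x) has_real_derivative deriv f x * g x + deriv g x * f x) (at x)" for x
    by (intro DERIV_mult smooth_has_derivative mul)
  then have "deriv (\<lambda>x. f x * g x) = (\<lambda>x. deriv f x * g x + deriv g x * f x)" by (intro ext DERIV_imp_deriv)
  then show ?case using d mul by (auto intro!: poly_smooth.add poly_smooth.mul smooth_deriv)
qed

lemma poly_smooth_smooth:
  assumes "poly_smooth f" shows "smooth f"
proof (rule smooth_coinduct[where P = poly_smooth, OF assms])
  fix g assume "poly_smooth g"
  then show "g differentiable_on UNIV \<and> poly_smooth (deriv g)"
    using poly_smooth_step[of g]
    by (auto simp: differentiable_on_def DERIV_deriv_iff_real_differentiable)
qed

lemma smooth_add: "smooth f \<Longrightarrow> smooth g \<Longrightarrow> smooth (\<lambda>x. f x + g x)"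
  by (rule poly_smooth_smooth[OF poly_smooth.add[OF poly_smooth.gen poly_smooth.gen]])

lemma smooth_mult: "smooth f \<Longrightarrow> smooth g \<Longrightarrow> smooth (\<lambda>x. f x * g x)"
  by (rule poly_smooth_smooth[OF poly_smooth.mul])

lemma smooth_power: "smooth f \<Longrightarrow> smooth (\<lambda>x. f x ^ n)"
  by (induction n) (auto intro: smooth_const smooth_mult)

lemma smooth_sin: "smooth (\<lambda>x. sin (pi * x))"
proof -
  have "smooth (\<lambda>x. 1 * sin (pi * x) + 0 * cos (pi * x))"
  proof (rule smooth_coinduct[where P = "\<lambda>f. \<exists>a b. f = (\<lambda>x. a * sin (pi * x) + b * cos (pi * x))"])
    fix g assume "\<exists>a b. g = (\<lambda>x. a * sin (pi * x) + b * cos (pi * x))"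
    then obtain a b where g: "g = (\<lambda>x. a * sin (pi * x) + b * cos (pi * x))" by blast
    have d: "(g has_real_derivative (- b * pi) * sin (pi * x) + (a * pi) * cos (pi * x)) (at x)" for x
      unfolding g by (auto intro!: derivative_eq_intros)
    then have "deriv g = (\<lambda>x. (- b * pi) * sin (pi * x) + (a * pi) * cos (pi * x))" by (intro ext DERIV_imp_deriv)
    moreover have "g differentiable_on UNIV"
      unfolding differentiable_on_def using d real_differentiable_def by blast
    ultimately show "g differentiable_on UNIV \<and> (\<exists>a b. deriv g = (\<lambda>x. a * sin (pi * x) + b * cos (pi * x)))"
      by blast
  qed blast
  then show ?thesis by simp
qed

lemma smooth_continuous: "smooth f \<Longrightarrow> continuous_on UNIV f"
  using differentiable_imp_continuous_on smooth_differentiable by blast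

lemma deriv_periodic:
  fixes f :: "real \<Rightarrow> real"
  assumes "\<And>x. f (x + 1) = f x" "smooth f"
  shows "deriv f (x + 1) = deriv f x"
proof -
  have "((\<lambda>x. f (x + 1)) has_real_derivative deriv f (x + 1) * 1) (at x)"
    by (rule DERIV_chain2[OF smooth_has_derivative[OF assms(2)]]) (auto intro!: derivative_eq_intros)
  then have "(f has_real_derivative deriv f (x + 1)) (at x)" using assms(1) by simp
  then show ?thesis using DERIV_imp_deriv by fastforce
qed

lemma funpow_deriv_periodic:
  assumes "\<And>x. f (x + 1) = f x" "smooth f"
  shows "(deriv ^^ n) f (x + 1) = (deriv ^^ n) f x"
proof (induction n arbitrary: x)
  case (Suc n)
  then show ?case using deriv_periodic[of "(deriv ^^ n) f" x] smooth_funpow[OF assms(2)] by simp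
qed (use assms in simp)

lemma periodic_continuous_bounded:
  fixes f :: "real \<Rightarrow> real"
  assumes per: "\<And>x. f (x + 1) = f x" and c: "continuous_on UNIV f"
  shows "\<exists>K. \<forall>x. \<bar>f x\<bar> \<le> K"
proof -
  interpret periodic_fun_simple' f by unfold_locales (rule per)
  have "bounded (f ` {0..1})"
    by (intro compact_imp_bounded compact_continuous_image continuous_on_subset[OF c] compact_Icc) auto
  then obtain K where K: "\<And>x. x \<in> {0..1} \<Longrightarrow> \<bar>f x\<bar> \<le> K"
    unfolding bounded_iff real_norm_def by blast
  have "\<bar>f x\<bar> \<le> K" for x
  proof -
    have "f x = f (frac x + of_int \<lfloor>x\<rfloor>)" by (simp add: frac_def)
    also have "\<dots> = f (frac x)" by (rule plus_of_int)
    finally show ?thesis using K[of "frac x"] by (simp add: frac_lt_1 less_imp_le)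
  qed
  then show ?thesis by blast
qed

lemma funpow_deriv_affine:
  assumes a: "smooth a"
  shows "(deriv ^^ n) (\<lambda>x. c + k * a x) = (\<lambda>x. (if n = 0 then c else 0) + k * (deriv ^^ n) a x)"
proof (induction n)
  case (Suc n)
  have "((\<lambda>x. (if n = 0 then c else 0) + k * (deriv ^^ n) a x) has_real_derivative k * deriv ((deriv ^^ n) a) x) (at x)" for x
    by (auto intro!: derivative_eq_intros smooth_has_derivative smooth_funpow a)
  then have "deriv (\<lambda>x. (if n = 0 then c else 0) + k * (deriv ^^ n) a x) = (\<lambda>x. k * deriv ((deriv ^^ n) a) x)"
    by (intro ext DERIV_imp_deriv)
  then show ?case using Suc by simp
qed simp

text \<open>Only the size of \<open>k\<close> relative to a constant depending on the profile \<open>a\<close> matters, so a profile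
  with large derivatives can be compensated by a small coefficient.\<close>
lemma Cr_norm_affine_le:
  assumes a: "smooth a" "\<And>x. a (x + 1) = a x"
  shows "\<exists>K\<ge>0. \<forall>c k. Cr_norm r (\<lambda>x. c + k * a x) \<le> \<bar>c\<bar> + \<bar>k\<bar> * K"
proof -
  have "\<exists>K. \<forall>x. \<bar>(deriv ^^ n) a x\<bar> \<le> K" for n
    by (rule periodic_continuous_bounded)
      (auto intro: funpow_deriv_periodic[OF a(2,1)] smooth_continuous smooth_funpow a)
  then obtain B where B: "\<And>n x. \<bar>(deriv ^^ n) a x\<bar> \<le> B n" by metis
  define K where "K = (\<Sum>n\<le>r. \<bar>B n\<bar>)"
  have BK: "B n \<le> K" if "n \<le> r" for n
    unfolding K_def by (rule order_trans[OF abs_ge_self member_le_sum[of n "{..r}" "\<lambda>n. \<bar>B n\<bar>"]]) (use that in auto)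
  have "Cr_norm r (\<lambda>x. c + k * a x) \<le> \<bar>c\<bar> + \<bar>k\<bar> * K" for c k
    unfolding Cr_norm_def
  proof (rule Max.boundedI)
    fix m assume "m \<in> (\<lambda>n. SUP x. \<bar>(deriv ^^ n) (\<lambda>x. c + k * a x) x\<bar>) ` {..r}"
    then obtain n where n: "n \<le> r" "m = (SUP x. \<bar>(deriv ^^ n) (\<lambda>x. c + k * a x) x\<bar>)" by auto
    show "m \<le> \<bar>c\<bar> + \<bar>k\<bar> * K"
      unfolding n(2)
    proof (rule cSUP_least)
      fix x
      have "\<bar>k * (deriv ^^ n) a x\<bar> \<le> \<bar>k\<bar> * K"
        unfolding abs_mult using order_trans[OF B BK[OF n(1)]] by (intro mult_left_mono) auto
      then show "\<bar>(deriv ^^ n) (\<lambda>x. c + k * a x) x\<bar> \<le> \<bar>c\<bar> + \<bar>k\<bar> * K"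
        unfolding funpow_deriv_affine[OF a(1)] by auto
    qed simp
  qed auto
  moreover have "0 \<le> K" by (simp add: K_def sum_nonneg)
  ultimately show ?thesis by blast
qed

lemma smooth_circle_iff: "f \<in> smooth_circle \<longleftrightarrow> smooth f \<and> (\<forall>x. f (x + 1) = f x)"
  by (auto simp: smooth_circle_def smooth_def)

section \<open>Irrationality of the frequency\<close>

text \<open>For a rational with denominator \<open>n\<close> the distance of \<open>n * x\<close> to the integers is 0.\<close>
lemma CD_irrational:
  assumes "x \<in> CD \<gamma> \<sigma>" "\<gamma> > 0" shows "x \<notin> \<rat>"
proof
  assume "x \<in> \<rat>"
  then obtain m n :: int where n: "n \<noteq> 0" "x = of_int m / of_int n" by (auto simp: Rats_eq_int_div_int)
  have "inverse \<gamma> * \<bar>of_int n\<bar> powr (- \<sigma>) \<le> (INF l::int. \<bar>of_int n * x - of_int l\<bar>)"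
    using assms(1) n(1) by (auto simp: CD_def)
  also have "\<dots> \<le> \<bar>of_int n * x - of_int m\<bar>"
    by (rule cINF_lower) (auto intro!: bdd_belowI[of _ 0])
  also have "\<dots> = 0" using n by simp
  finally have "inverse \<gamma> * \<bar>real_of_int n\<bar> powr (- \<sigma>) \<le> 0" .
  moreover have "0 < inverse \<gamma> * \<bar>real_of_int n\<bar> powr (- \<sigma>)" using assms(2) n(1) by simp
  ultimately show False by linarith
qed

lemma gauss_map_rational: "x \<in> \<rat> \<Longrightarrow> gauss_map x \<in> \<rat>"
  unfolding gauss_map_def frac_def by simp

lemma Sigma_freq_irrational:
  assumes "\<alpha> \<in> Sigma_freq \<gamma> \<sigma>" "\<gamma> > 0" shows "\<alpha> \<notin> \<rat>"
proof
  assume r: "\<alpha> \<in> \<rat>"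
  have "(gauss_map ^^ k) \<alpha> \<in> \<rat>" for k by (induction k) (auto intro: r gauss_map_rational)
  moreover have "\<exists>k\<ge>0. (gauss_map ^^ k) \<alpha> \<in> CD \<gamma> \<sigma>"
    using assms(1) unfolding Sigma_freq_def by blast
  ultimately show False using CD_irrational assms(2) by blast
qed

lemma irrational_multiples:
  fixes \<alpha> :: real
  assumes "\<alpha> \<notin> \<rat>" "0 < k" shows "real k * \<alpha> \<notin> \<int>"
proof
  assume "real k * \<alpha> \<in> \<int>"
  then obtain m :: int where "real k * \<alpha> = of_int m" by (auto elim: Ints_cases)
  then have "\<alpha> = of_int m / of_nat k" using assms(2) by (simp add: field_simps)
  then show False using assms(1) by (metis Rats_divide Rats_of_int Rats_of_nat)
qed

section \<open>Density of positive exponents\<close>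

lemma bump_smooth: "smooth (bump n)"
  unfolding bump_def by (intro smooth_power smooth_sin)

text \<open>For \<open>\<bar>x\<bar> \<le> R\<close> the members of the family with bumps as profiles stay in the ball if \<open>R \<le> \<epsilon> / 4\<close> and
  the coefficients \<open>s n\<close> compensate the derivatives of the bumps. Nonpositive exponents throughout the
  ball would thus contradict \<open>no_zero_exponents\<close>.\<close>
theorem positive_exponent_in_ball:
  assumes irr: "\<alpha> \<notin> \<rat>" and V: "V \<in> smooth_circle" and \<epsilon>: "0 < \<epsilon>"
  shows "\<exists>W \<in> Cr_ball r V \<epsilon>. 0 < lyapunov \<alpha> (schrodinger W)"
proof (rule ccontr)
  assume "\<not> ?thesis"
  then have neg: "lyapunov \<alpha> (schrodinger W) \<le> 0" if "W \<in> Cr_ball r V \<epsilon>" for W using that by force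
  have Vs: "smooth V" and Vp: "V (x + 1) = V x" for x using V by (auto simp: smooth_circle_iff)
  define R where "R = min 1 (\<epsilon> / 4)"
  have R: "0 < R" "R \<le> 1" using \<epsilon> by (auto simp: R_def)
  have R4: "R \<le> \<epsilon> / 4" by (simp add: R_def)
  obtain M0 where M0: "\<And>\<theta>. \<bar>V \<theta>\<bar> \<le> M0"
    using periodic_continuous_bounded[OF Vp smooth_continuous[OF Vs]] by blast
  have fam: "family R V M0"
    by unfold_locales (use R M0 Vp smooth_continuous[OF Vs] in auto)
  have "\<exists>K\<ge>0. \<forall>c k. Cr_norm r (\<lambda>x. c + k * bump n x) \<le> \<bar>c\<bar> + \<bar>k\<bar> * K" for n
    by (rule Cr_norm_affine_le[OF bump_smooth bump_periodic])
  then obtain K where K: "\<And>n. 0 \<le> K n" "\<And>n c k. Cr_norm r (\<lambda>x. c + k * bump n x) \<le> \<bar>c\<bar> + \<bar>k\<bar> * K n" by metis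
  \<comment> \<open>The three bounds make the profiles admissible, keep the potentials in the ball, and make
    \<open>s n\<close> negligible compared to \<open>mass (2 * n)\<close>.\<close>
  define s where "s n = min (1 / 600) (min (\<epsilon> / (2 * (K n + 1))) (mass (2 * n) / real (Suc n)))" for n
  have K1: "0 < K n + 1" for n using K(1)[of n] by linarith
  have s: "0 < s n" "s n \<le> 1 / 600" "s n \<le> \<epsilon> / (2 * (K n + 1))" "s n \<le> mass (2 * n) / real (Suc n)" for n
  proof -
    show "0 < s n" using \<epsilon> K1[of n] mass_pos[of "2 * n"] by (auto simp: s_def)
    show "s n \<le> 1 / 600" unfolding s_def by (rule min.cobounded1)
    show "s n \<le> \<epsilon> / (2 * (K n + 1))" unfolding s_def by (rule min.coboundedI2[OF min.cobounded1])
    show "s n \<le> mass (2 * n) / real (Suc n)" unfolding s_def by (rule min.coboundedI2[OF min.cobounded2])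
  qed
  have lim: "(\<lambda>n. s n / mass (2 * n)) \<longlonglongrightarrow> 0"
  proof (rule tendsto_sandwich[OF _ _ tendsto_const LIMSEQ_inverse_real_of_nat])
    show "\<forall>\<^sub>F n in sequentially. 0 \<le> s n / mass (2 * n)"
      using s(1) mass_pos by (intro always_eventually allI divide_nonneg_pos) (auto intro: less_imp_le)
    have "s n / mass (2 * n) \<le> inverse (real (Suc n))" for n
      using divide_right_mono[OF s(4)[of n], of "mass (2 * n)"] mass_pos[of "2 * n"]
      by (simp add: inverse_eq_divide del: of_nat_Suc)
    then show "\<forall>\<^sub>F n in sequentially. s n / mass (2 * n) \<le> inverse (real (Suc n))"
      by (intro always_eventually allI)
  qed
  have lyap: "lyapunov \<alpha> (schrodinger (\<lambda>\<theta>. V \<theta> + x + (R\<^sup>2 - x\<^sup>2) ^ 3 * (\<sigma> * bump n \<theta>))) \<le> 0"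
    if x: "\<bar>x\<bar> \<le> R" and \<sigma>: "\<sigma> \<in> {0, s n, - s n}" for n x \<sigma>
  proof (rule neg)
    let ?k = "(R\<^sup>2 - x\<^sup>2) ^ 3 * \<sigma>"
    have "x\<^sup>2 \<le> R\<^sup>2" using power_mono[OF x abs_ge_zero, of 2] by simp
    moreover have "R\<^sup>2 \<le> 1" using R by (simp add: power_le_one)
    ultimately have "\<bar>R\<^sup>2 - x\<^sup>2\<bar> \<le> 1" using zero_le_power2[of x] by linarith
    then have "\<bar>(R\<^sup>2 - x\<^sup>2) ^ 3\<bar> \<le> 1" unfolding power_abs by (intro power_le_one) auto
    moreover have "\<bar>\<sigma>\<bar> \<le> s n" using \<sigma> s(1)[of n] by auto
    ultimately have k: "\<bar>?k\<bar> \<le> s n" unfolding abs_mult using mult_mono[of _ 1 "\<bar>\<sigma>\<bar>" "s n"] s(1)[of n] by fastforce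
    have "(\<lambda>\<theta>. V \<theta> + x + ?k * bump n \<theta>) \<in> smooth_circle"
      unfolding smooth_circle_iff
      by (auto simp: Vp bump_periodic intro!: smooth_add smooth_mult smooth_const bump_smooth Vs)
    moreover have "Cr_norm r (\<lambda>\<theta>. (V \<theta> + x + ?k * bump n \<theta>) - V \<theta>) < \<epsilon>"
    proof -
      have "\<bar>?k\<bar> * K n \<le> s n * (K n + 1)" using k K(1)[of n] s(1)[of n] by (intro mult_mono) auto
      also have "\<dots> \<le> \<epsilon> / (2 * (K n + 1)) * (K n + 1)" using s(3)[of n] K1[of n] by (intro mult_right_mono) auto
      also have "\<dots> = \<epsilon> / 2"
      proof -
        have "\<epsilon> / (2 * t) * t = \<epsilon> / 2" if "0 < t" for t using that by simp
        then show ?thesis using K1[of n] .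
      qed
      finally have kK: "\<bar>?k\<bar> * K n \<le> \<epsilon> / 2" .
      have eq: "(\<lambda>\<theta>. (V \<theta> + x + ?k * bump n \<theta>) - V \<theta>) = (\<lambda>\<theta>. x + ?k * bump n \<theta>)" by (simp add: fun_eq_iff)
      have "Cr_norm r (\<lambda>\<theta>. x + ?k * bump n \<theta>) \<le> \<bar>x\<bar> + \<bar>?k\<bar> * K n" by (rule K(2))
      then show ?thesis unfolding eq using kK x R4 \<epsilon> by linarith
    qed
    ultimately show "(\<lambda>\<theta>. V \<theta> + x + (R\<^sup>2 - x\<^sup>2) ^ 3 * (\<sigma> * bump n \<theta>)) \<in> Cr_ball r V \<epsilon>"
      by (simp add: Cr_ball_def mult.assoc)
  qed
  show False
    by (rule family.no_zero_exponents[OF fam irrational_multiples[OF irr] s(1) s(2) lim lyap])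
qed

theorem corollary2p3:
  fixes \<gamma> \<sigma> \<alpha> :: real
  assumes "\<gamma> > 0" and "\<sigma> > 1"
    and "measure gauss_measure (CD \<gamma> \<sigma> \<inter> gauss_preimage (CD \<gamma> \<sigma>))
      > 1 - measure gauss_measure ({1/5<..1/4} \<inter> gauss_preimage {1/5<..1/4})"
    and "\<alpha> \<in> Sigma_freq \<gamma> \<sigma>"
  shows "smooth_circle_topology closure_of
      {V \<in> smooth_circle. lyapunov \<alpha> (schrodinger V) > 0} = smooth_circle"
proof
  show "smooth_circle_topology closure_of {V \<in> smooth_circle. lyapunov \<alpha> (schrodinger V) > 0} \<subseteq> smooth_circle"
    using closure_of_subset_topspace[of smooth_circle_topology] by (simp add: topspace_smooth_circle)
  show "smooth_circle \<subseteq> smooth_circle_topology closure_of {V \<in> smooth_circle. lyapunov \<alpha> (schrodinger V) > 0}"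
  proof
    fix V assume V: "V \<in> smooth_circle"
    have irr: "\<alpha> \<notin> \<rat>" by (rule Sigma_freq_irrational[OF assms(4) assms(1)])
    have "\<exists>W\<in>{V \<in> smooth_circle. lyapunov \<alpha> (schrodinger V) > 0}. W \<in> U"
      if U: "V \<in> U" "openin smooth_circle_topology U" for U
    proof -
      obtain r \<epsilon> where "\<epsilon> > 0" "Cr_ball r V \<epsilon> \<subseteq> U" using U by (auto simp: openin_smooth_circle)
      then show ?thesis
        using positive_exponent_in_ball[OF irr V, of \<epsilon> r] by (auto simp: Cr_ball_def)
    qed
    then show "V \<in> smooth_circle_topology closure_of {V \<in> smooth_circle. lyapunov \<alpha> (schrodinger V) > 0}"
      using V by (auto simp: in_closure_of topspace_smooth_circle)
  qed
qed

end
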